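(* Let $p\geq 3$ and let $f:2\mathbb{T}^p\to 2\mathbb{T}^p$ be a continuous map such that $f(\mathbb{T}^p_1)\subset\mathbb{T}^p_1$, $f(\mathbb{T}^p_2)\subset\mathbb{T}^p_2$ and $f(S^{p-1})\subset S^{p-1}$. Suppose moreover that $f$, $\tilde f_1$ and $\tilde f_2$ are open maps. (1) If $N(\tilde f_i)=\varLambda(\tilde f_i,\mathbb{T}^p)$ for both $i=1,2$, then $$N(f;\overline{\mathbb{T}^p_1}\cup\overline{\mathbb{T}^p_2})\geq\varLambda(f,2\mathbb{T}^p)-\varLambda(f_{|S^{p-1}},S^{p-1})-1.$$ (2) If $N(\tilde f_i)=-\varLambda(\tilde f_i,\mathbb{T}^p)$ for both $i=1,2$, then $$N(f;\overline{\mathbb{T}^p_1}\cup\overline{\mathbb{T}^p_2})\geq-\varLambda(f,2\mathbb{T}^p)+\varLambda(f_{|S^{p-1}},S^{p-1})-5.$$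
   Context: $\mathbb{T}^p=S^1\times\cdots\times S^1$ ($p$ factors) is the $p$-torus and $2\mathbb{T}^p$ is the connected sum of two $p$-tori. It is described as the disjoint union of a sphere $S^{p-1}$ (the connecting sphere) and two open subsets $\mathbb{T}^p_1$, $\mathbb{T}^p_2$, each of which is a $p$-torus with a (closed) $p$-disk removed; $\overline{\mathbb{T}^p_i}=\mathbb{T}^p_i\cup S^{p-1}$ is the closure of $\mathbb{T}^p_i$ in $2\mathbb{T}^p$. For $i=1,2$, $\tilde f_i:\mathbb{T}^p\to\mathbb{T}^p$ is the extension of $f_{|\mathbb{T}^p_i}$ to the one-point (Alexandroff) compactification of $\mathbb{T}^p_i$, which is the $p$-torus $\mathbb{T}^p=\overline{\mathbb{T}^p_i}/S^{p-1}$; the point at infinity is fixed. $\varLambda(\cdot,\cdot)$ is the usual Lefschetz number, and $N(\tilde f_i)$ is the classical Nielsen number of $\tilde f_i:\mathbb{T}^p\to\mathbb{T}^p$. For a suitable simplicial complex $X=A_1\cup A_2$ with subcomplexes $A_1,A_2$, and a map $f:X\to X$ with $f(A_i)\subset A_i$ for $i=1,2$, $N(f;A_1\cup A_2)$ is the Nielsen number of a triad (H. Schirmer): the minimum number of fixed points of maps homotopic to $f$ under a homotopy that preserves $A_1$ and $A_2$ (i.e. every stage maps $A_1$ into $A_1$ and $A_2$ into $A_2$). *)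

theory Defs
  imports "HOL-Analysis.Analysis" "HOL-Homology.Homology"
begin

section \<open>The connected sum of two tori\<close>

definition quotient_topology :: "'a topology \<Rightarrow> ('a \<Rightarrow> 'b) \<Rightarrow> 'b topology" where
  "quotient_topology X q =
     topology (\<lambda>U. U \<subseteq> q ` topspace X \<and> openin X {x \<in> topspace X. q x \<in> U})"

lemma openin_quotient_topology:
  "openin (quotient_topology X q) U \<longleftrightarrow>
     U \<subseteq> q ` topspace X \<and> openin X {x \<in> topspace X. q x \<in> U}"
proof -
  have "istopology (\<lambda>U. U \<subseteq> q ` topspace X \<and> openin X {x \<in> topspace X. q x \<in> U})"
    unfolding istopology_def
  proof (intro conjI allI impI)
    fix S T
    assume S: "S \<subseteq> q ` topspace X \<and> openin X {x \<in> topspace X. q x \<in> S}"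
      and T: "T \<subseteq> q ` topspace X \<and> openin X {x \<in> topspace X. q x \<in> T}"
    have "{x \<in> topspace X. q x \<in> S \<inter> T} =
            {x \<in> topspace X. q x \<in> S} \<inter> {x \<in> topspace X. q x \<in> T}"
      by blast
    then show "openin X {x \<in> topspace X. q x \<in> S \<inter> T}"
      using S T by auto
    show "S \<inter> T \<subseteq> q ` topspace X"
      using S by blast
  next
    fix \<K>
    assume K: "\<forall>K\<in>\<K>. K \<subseteq> q ` topspace X \<and> openin X {x \<in> topspace X. q x \<in> K}"
    have "{x \<in> topspace X. q x \<in> \<Union>\<K>} = (\<Union>K\<in>\<K>. {x \<in> topspace X. q x \<in> K})"
      by blast
    then show "openin X {x \<in> topspace X. q x \<in> \<Union>\<K>}"
      using K by auto
    show "\<Union>\<K> \<subseteq> q ` topspace X"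
      using K by blast
  qed
  then show ?thesis
    by (simp add: quotient_topology_def)
qed

lemma topspace_quotient_topology [simp]:
  "topspace (quotient_topology X q) = q ` topspace X"
proof -
  have "{x \<in> topspace X. q x \<in> q ` topspace X} = topspace X"
    by blast
  then have "openin (quotient_topology X q) (q ` topspace X)"
    by (simp add: openin_quotient_topology)
  then show ?thesis
    by (metis openin_quotient_topology openin_subset openin_topspace subset_antisym)
qed

lemma quotient_map_quotient_topology: "quotient_map X (quotient_topology X q) q"
  by (auto simp: quotient_map_def openin_quotient_topology)

definition torus :: "nat \<Rightarrow> (nat \<Rightarrow> complex) topology" where
  "torus p = product_topology (\<lambda>_. top_of_set (sphere (0::complex) 1)) {..<p}"

definition torus_exp :: "nat \<Rightarrow> (nat \<Rightarrow> real) \<Rightarrow> (nat \<Rightarrow> complex)" where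
  "torus_exp p \<theta> = (\<lambda>i\<in>{..<p}. cis (\<theta> i))"

text \<open>The map \<^const>\<open>torus_exp\<close> is injective on points with all coordinates in \<open>]-\<pi>, \<pi>[\<close>, hence
  embeds the closed unit ball of \<open>\<real>\<^sup>p\<close> in the torus.\<close>

definition torus_disc :: "nat \<Rightarrow> (nat \<Rightarrow> complex) set" where
  "torus_disc p = torus_exp p ` {\<theta>. (\<Sum>i<p. (\<theta> i)\<^sup>2) \<le> 1}"

definition torus_disc_boundary :: "nat \<Rightarrow> (nat \<Rightarrow> complex) set" where
  "torus_disc_boundary p = torus_exp p ` {\<theta>. (\<Sum>i<p. (\<theta> i)\<^sup>2) = 1}"

definition bordered_torus :: "nat \<Rightarrow> (nat \<Rightarrow> complex) topology" where
  "bordered_torus p =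
     subtopology (torus p) (topspace (torus p) - (torus_disc p - torus_disc_boundary p))"

text \<open>Two copies, tagged 1 and 2, of the torus minus an open disc are glued along their boundary
  spheres by the identity; a point of the glued sphere gets the tag 0. Since the torus has an
  orientation-reversing self-homeomorphism, this is the connected sum for either choice of
  orientations.\<close>

definition glue :: "nat \<Rightarrow> nat \<times> (nat \<Rightarrow> complex) \<Rightarrow> nat \<times> (nat \<Rightarrow> complex)" where
  "glue p = (\<lambda>(i, x). (if x \<in> torus_disc_boundary p then 0 else i, x))"

definition double_torus :: "nat \<Rightarrow> (nat \<times> (nat \<Rightarrow> complex)) topology" where
  "double_torus p = quotient_topology (sum_topology (\<lambda>_. bordered_torus p) {1, 2}) (glue p)"

definition torus_part :: "nat \<Rightarrow> nat \<Rightarrow> (nat \<times> (nat \<Rightarrow> complex)) set" where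
  "torus_part p i = {i} \<times> (topspace (torus p) - torus_disc p)"

definition connecting_sphere :: "nat \<Rightarrow> (nat \<times> (nat \<Rightarrow> complex)) set" where
  "connecting_sphere p = {0} \<times> torus_disc_boundary p"

lemma topspace_double_torus:
  "topspace (double_torus p) = torus_part p 1 \<union> torus_part p 2 \<union> connecting_sphere p"
proof -
  have sub: "torus_disc_boundary p \<subseteq> topspace (torus p)"
    by (auto simp: torus_disc_boundary_def torus_exp_def torus_def split: if_splits)
  have sub': "torus_disc_boundary p \<subseteq> torus_disc p"
    by (auto simp: torus_disc_boundary_def torus_disc_def)
  have "topspace (bordered_torus p) =
          (topspace (torus p) - torus_disc p) \<union> torus_disc_boundary p"
    using sub sub' by (auto simp: bordered_torus_def)
  then show ?thesis
    using sub' unfolding double_torus_def topspace_quotient_topology topspace_sum_topology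
    by (auto simp: glue_def torus_part_def connecting_sphere_def image_iff split: if_splits)
qed

text \<open>For a subspace \<open>T\<close> that \<open>f\<close> maps into itself, the extension of \<open>f\<close> to
  \<^term>\<open>Alexandroff_compactification (subtopology X T)\<close> that fixes the point \<^const>\<open>None\<close> at
  infinity is \<^term>\<open>map_option f\<close>. The compactification of \<^term>\<open>torus_part p i\<close> is a
  \<open>p\<close>-torus, obtained by collapsing the closed disc to a point.\<close>

abbreviation compactified_part ::
    "nat \<Rightarrow> nat \<Rightarrow> (nat \<times> (nat \<Rightarrow> complex)) option topology" where
  "compactified_part p i \<equiv>
     Alexandroff_compactification (subtopology (double_torus p) (torus_part p i))"


section \<open>Lefschetz numbers\<close>

definition rational_basis :: "('a, 'b) monoid_scheme \<Rightarrow> 'a set \<Rightarrow> bool" where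
  "rational_basis G B \<longleftrightarrow>
     finite B \<and> B \<subseteq> carrier G \<and>
     (\<forall>c :: 'a \<Rightarrow> int. (\<Otimes>\<^bsub>G\<^esub>b\<in>B. b [^]\<^bsub>G\<^esub> c b) = \<one>\<^bsub>G\<^esub> \<longrightarrow> (\<forall>b\<in>B. c b = 0)) \<and>
     (\<forall>x\<in>carrier G. \<exists>n :: int. \<exists>c :: 'a \<Rightarrow> int.
        n \<noteq> 0 \<and> x [^]\<^bsub>G\<^esub> n = (\<Otimes>\<^bsub>G\<^esub>b\<in>B. b [^]\<^bsub>G\<^esub> c b))"

text \<open>The trace of \<open>\<phi> \<otimes> \<rat>\<close> on \<open>G \<otimes> \<rat>\<close>, for an abelian group \<open>G\<close> (written multiplicatively) of
  finite rank: in a basis \<open>B\<close> of \<open>G \<otimes> \<rat>\<close> consisting of elements of \<open>G\<close>, the matrix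
  entries of \<open>\<phi> \<otimes> \<rat>\<close> are \<open>c b b' / n b\<close>.\<close>

definition rational_trace :: "('a, 'b) monoid_scheme \<Rightarrow> ('a \<Rightarrow> 'a) \<Rightarrow> real" where
  "rational_trace G \<phi> =
     (THE t. \<exists>B. \<exists>n :: 'a \<Rightarrow> int. \<exists>c :: 'a \<Rightarrow> 'a \<Rightarrow> int.
        rational_basis G B \<and>
        (\<forall>b\<in>B. n b \<noteq> 0 \<and> \<phi> b [^]\<^bsub>G\<^esub> n b = (\<Otimes>\<^bsub>G\<^esub>b'\<in>B. b' [^]\<^bsub>G\<^esub> c b b')) \<and>
        t = (\<Sum>b\<in>B. of_int (c b b) / of_int (n b)))"

definition homology_trace :: "nat \<Rightarrow> 'a topology \<Rightarrow> ('a \<Rightarrow> 'a) \<Rightarrow> real" where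
  "homology_trace k X f =
     rational_trace (homology_group (int k) X) (hom_induced (int k) X {} X {} f)"

definition lefschetz_number :: "('a \<Rightarrow> 'a) \<Rightarrow> 'a topology \<Rightarrow> real" where
  "lefschetz_number f X =
     (\<Sum>k | homology_trace k X f \<noteq> 0. (-1) ^ k * homology_trace k X f)"


section \<open>Fixed point index and Nielsen numbers\<close>

definition fixed_points :: "'a topology \<Rightarrow> ('a \<Rightarrow> 'a) \<Rightarrow> 'a set" where
  "fixed_points X f = {x \<in> topspace X. f x = x}"

text \<open>Dold's definition of the index of \<open>g : U \<rightarrow> \<real>\<^sup>n\<close>, for \<open>U\<close> open in \<open>\<real>\<^sup>n\<close> and compact
  fixed point set \<open>K\<close>. Given a ball \<open>D\<close> around 0 containing \<open>K\<close>, a class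
  \<open>c \<in> H\<^sub>n(\<real>\<^sup>n, \<real>\<^sup>n - D) \<cong> \<int>\<close> restricts to \<open>H\<^sub>n(\<real>\<^sup>n, \<real>\<^sup>n - K)\<close>, corresponds by excision
  to a class \<open>z \<in> H\<^sub>n(U, U - K)\<close>, and is sent by \<open>id - g\<close> to \<open>k\<close> times its restriction to
  \<open>H\<^sub>n(\<real>\<^sup>n, \<real>\<^sup>n - 0)\<close>. Letting \<open>c\<close> range over all classes avoids choosing a generator.\<close>

definition has_euclidean_index ::
    "nat \<Rightarrow> (nat \<Rightarrow> real) set \<Rightarrow> ((nat \<Rightarrow> real) \<Rightarrow> (nat \<Rightarrow> real)) \<Rightarrow> int \<Rightarrow> bool" where
  "has_euclidean_index n U g k \<longleftrightarrow>
     (let E = Euclidean_space n; K = {v \<in> U. g v = v} in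
        openin E U \<and> continuous_map (subtopology E U) E g \<and> compactin E K \<and>
        (\<exists>R\<ge>0. let D = {v \<in> topspace E. (\<Sum>i<n. (v i)\<^sup>2) \<le> R\<^sup>2} in
           K \<subseteq> D \<and>
           (\<forall>c \<in> carrier (relative_homology_group (int n) E (topspace E - D)).
            \<forall>z \<in> carrier (relative_homology_group (int n) (subtopology E U) (U - K)).
              hom_induced (int n) (subtopology E U) (U - K) E (topspace E - K) id z =
              hom_induced (int n) E (topspace E - D) E (topspace E - K) id c \<longrightarrow>
              hom_induced (int n) (subtopology E U) (U - K) E (topspace E - {\<lambda>i. 0})
                (\<lambda>v i. v i - g v i) z =
              hom_induced (int n) E (topspace E - D) E (topspace E - {\<lambda>i. 0}) id c
                [^]\<^bsub>relative_homology_group (int n) E (topspace E - {\<lambda>i. 0})\<^esub> k)))"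

text \<open>The index of an isolated compact set \<open>F\<close> of fixed points of \<open>f : X \<rightarrow> X\<close>, for \<open>X\<close> a
  Euclidean neighbourhood retract: realise \<open>X\<close> as a retract \<open>X \<rightarrow>\<^sup>e V \<rightarrow>\<^sup>r X\<close> of an open \<open>V \<subseteq> \<real>\<^sup>n\<close>
  and take the index of \<open>e \<circ> f \<circ> r\<close> on the inverse image of an open \<open>W \<subseteq> X\<close> that contains no
  other fixed points. The value is independent of the choices of \<open>n\<close>, \<open>V\<close>, \<open>e\<close>, \<open>r\<close> and \<open>W\<close>.\<close>

definition has_fixed_point_index ::
    "'a topology \<Rightarrow> ('a \<Rightarrow> 'a) \<Rightarrow> 'a set \<Rightarrow> int \<Rightarrow> bool" where
  "has_fixed_point_index X f F k \<longleftrightarrow>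
     (\<exists>n V r e W.
        openin (Euclidean_space n) V \<and>
        retraction_maps (subtopology (Euclidean_space n) V) X r e \<and>
        openin X W \<and> fixed_points X f \<inter> W = F \<and>
        has_euclidean_index n {v \<in> V. r v \<in> W} (\<lambda>v. e (f (r v))) k)"

definition nielsen_relation :: "'a topology \<Rightarrow> ('a \<Rightarrow> 'a) \<Rightarrow> ('a \<times> 'a) set" where
  "nielsen_relation X f =
     {(x, y). x \<in> fixed_points X f \<and> y \<in> fixed_points X f \<and>
        (\<exists>\<gamma>. homotopic_with (\<lambda>h. h 0 = x \<and> h 1 = y) (top_of_set {0..1::real}) X \<gamma> (f \<circ> \<gamma>))}"

definition nielsen_number :: "'a topology \<Rightarrow> ('a \<Rightarrow> 'a) \<Rightarrow> nat" where
  "nielsen_number X f =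
     card {F \<in> fixed_points X f // nielsen_relation X f.
             \<exists>k. has_fixed_point_index X f F k \<and> k \<noteq> 0}"

definition enat_card :: "'a set \<Rightarrow> enat" where
  "enat_card A = (if finite A then enat (card A) else \<infinity>)"

definition triad_nielsen_number ::
    "'a topology \<Rightarrow> 'a set \<Rightarrow> 'a set \<Rightarrow> ('a \<Rightarrow> 'a) \<Rightarrow> enat" where
  "triad_nielsen_number X A\<^sub>1 A\<^sub>2 f =
     (INF g \<in> {g. homotopic_with (\<lambda>h. h ` A\<^sub>1 \<subseteq> A\<^sub>1 \<and> h ` A\<^sub>2 \<subseteq> A\<^sub>2) X X f g}.
        enat_card (fixed_points X g))"

end

theory Submission
  imports Defs
begin

text \<open>Since a triad homotopy preserves both closed halves of the double torus, it descends to each of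
  the tori obtained by collapsing the other half. A Nielsen class of the collapsed map with nonzero
  index cannot disappear along the homotopy: on the fixed point set of the track of the homotopy, the
  local homology class that computes the index could otherwise be pushed to the final time and would
  vanish there. So \<open>N(f\<^sub>i)\<close> is at most the number of fixed points at the final time in the \<open>i\<close>-th open
  half, plus one for the point at infinity, and the triad Nielsen number is at least
  \<open>N(f\<^sub>1) + N(f\<^sub>2) - 2\<close>. On the other side, the sphere and the closed halves have collars, so that
  relative homology agrees with the homology of the quotients. Lefschetz numbers being additive for
  pairs, \<open>\<Lambda>(f\<^sub>1) + \<Lambda>(f\<^sub>2) = \<Lambda>(f) - \<Lambda>(f|S) + 2\<close>. This gives the lower bound \<open>\<Lambda>(f) - \<Lambda>(f|S)\<close> in the
  first case and \<open>-\<Lambda>(f) + \<Lambda>(f|S) - 4\<close> in the second.\<close>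

section \<open>Traces on abelian groups of finite rank\<close>

text \<open>\<open>rational_trace\<close> is a definite description over all rational bases, and
  \<open>lefschetz_number\<close> sums over all degrees with nonzero trace; neither can be computed
  before the homology groups are known to have finite rank and to vanish in high degrees. This
  finiteness travels a long way: from the torus to the torus modulo a disc, through the
  homeomorphism between the complement of the disc and \<open>torus_part\<close>, and back through
  the collapse to the pairs formed inside the double torus. The index is equally indirect. It is a
  relation, and a class is counted as soon as some nonzero integer is one of its indices;
  persistence is therefore proved for every retraction and every isolating neighbourhood that may
  witness such an integer. Finally, a stage of a triad homotopy may move points of an open half into
  the connecting sphere. In the collapsed torus such points must go to infinity, so the induced
  homotopy is not given by \<open>map_option\<close>.\<close>

definition finite_rank :: "('a, 'b) monoid_scheme \<Rightarrow> bool" where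
  "finite_rank G \<longleftrightarrow> (\<exists>B. rational_basis G B)"

text \<open>These functionals form the dual of G \<otimes> R. Testing elements against them replaces
  the construction of the tensor product and ignores torsion automatically.\<close>

definition real_additive :: "('a, 'b) monoid_scheme \<Rightarrow> ('a \<Rightarrow> real) \<Rightarrow> bool" where
  "real_additive G h \<longleftrightarrow>
     (\<forall>x\<in>carrier G. \<forall>y\<in>carrier G. h (x \<otimes>\<^bsub>G\<^esub> y) = h x + h y)"

definition int_comb :: "('a, 'b) monoid_scheme \<Rightarrow> 'a set \<Rightarrow> ('a \<Rightarrow> int) \<Rightarrow> 'a" where
  "int_comb G S c = (\<Otimes>\<^bsub>G\<^esub>s\<in>S. s [^]\<^bsub>G\<^esub> c s)"

lemma real_additive_compose_hom:
  "real_additive H h \<Longrightarrow> \<phi> \<in> hom G H \<Longrightarrow> real_additive G (h \<circ> \<phi>)"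
  by (auto simp: real_additive_def hom_def Pi_iff)

context comm_group
begin

lemma real_additive_one: "real_additive G h \<Longrightarrow> h \<one> = 0"
  unfolding real_additive_def by (metis add_cancel_left_left l_one one_closed)

lemma real_additive_inv: "real_additive G h \<Longrightarrow> x \<in> carrier G \<Longrightarrow> h (inv x) = - h x"
  using real_additive_one[of h] unfolding real_additive_def
  by (metis add.inverse_unique inv_closed r_inv)

lemma real_additive_nat_pow:
  "real_additive G h \<Longrightarrow> x \<in> carrier G \<Longrightarrow> h (x [^] (n::nat)) = real n * h x"
  by (induction n) (auto simp: real_additive_one real_additive_def algebra_simps)

lemma real_additive_int_pow:
  assumes "real_additive G h" "x \<in> carrier G"
  shows "h (x [^] (n::int)) = of_int n * h x"
proof (cases "n \<ge> 0")
  case True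
  then obtain m where "n = int m"
    using nonneg_int_cases by blast
  then show ?thesis
    using assms by (simp add: int_pow_int real_additive_nat_pow)
next
  case False
  then obtain m where "n = - int m"
    using that[of "nat (- n)"] by simp
  then show ?thesis
    using assms by (simp add: int_pow_neg int_pow_int real_additive_nat_pow real_additive_inv)
qed

lemma int_comb_closed [simp]: "S \<subseteq> carrier G \<Longrightarrow> int_comb G S c \<in> carrier G"
  unfolding int_comb_def by (intro finprod_closed) auto

lemma real_additive_int_comb:
  assumes h: "real_additive G h" and "finite S" "S \<subseteq> carrier G"
  shows "h (int_comb G S c) = (\<Sum>s\<in>S. of_int (c s) * h s)"
  using assms(2,3)
proof (induction S rule: finite_induct)
  case empty
  then show ?case by (simp add: int_comb_def real_additive_one[OF h])
next
  case (insert s S)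
  have "(\<lambda>s. s [^] c s) \<in> S \<rightarrow> carrier G" using insert by auto
  then have "int_comb G (insert s S) c = s [^] c s \<otimes> int_comb G S c"
    using insert by (simp add: int_comb_def)
  moreover have "int_comb G S c \<in> carrier G" "s [^] c s \<in> carrier G" using insert by auto
  ultimately show ?case
    using insert h real_additive_int_pow[OF h, of s "c s"] by (simp add: real_additive_def)
qed

lemma int_comb_add:
  assumes "S \<subseteq> carrier G"
  shows "int_comb G S (\<lambda>s. c s + d s) = int_comb G S c \<otimes> int_comb G S d"
proof -
  have "int_comb G S (\<lambda>s. c s + d s) = (\<Otimes>s\<in>S. s [^] c s \<otimes> s [^] d s)"
    unfolding int_comb_def
    by (rule finprod_cong') (use assms in \<open>auto simp: int_pow_mult\<close>)
  also have "\<dots> = int_comb G S c \<otimes> int_comb G S d"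
    unfolding int_comb_def using assms by (intro finprod_multf) auto
  finally show ?thesis .
qed

lemma int_comb_zero: "int_comb G S (\<lambda>_. 0) = \<one>"
  by (simp add: int_comb_def)

lemma int_comb_uminus:
  assumes "S \<subseteq> carrier G"
  shows "int_comb G S (\<lambda>s. - c s) = inv (int_comb G S c)"
proof -
  have "int_comb G S (\<lambda>s. - c s) \<otimes> int_comb G S c = \<one>"
    using int_comb_add[OF assms, of "\<lambda>s. - c s" c] by (simp add: int_comb_zero)
  then show ?thesis
    using assms by (metis int_comb_closed inv_equality)
qed

lemma int_comb_int_pow:
  assumes "S \<subseteq> carrier G"
  shows "int_comb G S c [^] (n::int) = int_comb G S (\<lambda>s. n * c s)"
proof -
  have nat: "int_comb G S c [^] (m::nat) = int_comb G S (\<lambda>s. int m * c s)" for m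
  proof (induction m)
    case (Suc m)
    have eq: "(\<lambda>s. int (Suc m) * c s) = (\<lambda>s. int m * c s + c s)"
      by (auto simp: algebra_simps)
    show ?case
      unfolding eq int_comb_add[OF assms] using Suc by simp
  qed (simp add: int_comb_zero)
  show ?thesis
  proof (cases "n \<ge> 0")
    case True
    then obtain m where "n = int m"
      using nonneg_int_cases by blast
    then show ?thesis by (simp add: nat int_pow_int)
  next
    case False
    then obtain m where "n = - int m"
      using that[of "nat (- n)"] by simp
    then show ?thesis
      using int_comb_uminus[OF assms, of "\<lambda>s. int m * c s"] assms
      by (simp add: nat int_pow_int int_pow_neg)
  qed
qed

lemma int_comb_single:
  assumes "finite S" "S \<subseteq> carrier G" "s \<in> S"
  shows "int_comb G S (\<lambda>t. if t = s then n else 0) = s [^] n"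
proof -
  have "int_comb G S (\<lambda>t. if t = s then n else 0) = (\<Otimes>t\<in>S. if t = s then t [^] n else \<one>)"
    unfolding int_comb_def
    by (rule finprod_cong') (use assms in \<open>auto simp: int_pow_mult\<close>)
  also have "\<dots> = s [^] n"
    using finprod_singleton_swap[of s S "\<lambda>t. t [^] n"] assms by auto
  finally show ?thesis .
qed

lemma generate_eq_int_comb:
  assumes "finite S" "S \<subseteq> carrier G"
  shows "generate G S = range (int_comb G S)"
proof
  have "subgroup (range (int_comb G S)) G"
  proof (rule subgroupI)
    fix a b assume "a \<in> range (int_comb G S)" "b \<in> range (int_comb G S)"
    then obtain c d where "a = int_comb G S c" "b = int_comb G S d" by auto
    then show "a \<otimes> b \<in> range (int_comb G S)" "inv a \<in> range (int_comb G S)"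
      by (simp_all flip: int_comb_add[OF assms(2)] int_comb_uminus[OF assms(2)])
  qed (use assms in auto)
  moreover have "s \<in> range (int_comb G S)" if "s \<in> S" for s
    using int_comb_single[OF assms that, of 1] that assms(2)
    by (intro range_eqI[where x = "\<lambda>t. if t = s then 1 else 0"]) auto
  ultimately show "generate G S \<subseteq> range (int_comb G S)"
    using generate_subgroup_incl by blast
next
  have sub: "subgroup (generate G S) G"
    using generate_is_subgroup assms by blast
  have "int_comb G T c \<in> generate G S" if "finite T" "T \<subseteq> S" for T c
    using that
  proof (induction T rule: finite_induct)
    case empty
    then show ?case by (simp add: int_comb_def generate.one)
  next
    case (insert s T)
    have "s [^] c s \<in> generate G S"
      using subgroup_int_pow_closed[OF sub] insert generate.incl[of s S G] by auto
    moreover have "int_comb G (insert s T) c = s [^] c s \<otimes> int_comb G T c"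
      unfolding int_comb_def using insert assms by (intro finprod_insert) auto
    ultimately show ?case
      using insert generate.eng[of "s [^] c s" G S] by auto
  qed
  then show "range (int_comb G S) \<subseteq> generate G S"
    using assms by auto
qed

text \<open>The functionals \<open>\<beta> b\<close> form the dual basis of \<open>B\<close>; the last condition says that
  \<open>\<Sum>b. \<beta> b \<otimes> b\<close> is the identity of \<open>G \<otimes> \<real>\<close>, tested against functionals.\<close>

definition dual_system :: "'a set \<Rightarrow> ('a \<Rightarrow> 'a \<Rightarrow> real) \<Rightarrow> bool" where
  "dual_system B \<beta> \<longleftrightarrow> finite B \<and> B \<subseteq> carrier G \<and> (\<forall>b\<in>B. real_additive G (\<beta> b)) \<and>
     (\<forall>h. real_additive G h \<longrightarrow> (\<forall>x\<in>carrier G. h x = (\<Sum>b\<in>B. \<beta> b x * h b)))"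

text \<open>The computation behind tr(PQ) = tr(QP): expand \<beta>' b' \<circ> \<phi> along
  \<open>B\<close>, exchange the sums, and contract the expansion of \<beta> b along
  \<open>B'\<close>.\<close>

lemma dual_system_trace_unique:
  assumes B: "dual_system B \<beta>" and B': "dual_system B' \<beta>'" and \<phi>: "\<phi> \<in> hom G G"
  shows "(\<Sum>b\<in>B. \<beta> b (\<phi> b)) = (\<Sum>b\<in>B'. \<beta>' b (\<phi> b))"
proof -
  have \<phi>c: "\<phi> x \<in> carrier G" if "x \<in> carrier G" for x
    using \<phi> that by (auto simp: hom_def)
  have "(\<Sum>b'\<in>B'. \<beta>' b' (\<phi> b')) = (\<Sum>b'\<in>B'. \<Sum>b\<in>B. \<beta> b b' * \<beta>' b' (\<phi> b))"
  proof (rule sum.cong)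
    fix b' assume "b' \<in> B'"
    then have add: "real_additive G (\<beta>' b' \<circ> \<phi>)" and b': "b' \<in> carrier G"
      using B' real_additive_compose_hom[OF _ \<phi>, of "\<beta>' b'"] by (auto simp: dual_system_def)
    have "(\<beta>' b' \<circ> \<phi>) b' = (\<Sum>b\<in>B. \<beta> b b' * (\<beta>' b' \<circ> \<phi>) b)"
      using B add b' unfolding dual_system_def by blast
    then show "\<beta>' b' (\<phi> b') = (\<Sum>b\<in>B. \<beta> b b' * \<beta>' b' (\<phi> b))"
      by simp
  qed simp
  also have "\<dots> = (\<Sum>b\<in>B. \<Sum>b'\<in>B'. \<beta>' b' (\<phi> b) * \<beta> b b')"
    by (subst sum.swap) (simp add: mult.commute)
  also have "\<dots> = (\<Sum>b\<in>B. \<beta> b (\<phi> b))"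
  proof (rule sum.cong)
    fix b assume b: "b \<in> B"
    then have "real_additive G (\<beta> b)" "\<phi> b \<in> carrier G"
      using B \<phi>c by (auto simp: dual_system_def)
    then show "(\<Sum>b'\<in>B'. \<beta>' b' (\<phi> b) * \<beta> b b') = \<beta> b (\<phi> b)"
      using B' by (simp add: dual_system_def)
  qed simp
  finally show ?thesis by simp
qed

section \<open>Coordinates in a rational basis and the trace\<close>

lemma rational_basis_iff:
  "rational_basis G B \<longleftrightarrow> finite B \<and> B \<subseteq> carrier G \<and>
     (\<forall>c. int_comb G B c = \<one> \<longrightarrow> (\<forall>b\<in>B. c b = 0)) \<and>
     (\<forall>x\<in>carrier G. \<exists>n c. n \<noteq> 0 \<and> x [^] (n::int) = int_comb G B c)"
  by (auto simp: rational_basis_def int_comb_def)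

text \<open>Cross-multiplying the two representations gives a relation among the basis
  elements.\<close>

lemma rational_basis_coeff_unique:
  assumes B: "rational_basis G B" and x: "x \<in> carrier G"
    and n: "n \<noteq> 0" "x [^] (n::int) = int_comb G B c"
    and m: "m \<noteq> 0" "x [^] (m::int) = int_comb G B d" and b: "b \<in> B"
  shows "real_of_int (c b) / of_int n = of_int (d b) / of_int m"
proof -
  have Bc: "B \<subseteq> carrier G" using B by (simp add: rational_basis_iff)
  have "int_comb G B (\<lambda>b. m * c b) = int_comb G B (\<lambda>b. n * d b)"
    unfolding int_comb_int_pow[OF Bc, symmetric] n(2)[symmetric] m(2)[symmetric]
    using x by (simp add: int_pow_pow mult.commute)
  then have "int_comb G B (\<lambda>b. m * c b + - (n * d b)) = \<one>"
    using int_comb_add[OF Bc, of "\<lambda>b. m * c b" "\<lambda>b. - (n * d b)"] Bc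
      int_comb_uminus[OF Bc, of "\<lambda>b. n * d b"] by simp
  then have "m * c b + - (n * d b) = 0"
    using B b unfolding rational_basis_iff by blast
  then have "real_of_int m * of_int (c b) = of_int n * of_int (d b)"
    by (simp flip: of_int_mult)
  then show ?thesis using n(1) m(1) by (simp add: field_simps)
qed

text \<open>The coordinate of x \<otimes> 1 at b. The exponent n that turns x into an integer
  combination is arbitrary; \<open>rational_basis_coeff_unique\<close> makes the quotient
  independent of the choice.\<close>

definition coord :: "'a set \<Rightarrow> 'a \<Rightarrow> 'a \<Rightarrow> real" where
  "coord B b x = (let p = (SOME (n::int, c). n \<noteq> 0 \<and> x [^] n = int_comb G B c)
                  in of_int (snd p b) / of_int (fst p))"

lemma coord_eq:
  assumes B: "rational_basis G B" and x: "x \<in> carrier G"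
    and n: "n \<noteq> 0" "x [^] (n::int) = int_comb G B c" and b: "b \<in> B"
  shows "coord B b x = of_int (c b) / of_int n"
proof -
  define p where "p = (SOME (n::int, c). n \<noteq> 0 \<and> x [^] n = int_comb G B c)"
  have "\<exists>p. case p of (n::int, c) \<Rightarrow> n \<noteq> 0 \<and> x [^] n = int_comb G B c" using n by auto
  then have "case p of (n, c) \<Rightarrow> n \<noteq> 0 \<and> x [^] n = int_comb G B c"
    unfolding p_def by (rule someI_ex)
  then have "fst p \<noteq> 0" "x [^] fst p = int_comb G B (snd p)" by (auto split: prod.splits)
  from rational_basis_coeff_unique[OF B x this n b] show ?thesis
    by (simp add: coord_def p_def Let_def)
qed

lemma coordE:
  assumes B: "rational_basis G B" and x: "x \<in> carrier G"
  obtains n c where "n \<noteq> 0" "x [^] (n::int) = int_comb G B c"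
    "\<And>b. b \<in> B \<Longrightarrow> coord B b x = of_int (c b) / of_int n"
  using B x coord_eq[OF B x] unfolding rational_basis_iff by blast

lemma coord_additive:
  assumes B: "rational_basis G B" and b: "b \<in> B"
  shows "real_additive G (coord B b)"
  unfolding real_additive_def
proof (intro ballI)
  fix x y assume x: "x \<in> carrier G" and y: "y \<in> carrier G"
  have Bc: "B \<subseteq> carrier G" using B by (simp add: rational_basis_iff)
  obtain n c where n: "n \<noteq> 0" "x [^] (n::int) = int_comb G B c" using coordE[OF B x] by metis
  obtain m d where m: "m \<noteq> 0" "y [^] (m::int) = int_comb G B d" using coordE[OF B y] by metis
  have "(x \<otimes> y) [^] (n * m) = (x [^] n) [^] m \<otimes> (y [^] m) [^] n"
    using x y by (simp add: int_pow_distrib int_pow_pow mult.commute)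
  also have "\<dots> = int_comb G B (\<lambda>b. m * c b + n * d b)"
    by (simp add: n m int_comb_int_pow[OF Bc] int_comb_add[OF Bc])
  finally have "(x \<otimes> y) [^] (n * m) = int_comb G B (\<lambda>b. m * c b + n * d b)" .
  then have "coord B b (x \<otimes> y) = of_int (m * c b + n * d b) / of_int (n * m)"
    using n(1) m(1) x y by (intro coord_eq[OF B _ _ _ b]) auto
  also have "\<dots> = of_int (c b) / of_int n + of_int (d b) / of_int m"
    using n(1) m(1) by (simp add: add_divide_distrib)
  finally show "coord B b (x \<otimes> y) = coord B b x + coord B b y"
    by (simp only: coord_eq[OF B x n b] coord_eq[OF B y m b])
qed

lemma rational_basis_dual_system:
  assumes B: "rational_basis G B"
  shows "dual_system B (coord B)"
  unfolding dual_system_def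
proof (intro conjI ballI allI impI)
  fix h x assume h: "real_additive G h" and x: "x \<in> carrier G"
  obtain n c where n: "n \<noteq> 0" "x [^] (n::int) = int_comb G B c"
    and c: "\<And>b. b \<in> B \<Longrightarrow> coord B b x = of_int (c b) / of_int n" using coordE[OF B x] by metis
  have "of_int n * h x = (\<Sum>b\<in>B. of_int (c b) * h b)"
    using B real_additive_int_pow[OF h x, of n] real_additive_int_comb[OF h, of B c] n(2)
    by (simp add: rational_basis_iff)
  then have "h x = (\<Sum>b\<in>B. of_int (c b) * h b) / of_int n" using n(1) by (simp add: field_simps)
  also have "\<dots> = (\<Sum>b\<in>B. coord B b x * h b)"
    by (simp add: sum_divide_distrib c)
  finally show "h x = (\<Sum>b\<in>B. coord B b x * h b)" .
qed (use B coord_additive[OF B] in \<open>auto simp: rational_basis_iff\<close>)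

lemma coord_basis:
  assumes B: "rational_basis G B" and b: "b \<in> B" and b': "b' \<in> B"
  shows "coord B b b' = (if b = b' then 1 else 0)"
proof -
  have "b' [^] (1::int) = int_comb G B (\<lambda>t. if t = b' then 1 else 0)" "b' \<in> carrier G"
    using B b' int_comb_single[of B b' 1] by (auto simp: rational_basis_iff)
  from coord_eq[OF B this(2) _ this(1) b] show ?thesis by simp
qed

text \<open>Shows that the definite description denotes: existence comes from choosing multiples for
  the images of the basis elements, uniqueness from comparing the dual systems of two bases.\<close>

lemma rational_trace_eq:
  assumes B: "rational_basis G B" and \<phi>: "\<phi> \<in> hom G G"
  shows "rational_trace G \<phi> = (\<Sum>b\<in>B. coord B b (\<phi> b))"
  unfolding rational_trace_def
proof (rule the_equality)
  have \<phi>c: "\<phi> x \<in> carrier G" if "x \<in> carrier G" for x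
    using \<phi> that by (auto simp: hom_def)
  have "\<exists>p. fst p \<noteq> 0 \<and> \<phi> b [^] (fst p :: int) = int_comb G B (snd p)" if "b \<in> B" for b
  proof -
    have "\<phi> b \<in> carrier G" using that B \<phi>c by (auto simp: rational_basis_iff)
    then show ?thesis using coordE[OF B] by (metis fst_conv snd_conv)
  qed
  then obtain p where p: "\<And>b. b \<in> B \<Longrightarrow> fst (p b) \<noteq> 0"
      "\<And>b. b \<in> B \<Longrightarrow> \<phi> b [^] (fst (p b) :: int) = int_comb G B (snd (p b))"
    by metis
  define n c where "n = fst \<circ> p" and "c = snd \<circ> p"
  have nc: "\<forall>b\<in>B. n b \<noteq> 0 \<and> \<phi> b [^] n b = int_comb G B (c b)"
    using p by (simp add: n_def c_def)
  have eq: "(\<Sum>b\<in>B. coord B b (\<phi> b)) = (\<Sum>b\<in>B. of_int (c b b) / of_int (n b))"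
  proof (rule sum.cong)
    fix b assume b: "b \<in> B"
    then have "\<phi> b \<in> carrier G" using B \<phi>c by (auto simp: rational_basis_iff)
    then show "coord B b (\<phi> b) = of_int (c b b) / of_int (n b)"
      using nc b coord_eq[OF B] by blast
  qed simp
  show "\<exists>B' n c. rational_basis G B' \<and>
      (\<forall>b\<in>B'. n b \<noteq> 0 \<and> \<phi> b [^] n b = (\<Otimes>b'\<in>B'. b' [^] c b b')) \<and>
      (\<Sum>b\<in>B. coord B b (\<phi> b)) = (\<Sum>b\<in>B'. of_int (c b b) / of_int (n b))"
    by (rule exI[of _ B], rule exI[of _ n], rule exI[of _ c], intro conjI B eq nc[unfolded int_comb_def])
  fix t :: real
  assume "\<exists>B' n c. rational_basis G B' \<and>
      (\<forall>b\<in>B'. n b \<noteq> 0 \<and> \<phi> b [^] n b = (\<Otimes>b'\<in>B'. b' [^] c b b')) \<and>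
      t = (\<Sum>b\<in>B'. of_int (c b b) / of_int (n b))"
  then obtain B' n c where B': "rational_basis G B'"
    and nc: "\<forall>b\<in>B'. n b \<noteq> 0 \<and> \<phi> b [^] n b = (\<Otimes>b'\<in>B'. b' [^] c b b')"
    and t: "t = (\<Sum>b\<in>B'. of_int (c b b) / of_int (n b))"
    by (elim exE conjE) (rule that)
  note nc = nc[folded int_comb_def]
  have "t = (\<Sum>b\<in>B'. coord B' b (\<phi> b))"
    unfolding t
  proof (rule sum.cong)
    fix b assume b: "b \<in> B'"
    then have "\<phi> b \<in> carrier G" using B' \<phi>c by (auto simp: rational_basis_iff)
    then show "of_int (c b b) / of_int (n b) = coord B' b (\<phi> b)"
      using nc b coord_eq[OF B', of "\<phi> b" "n b" "c b" b] by simp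
  qed simp
  also have "\<dots> = (\<Sum>b\<in>B. coord B b (\<phi> b))"
    using rational_basis_dual_system[OF B'] rational_basis_dual_system[OF B] \<phi>
    by (rule dual_system_trace_unique)
  finally show "t = (\<Sum>b\<in>B. coord B b (\<phi> b))" .
qed

end

text \<open>For S inside the subgroup H this says that H modulo the subgroup generated by S is
  torsion, that is, S spans H \<otimes> Q. Independence is left out, which makes the notion stable
  under images and extensions.\<close>

definition rationally_spans :: "('a, 'b) monoid_scheme \<Rightarrow> 'a set \<Rightarrow> 'a set \<Rightarrow> bool" where
  "rationally_spans G S H \<longleftrightarrow> (\<forall>x\<in>H. \<exists>n::int. n \<noteq> 0 \<and> x [^]\<^bsub>G\<^esub> n \<in> generate G S)"

context comm_group
begin

lemma generate_int_pow:
  "S \<subseteq> carrier G \<Longrightarrow> x \<in> generate G S \<Longrightarrow> x [^] (n::int) \<in> generate G S"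
  using subgroup_int_pow_closed generate_is_subgroup by blast

lemma rational_basis_iff_spans:
  "rational_basis G B \<longleftrightarrow> finite B \<and> B \<subseteq> carrier G \<and>
     (\<forall>c. int_comb G B c = \<one> \<longrightarrow> (\<forall>b\<in>B. c b = 0)) \<and> rationally_spans G B (carrier G)"
proof (cases "finite B \<and> B \<subseteq> carrier G")
  case True
  then have "generate G B = range (int_comb G B)" by (simp add: generate_eq_int_comb)
  then show ?thesis
    unfolding rational_basis_iff rationally_spans_def by (simp add: image_iff)
qed (auto simp: rational_basis_iff)

text \<open>The relation puts the power c b of b into the subgroup generated by the other elements.
  A combination representing a power of x therefore loses b after being raised to the power c b;
  since c b is nonzero, the exponent of x stays nonzero.\<close>

lemma rationally_spans_remove:
  assumes S: "finite S" "S \<subseteq> carrier G" "rationally_spans G S (carrier G)"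
    and c: "int_comb G S c = \<one>" and b: "b \<in> S" "c b \<noteq> 0"
  shows "rationally_spans G (S - {b}) (carrier G)"
  unfolding rationally_spans_def
proof
  fix x assume x: "x \<in> carrier G"
  define T where "T = S - {b}"
  have T: "finite T" "T \<subseteq> carrier G" "b \<notin> T" "S = insert b T"
    using S b by (auto simp: T_def)
  have bc: "b \<in> carrier G" using b S by blast
  have split: "int_comb G S d = b [^] d b \<otimes> int_comb G T d" for d
    unfolding int_comb_def T(4) using T bc by (intro finprod_insert) auto
  have gen: "int_comb G T d \<in> generate G T" for d
    using generate_eq_int_comb[OF T(1,2)] by simp
  have sub: "subgroup (generate G T) G" by (rule generate_is_subgroup[OF T(2)])
  have "b [^] c b = inv (int_comb G T c)"
    using c bc T split[of c] by (metis int_comb_closed int_pow_closed inv_equality)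
  then have bgen: "b [^] c b \<in> generate G T"
    using gen[of c] subgroup.m_inv_closed[OF sub] by simp
  obtain n d where n: "n \<noteq> 0" "x [^] (n::int) = int_comb G S d"
    using S x generate_eq_int_comb[OF S(1,2)] unfolding rationally_spans_def by (metis imageE)
  have "x [^] (n * c b) = (b [^] c b) [^] d b \<otimes> int_comb G T d [^] c b"
    using x bc T n split[of d]
    by (simp add: int_pow_pow[symmetric] int_pow_distrib) (simp add: int_pow_pow mult.commute)
  then have "x [^] (n * c b) \<in> generate G T"
    using bgen gen[of d] generate_int_pow[OF T(2)] subgroup.m_closed[OF sub] by simp
  then show "\<exists>n::int. n \<noteq> 0 \<and> x [^] n \<in> generate G (S - {b})"
    using n(1) b(2) unfolding T_def[symmetric] by (metis mult_eq_0_iff)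
qed

text \<open>As long as the spanning set satisfies a nontrivial relation, an element with nonzero
  coefficient can be discarded; the process ends at a basis.\<close>

lemma finite_rankI:
  assumes "finite S" "S \<subseteq> carrier G" "rationally_spans G S (carrier G)"
  shows "finite_rank G"
  using assms
proof (induction "card S" arbitrary: S rule: less_induct)
  case less
  show ?case
  proof (cases "\<forall>c. int_comb G S c = \<one> \<longrightarrow> (\<forall>b\<in>S. c b = 0)")
    case True
    then have "rational_basis G S" using less.prems by (simp add: rational_basis_iff_spans)
    then show ?thesis by (auto simp: finite_rank_def)
  next
    case False
    then obtain c b where "int_comb G S c = \<one>" "b \<in> S" "c b \<noteq> 0" by auto
    then have "rationally_spans G (S - {b}) (carrier G)" "card (S - {b}) < card S"
      using rationally_spans_remove[OF less.prems] less.prems card_Diff1_less[of S b]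
      by blast+
    then show ?thesis using less.hyps[of "S - {b}"] less.prems by auto
  qed
qed

text \<open>A substitute for dimension arguments over Q, by induction on the functionals. Let K be
  the kernel of h in H. If K is not H, one further element y with h y nonzero suffices: rational
  values give b * h x = a * h y with b nonzero, so x^b y^(-a) lies in K. With no functionals left, H
  is torsion and spanned by the empty set.\<close>

lemma subgroup_functionals_span:
  assumes "finite F" "subgroup H G" "\<And>h. h \<in> F \<Longrightarrow> real_additive G h"
    "\<And>h x. h \<in> F \<Longrightarrow> x \<in> H \<Longrightarrow> h x \<in> \<rat>"
    "\<And>x. x \<in> H \<Longrightarrow> (\<And>h. h \<in> F \<Longrightarrow> h x = 0) \<Longrightarrow> \<exists>n::int. n \<noteq> 0 \<and> x [^] n = \<one>"
  shows "\<exists>S. finite S \<and> S \<subseteq> H \<and> rationally_spans G S H"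
  using assms
proof (induction F arbitrary: H rule: finite_induct)
  case empty
  then have "rationally_spans G {} H"
    unfolding rationally_spans_def by (metis empty_iff generate.one)
  then show ?case by blast
next
  case (insert h F)
  have H: "H \<subseteq> carrier G" using insert.prems(1) subgroup.subset by blast
  have h: "real_additive G h" using insert.prems(2) by simp
  define K where "K = {x \<in> H. h x = 0}"
  have "subgroup K G"
  proof (rule subgroupI)
    show "K \<noteq> {}"
      using subgroup.one_closed[OF insert.prems(1)] real_additive_one[OF h] by (auto simp: K_def)
    fix a b assume "a \<in> K" "b \<in> K"
    then show "a \<otimes> b \<in> K" "inv a \<in> K"
      using subgroup.m_closed[OF insert.prems(1)] subgroup.m_inv_closed[OF insert.prems(1)]
        real_additive_inv[OF h] h H by (auto simp: K_def real_additive_def subset_iff)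
  qed (use H in \<open>auto simp: K_def\<close>)
  then have "\<exists>S. finite S \<and> S \<subseteq> K \<and> rationally_spans G S K"
  proof (rule insert.IH)
    show "\<exists>n::int. n \<noteq> 0 \<and> x [^] n = \<one>" if "x \<in> K" "\<And>h. h \<in> F \<Longrightarrow> h x = 0" for x
      by (rule insert.prems(4)) (use that in \<open>auto simp: K_def\<close>)
  qed (use insert.prems in \<open>auto simp: K_def\<close>)
  then obtain S where S: "finite S" "S \<subseteq> K" "rationally_spans G S K" by blast
  show ?case
  proof (cases "K = H")
    case True
    then show ?thesis using S by blast
  next
    case False
    then obtain y where y: "y \<in> H" "h y \<noteq> 0" by (auto simp: K_def)
    have sub: "insert y S \<subseteq> H" using y S by (auto simp: K_def)
    have gen: "subgroup (generate G (insert y S)) G"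
      using sub H by (intro generate_is_subgroup) auto
    have "rationally_spans G (insert y S) H"
      unfolding rationally_spans_def
    proof
      fix x assume x: "x \<in> H"
      have "h x / h y \<in> \<rat>" using insert.prems(3) x y by auto
      then obtain a b :: int where ab: "b \<noteq> 0" "h x / h y = of_int a / of_int b"
        by (metis Rats_cases' less_irrefl)
      then have hab: "of_int b * h x = of_int a * h y" using y by (simp add: field_simps)
      have xy: "x \<in> carrier G" "y \<in> carrier G" using x y H by auto
      define z where "z = x [^] b \<otimes> inv (y [^] a)"
      have "z \<in> H"
        unfolding z_def using x y insert.prems(1)
        by (simp add: subgroup.m_closed subgroup.m_inv_closed subgroup_int_pow_closed)
      moreover have "h z = of_int b * h x - of_int a * h y"
        using h xy real_additive_int_pow[OF h] real_additive_inv[OF h, of "y [^] a"]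
        unfolding z_def real_additive_def by simp
      ultimately have "z \<in> K" using hab by (simp add: K_def)
      then obtain n where n: "n \<noteq> 0" "z [^] (n::int) \<in> generate G S"
        using S(3) by (auto simp: rationally_spans_def)
      have zn: "z [^] n \<in> generate G (insert y S)"
        using n(2) mono_generate[of S "insert y S"] by auto
      have "y \<in> generate G (insert y S)" by (simp add: generate.incl)
      then have yn: "y [^] (a * n) \<in> generate G (insert y S)"
        using subgroup_int_pow_closed[OF gen] by blast
      have "x [^] b = z \<otimes> y [^] a"
        unfolding z_def using xy by (simp add: m_assoc)
      moreover have "z \<in> carrier G" using \<open>z \<in> H\<close> H by auto
      ultimately have "x [^] (b * n) = z [^] n \<otimes> y [^] (a * n)"
        using xy by (simp add: int_pow_pow[symmetric] int_pow_distrib)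
      then have "x [^] (b * n) \<in> generate G (insert y S)"
        using zn yn subgroup.m_closed[OF gen] by simp
      then show "\<exists>n::int. n \<noteq> 0 \<and> x [^] n \<in> generate G (insert y S)"
        using n(1) ab(1) by (metis mult_eq_0_iff)
    qed
    then show ?thesis using sub S(1) by blast
  qed
qed

text \<open>The coordinates in a basis of G take rational values and vanish simultaneously only on
  torsion elements, so they serve as the functionals.\<close>

lemma finite_rank_subgroup_span:
  assumes "finite_rank G" and H: "subgroup H G"
  shows "\<exists>S. finite S \<and> S \<subseteq> H \<and> rationally_spans G S H"
proof -
  obtain B where B: "rational_basis G B" using assms by (auto simp: finite_rank_def)
  have Hc: "H \<subseteq> carrier G" using H subgroup.subset by blast
  show ?thesis
  proof (rule subgroup_functionals_span[of "coord B ` B", OF _ H])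
    show "finite (coord B ` B)" using B by (simp add: rational_basis_iff)
  next
    fix h assume "h \<in> coord B ` B"
    then show "real_additive G h" using coord_additive[OF B] by auto
  next
    fix h x assume hx: "h \<in> coord B ` B" "x \<in> H"
    then have "x \<in> carrier G" using Hc by auto
    from coordE[OF B this] show "h x \<in> \<rat>" using hx(1)
      by (metis Rats_divide Rats_of_int imageE)
  next
    fix x assume x: "x \<in> H" "\<And>h. h \<in> coord B ` B \<Longrightarrow> h x = 0"
    then have "x \<in> carrier G" using Hc by auto
    from coordE[OF B this] obtain n c where n: "n \<noteq> 0" "x [^] (n::int) = int_comb G B c"
      and c: "\<And>b. b \<in> B \<Longrightarrow> coord B b x = of_int (c b) / of_int n" by metis
    have "c b = 0" if "b \<in> B" for b
      using c[OF that] x(2)[of "coord B b"] that n(1) by simp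
    then have "int_comb G B c = (\<Otimes>b\<in>B. \<one>)"
      unfolding int_comb_def by (intro finprod_cong') auto
    then show "\<exists>n::int. n \<noteq> 0 \<and> x [^] n = \<one>" using n by auto
  qed
qed

lemma rationally_spans_subgroup_generated:
  assumes H: "subgroup H G" and "S \<subseteq> H" and K: "K \<subseteq> H"
  shows "rationally_spans (subgroup_generated G H) S K \<longleftrightarrow> rationally_spans G S K"
proof -
  have Hc: "H \<subseteq> carrier G" using H subgroup.subset by blast
  have eq: "subgroup_generated G H = G\<lparr>carrier := H\<rparr>"
    using subgroup.carrier_subgroup_generated_subgroup[OF H] H Hc
    by (simp add: subgroup_generated_def)
  have "generate (subgroup_generated G H) S = generate G S"
    unfolding eq using generate_consistent[OF assms(2) H] by simp
  moreover have "x [^]\<^bsub>subgroup_generated G H\<^esub> (n::int) = x [^] n" if "x \<in> K" for x n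
    using that K subgroup.carrier_subgroup_generated_subgroup[OF H]
    by (intro int_pow_subgroup_generated) auto
  ultimately show ?thesis by (simp add: rationally_spans_def)
qed

end

section \<open>Finite rank of subgroups, extensions and images\<close>

lemma (in comm_group) finite_rank_subgroup:
  assumes "finite_rank G" and H: "subgroup H G"
  shows "finite_rank (subgroup_generated G H)"
proof -
  obtain S where S: "finite S" "S \<subseteq> H" "rationally_spans G S H"
    using finite_rank_subgroup_span[OF assms] by blast
  have cH: "carrier (subgroup_generated G H) = H"
    using subgroup.carrier_subgroup_generated_subgroup[OF H] .
  interpret K: comm_group "subgroup_generated G H"
    using abelian_subgroup_generated comm_group_axioms by blast
  show ?thesis
    using S cH rationally_spans_subgroup_generated[OF H S(2) order_refl]
    by (intro K.finite_rankI[of S]) auto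
qed

text \<open>Coefficients are indexed by group elements, hence the injectivity on S and the shape c
  (h s). With h = id it moves combinations from a subgroup structure to the ambient group.\<close>

lemma (in group_hom) hom_int_comb:
  assumes "finite S" "S \<subseteq> carrier G" "inj_on h S" "comm_group G" "comm_group H"
  shows "h (int_comb G S (\<lambda>s. c (h s))) = int_comb H (h ` S) c"
  using assms
proof (induction S rule: finite_induct)
  case empty
  then show ?case by (simp add: int_comb_def comm_monoid.finprod_empty comm_group.axioms)
next
  case (insert s S)
  interpret G: comm_group G by fact
  interpret H: comm_group H by fact
  have "int_comb G (insert s S) (\<lambda>s. c (h s)) =
      s [^]\<^bsub>G\<^esub> c (h s) \<otimes>\<^bsub>G\<^esub> int_comb G S (\<lambda>s. c (h s))"
    unfolding int_comb_def using insert.hyps insert.prems by (intro G.finprod_insert) auto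
  moreover have "int_comb H (insert (h s) (h ` S)) c =
      h s [^]\<^bsub>H\<^esub> c (h s) \<otimes>\<^bsub>H\<^esub> int_comb H (h ` S) c"
    unfolding int_comb_def using insert.hyps insert.prems by (intro H.finprod_insert) auto
  moreover have "int_comb G S (\<lambda>s. c (h s)) \<in> carrier G" using insert.prems by simp
  ultimately show ?case
    using insert.IH insert.prems hom_int_pow[of s "c (h s)"] by simp
qed

lemma rationally_spans_extension:
  assumes G: "comm_group G" and H: "comm_group H" and g: "g \<in> hom G H"
    and S: "S \<subseteq> carrier G" and T: "T \<subseteq> kernel G H g"
    and im: "rationally_spans H (g ` S) (g ` carrier G)"
    and ker: "rationally_spans G T (kernel G H g)"
  shows "rationally_spans G (T \<union> S) (carrier G)"
  unfolding rationally_spans_def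
proof
  interpret G: comm_group G by (rule G)
  interpret H: comm_group H by (rule H)
  interpret gh: group_hom G H g by (unfold_locales) (rule g)
  fix x assume x: "x \<in> carrier G"
  have Tc: "T \<subseteq> carrier G" using T by (auto simp: kernel_def)
  have sub: "subgroup (generate G (T \<union> S)) G"
    using S Tc by (intro G.generate_is_subgroup) auto
  obtain n where n: "n \<noteq> 0" "g x [^]\<^bsub>H\<^esub> (n::int) \<in> generate H (g ` S)"
    using im x by (auto simp: rationally_spans_def)
  then obtain y where y: "y \<in> generate G S" "g x [^]\<^bsub>H\<^esub> n = g y"
    using gh.generate_img[OF S] by auto
  have yc: "y \<in> carrier G" using y(1) G.generate_in_carrier[OF S] by simp
  define z where "z = x [^]\<^bsub>G\<^esub> n \<otimes>\<^bsub>G\<^esub> inv\<^bsub>G\<^esub> y"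
  have z: "z \<in> carrier G" using x yc by (simp add: z_def)
  have "g z = \<one>\<^bsub>H\<^esub>"
    using x yc y(2) gh.hom_int_pow[OF x, of n] by (simp add: z_def)
  then have "z \<in> kernel G H g" using z by (simp add: kernel_def)
  then obtain m where m: "m \<noteq> 0" "z [^]\<^bsub>G\<^esub> (m::int) \<in> generate G T"
    using ker by (auto simp: rationally_spans_def)
  have "x [^]\<^bsub>G\<^esub> n = z \<otimes>\<^bsub>G\<^esub> y"
    using x yc by (simp add: z_def G.m_assoc)
  then have "x [^]\<^bsub>G\<^esub> (n * m) = z [^]\<^bsub>G\<^esub> m \<otimes>\<^bsub>G\<^esub> y [^]\<^bsub>G\<^esub> m"
    using x yc z by (simp add: G.int_pow_pow[symmetric] G.int_pow_distrib)
  moreover have "z [^]\<^bsub>G\<^esub> m \<in> generate G (T \<union> S)"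
    using m(2) G.mono_generate[of T "T \<union> S"] by auto
  moreover have "y \<in> generate G (T \<union> S)"
    using y(1) G.mono_generate[of S "T \<union> S"] by auto
  ultimately have "x [^]\<^bsub>G\<^esub> (n * m) \<in> generate G (T \<union> S)"
    using G.subgroup_int_pow_closed[OF sub] subgroup.m_closed[OF sub] by simp
  then show "\<exists>n::int. n \<noteq> 0 \<and> x [^]\<^bsub>G\<^esub> n \<in> generate G (T \<union> S)"
    using n(1) m(1) by (metis mult_eq_0_iff)
qed

lemma rationally_spans_image:
  assumes g: "group_hom G H g" and S: "S \<subseteq> carrier G" and K: "K \<subseteq> carrier G"
    and sp: "rationally_spans G S K"
  shows "rationally_spans H (g ` S) (g ` K)"
  unfolding rationally_spans_def
proof
  interpret gh: group_hom G H g by (rule g)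
  fix y assume "y \<in> g ` K"
  then obtain x where x: "x \<in> K" "y = g x" by auto
  then obtain n where n: "n \<noteq> 0" "x [^]\<^bsub>G\<^esub> (n::int) \<in> generate G S"
    using sp by (auto simp: rationally_spans_def)
  then have "g (x [^]\<^bsub>G\<^esub> n) \<in> generate H (g ` S)"
    using gh.generate_img[OF S] by auto
  then show "\<exists>n::int. n \<noteq> 0 \<and> y [^]\<^bsub>H\<^esub> n \<in> generate H (g ` S)"
    using n(1) x K gh.hom_int_pow[of x n] by (auto intro!: exI[of _ n])
qed

lemma finite_rank_spanning_set:
  assumes "comm_group G" "finite_rank G"
  obtains S where "finite S" "S \<subseteq> carrier G" "rationally_spans G S (carrier G)"
  using assms comm_group.rational_basis_iff_spans[OF assms(1)] by (auto simp: finite_rank_def)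

text \<open>The kernel of g is an image of A and the image of g is a subgroup of C, so both have
  finite spanning sets.\<close>

lemma finite_rank_exact:
  assumes A: "comm_group A" "finite_rank A" and C: "comm_group C" "finite_rank C"
    and B: "comm_group B" and f: "f \<in> hom A B" and g: "g \<in> hom B C"
    and ex: "kernel B C g = f ` carrier A"
  shows "finite_rank B"
proof -
  interpret A: comm_group A by (rule A)
  interpret B: comm_group B by (rule B)
  interpret C: comm_group C by (rule C)
  interpret fh: group_hom A B f by (unfold_locales) (rule f)
  interpret gh: group_hom B C g by (unfold_locales) (rule g)
  obtain SA where SA: "finite SA" "SA \<subseteq> carrier A" "rationally_spans A SA (carrier A)"
    using finite_rank_spanning_set[OF A] .
  have "subgroup (g ` carrier B) C" by (rule gh.img_is_subgroup)
  then obtain SC where SC: "finite SC" "SC \<subseteq> g ` carrier B" "rationally_spans C SC (g ` carrier B)"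
    using C.finite_rank_subgroup_span[OF C(2)] by blast
  then obtain S where S: "finite S" "S \<subseteq> carrier B" "SC = g ` S"
    using finite_subset_image by metis
  have "rationally_spans B (f ` SA \<union> S) (carrier B)"
  proof (rule rationally_spans_extension[OF B C(1) g S(2)])
    show "f ` SA \<subseteq> kernel B C g" using SA ex by auto
    show "rationally_spans C (g ` S) (g ` carrier B)" using SC S by simp
    show "rationally_spans B (f ` SA) (kernel B C g)"
      unfolding ex by (rule rationally_spans_image[OF fh.group_hom_axioms SA(2) order_refl SA(3)])
  qed
  then show ?thesis
    using SA S by (intro B.finite_rankI[of "f ` SA \<union> S"]) auto
qed

lemma finite_rank_image:
  assumes A: "comm_group A" "finite_rank A" and B: "comm_group B"
    and f: "f \<in> hom A B" and surj: "f ` carrier A = carrier B"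
  shows "finite_rank B"
proof -
  interpret A: comm_group A by (rule A)
  interpret B: comm_group B by (rule B)
  interpret fh: group_hom A B f by (unfold_locales) (rule f)
  obtain S where S: "finite S" "S \<subseteq> carrier A" "rationally_spans A S (carrier A)"
    using finite_rank_spanning_set[OF A] .
  then have "rationally_spans B (f ` S) (carrier B)"
    using rationally_spans_image[OF fh.group_hom_axioms S(2) order_refl S(3)] surj by simp
  then show ?thesis
    using S surj by (intro B.finite_rankI[of "f ` S"]) auto
qed

section \<open>Trivial and infinite cyclic groups\<close>

lemma rational_basis_trivial_group:
  assumes "comm_group G" "trivial_group G" shows "rational_basis G {}"
proof -
  interpret G: comm_group G by (rule assms)
  show ?thesis
    using assms(2) by (auto simp: G.rational_basis_iff int_comb_def trivial_group_def intro!: exI[of _ 1])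
qed

lemma finite_rank_trivial_group: "comm_group G \<Longrightarrow> trivial_group G \<Longrightarrow> finite_rank G"
  using rational_basis_trivial_group by (auto simp: finite_rank_def)

lemma rational_trace_trivial_group:
  assumes "comm_group G" "trivial_group G" "\<phi> \<in> hom G G"
  shows "rational_trace G \<phi> = 0"
  using comm_group.rational_trace_eq[OF assms(1) rational_basis_trivial_group[OF assms(1,2)] assms(3)]
  by simp

lemma finite_rank_integer_group: "finite_rank integer_group"
proof -
  interpret comm_group integer_group by (rule abelian_integer_group)
  have "rationally_spans integer_group {1} (carrier integer_group)"
    unfolding rationally_spans_def
  proof
    fix x :: int
    have "(1::int) [^]\<^bsub>integer_group\<^esub> x \<in> generate integer_group {1}"
      by (intro generate_int_pow generate.incl) auto
    moreover have "x [^]\<^bsub>integer_group\<^esub> (1::int) = x" by simp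
    ultimately show "\<exists>n::int. n \<noteq> 0 \<and> x [^]\<^bsub>integer_group\<^esub> n \<in> generate integer_group {1}"
      by (intro exI[of _ 1]) simp
  qed
  then show ?thesis by (intro finite_rankI[of "{1}"]) auto
qed

lemma finite_rank_iso:
  assumes "comm_group A" "finite_rank A" "comm_group B" "A \<cong> B"
  shows "finite_rank B"
  using assms finite_rank_image[OF assms(1-3)] by (auto simp: is_iso_def iso_iff)

text \<open>A basis \<open>BK\<close> of the kernel together with lifts of a basis \<open>BI\<close>
  of the image is a basis of G in which \<phi> is block triangular; the diagonal blocks are \<phi>
  on the kernel and \<psi> on the image. Both summands are traces on subgroups, so that exactness
  can later identify an image with the next kernel.\<close>

lemma rational_trace_kernel_image:
  assumes G: "comm_group G" and H: "comm_group H" and fin: "finite_rank G"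
    and g: "g \<in> hom G H" and \<phi>: "\<phi> \<in> hom G G" and \<psi>: "\<psi> \<in> hom H H"
    and comm: "\<And>x. x \<in> carrier G \<Longrightarrow> \<psi> (g x) = g (\<phi> x)"
  shows "rational_trace G \<phi> = rational_trace (subgroup_generated G (kernel G H g)) \<phi> +
           rational_trace (subgroup_generated H (g ` carrier G)) \<psi>"
proof -
  interpret G: comm_group G by (rule G)
  interpret H: comm_group H by (rule H)
  interpret gh: group_hom G H g by (unfold_locales) (rule g)
  have subK: "subgroup (kernel G H g) G" by (rule gh.subgroup_kernel)
  have subI: "subgroup (g ` carrier G) H" by (rule gh.img_is_subgroup)
  define K where "K = subgroup_generated G (kernel G H g)"
  define I where "I = subgroup_generated H (g ` carrier G)"
  have K: "comm_group K" and I: "comm_group I"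
    unfolding K_def I_def using G.abelian_subgroup_generated[OF G] H.abelian_subgroup_generated[OF H]
    by auto
  interpret K: comm_group K by (rule K)
  interpret I: comm_group I by (rule I)
  have cK: "carrier K = kernel G H g" and cI: "carrier I = g ` carrier G"
    unfolding K_def I_def
    using subgroup.carrier_subgroup_generated_subgroup subK subI by auto
  have mK: "mult K = mult G" and mI: "mult I = mult H" by (simp_all add: K_def I_def)
  have \<phi>c: "\<phi> x \<in> carrier G" if "x \<in> carrier G" for x using \<phi> that by (auto simp: hom_def)
  have gc: "g x \<in> carrier H" if "x \<in> carrier G" for x using g that by (auto simp: hom_def)
  have "\<psi> \<one>\<^bsub>H\<^esub> = \<one>\<^bsub>H\<^esub>"
    using \<psi> H.is_group hom_one by blast
  then have \<phi>K: "\<phi> \<in> hom K K"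
    using \<phi> comm \<phi>c unfolding hom_def cK mK by (auto simp: kernel_def) metis
  have \<psi>I: "\<psi> \<in> hom I I"
    using \<psi> comm \<phi>c gc unfolding hom_def cI mI by auto
  have gI: "g \<in> hom G I"
    using g unfolding hom_def cI mI by auto
  have incK: "id \<in> hom K G"
    unfolding hom_def cK mK by (auto simp: kernel_def)
  have finK: "finite_rank K" unfolding K_def by (rule G.finite_rank_subgroup[OF fin subK])
  have finI: "finite_rank I" using cI by (intro finite_rank_image[OF G fin I gI]) auto
  obtain BK where BK: "rational_basis K BK" using finK by (auto simp: finite_rank_def)
  obtain BI where BI: "rational_basis I BI" using finI by (auto simp: finite_rank_def)
  have BKf: "finite BK" "BK \<subseteq> kernel G H g" using BK cK by (auto simp: K.rational_basis_iff)
  have BIf: "finite BI" "BI \<subseteq> g ` carrier G" using BI cI by (auto simp: I.rational_basis_iff)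
  have "\<forall>b\<in>BI. \<exists>x. x \<in> carrier G \<and> g x = b" using BIf by auto
  then obtain l where l: "\<And>b. b \<in> BI \<Longrightarrow> l b \<in> carrier G" "\<And>b. b \<in> BI \<Longrightarrow> g (l b) = b"
    by metis
  have linj: "inj_on l BI" using l(2) by (metis inj_onI)
  define B where "B = BK \<union> l ` BI"
  have Bf: "finite B" "B \<subseteq> carrier G"
    using BKf BIf l by (auto simp: B_def kernel_def)
  have \<beta>add: "real_additive G (I.coord BI b \<circ> g)" if "b \<in> BI" for b
    by (rule real_additive_compose_hom[OF I.coord_additive[OF BI that] gI])
  have \<beta>K: "I.coord BI b (g k) = 0" if "b \<in> BI" "k \<in> BK" for b k
  proof -
    have "g k = \<one>\<^bsub>I\<^esub>" using that BKf by (auto simp: kernel_def I_def)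
    then show ?thesis using I.real_additive_one[OF I.coord_additive[OF BI that(1)]] by simp
  qed
  have \<beta>l: "I.coord BI b (g (l b')) = (if b = b' then 1 else 0)" if "b \<in> BI" "b' \<in> BI" for b b'
    using I.coord_basis[OF BI that] l that by simp
  have disj: "BK \<inter> l ` BI = {}"
  proof -
    have False if "b \<in> BI" "l b \<in> BK" for b using \<beta>K[OF that] \<beta>l[of b b] that by simp
    then show ?thesis by auto
  qed
  \<comment> \<open>\<open>I.coord BI b \<circ> g\<close> kills \<open>BK\<close> and is dual to the
    lifts, so pairing it with any family of coefficients extracts the one at \<open>l b\<close>.
    This yields both the independence of \<open>B\<close> and the coordinates along the
    lifts.\<close>
  have sumB: "(\<Sum>s\<in>B. F s * I.coord BI b (g s)) = F (l b)" if "b \<in> BI" for b and F :: "'a \<Rightarrow> real"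
  proof -
    have "(\<Sum>s\<in>B. F s * I.coord BI b (g s)) =
        (\<Sum>k\<in>BK. F k * I.coord BI b (g k)) + (\<Sum>b'\<in>BI. F (l b') * I.coord BI b (g (l b')))"
      unfolding B_def using BKf BIf disj linj
      by (subst sum.union_disjoint) (auto simp: sum.reindex)
    also have "(\<Sum>k\<in>BK. F k * I.coord BI b (g k)) = 0"
      using \<beta>K that by simp
    also have "(\<Sum>b'\<in>BI. F (l b') * I.coord BI b (g (l b'))) = (\<Sum>b'\<in>BI. if b = b' then F (l b') else 0)"
      by (rule sum.cong) (use \<beta>l that in auto)
    finally show ?thesis using that BIf by simp
  qed
  have Bbasis: "rational_basis G B"
    unfolding G.rational_basis_iff_spans
  proof (intro conjI Bf allI impI)
    fix c assume c: "int_comb G B c = \<one>\<^bsub>G\<^esub>"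
    have cl: "c (l b) = 0" if b: "b \<in> BI" for b
    proof -
      have "0 = (I.coord BI b \<circ> g) (int_comb G B c)"
        using c G.real_additive_one[OF \<beta>add[OF b]] by simp
      also have "\<dots> = (\<Sum>s\<in>B. of_int (c s) * (I.coord BI b \<circ> g) s)"
        by (rule G.real_additive_int_comb[OF \<beta>add[OF b] Bf])
      also have "\<dots> = of_int (c (l b))"
        using sumB[OF b, of "\<lambda>s. of_int (c s)"] by simp
      finally show ?thesis by simp
    qed
    \<comment> \<open>With the coefficients of the lifts gone, the relation lives in the kernel,
      where \<open>BK\<close> is independent.\<close>
    have "int_comb G B c = int_comb G BK c"
      unfolding int_comb_def
      by (rule G.finprod_mono_neutral_cong_right) (use Bf B_def cl BKf in \<open>auto simp: kernel_def\<close>)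
    also have "\<dots> = int_comb K BK c"
      using group_hom.hom_int_comb[OF _ BKf(1), of K G id c] BKf cK incK K.is_group G.is_group K G
      by (simp add: group_hom_def group_hom_axioms_def)
    finally have "int_comb K BK c = \<one>\<^bsub>K\<^esub>" using c by (simp add: K_def)
    then have "c k = 0" if "k \<in> BK" for k
      using that BK by (auto simp: K.rational_basis_iff)
    then show "\<forall>b\<in>B. c b = 0" using cl by (auto simp: B_def)
  next
    show "rationally_spans G B (carrier G)"
      unfolding B_def
    proof (rule rationally_spans_extension[OF G H g])
      show "l ` BI \<subseteq> carrier G" "BK \<subseteq> kernel G H g" using l BKf by auto
      have gl: "g ` l ` BI = BI" using l by force
      show "rationally_spans H (g ` l ` BI) (g ` carrier G)"
        unfolding gl using BI[unfolded I.rational_basis_iff_spans] cI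
          H.rationally_spans_subgroup_generated[OF subI BIf(2) order_refl]
        by (simp add: I_def)
      show "rationally_spans G BK (kernel G H g)"
        using BK[unfolded K.rational_basis_iff_spans] cK
          G.rationally_spans_subgroup_generated[OF subK BKf(2) order_refl]
        by (simp add: K_def)
    qed
  qed
  have cl: "G.coord B (l b) x = I.coord BI b (g x)" if b: "b \<in> BI" and x: "x \<in> carrier G" for b x
  proof -
    have "(I.coord BI b \<circ> g) x = (\<Sum>s\<in>B. G.coord B s x * (I.coord BI b \<circ> g) s)"
      using G.rational_basis_dual_system[OF Bbasis] \<beta>add[OF b] x
      unfolding G.dual_system_def by blast
    then show ?thesis using sumB[OF b, of "\<lambda>s. G.coord B s x"] by simp
  qed
  \<comment> \<open>On the kernel, the coordinate of G along k is an additive functional that is 1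
    at k and 0 on the rest of \<open>BK\<close>; hence it is the coordinate of K.\<close>
  have ck: "G.coord B k x = K.coord BK k x" if k: "k \<in> BK" and x: "x \<in> carrier K" for k x
  proof -
    have kB: "k \<in> B" using k by (simp add: B_def)
    have "real_additive K (G.coord B k \<circ> id)"
      by (rule real_additive_compose_hom[OF G.coord_additive[OF Bbasis kB] incK])
    then have "G.coord B k x = (\<Sum>s\<in>BK. K.coord BK s x * G.coord B k s)"
      using K.rational_basis_dual_system[OF BK] x
      unfolding K.dual_system_def by simp
    also have "\<dots> = (\<Sum>s\<in>BK. if k = s then K.coord BK s x else 0)"
      by (rule sum.cong) (use G.coord_basis[OF Bbasis kB] in \<open>auto simp: B_def\<close>)
    finally show ?thesis using k BKf by simp
  qed
  have "rational_trace G \<phi> = (\<Sum>s\<in>B. G.coord B s (\<phi> s))"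
    by (rule G.rational_trace_eq[OF Bbasis \<phi>])
  also have "\<dots> = (\<Sum>k\<in>BK. G.coord B k (\<phi> k)) + (\<Sum>b\<in>BI. G.coord B (l b) (\<phi> (l b)))"
    unfolding B_def[THEN arg_cong[where f = "sum _"]] using BKf BIf disj linj
    by (subst sum.union_disjoint) (auto simp: sum.reindex)
  also have "(\<Sum>k\<in>BK. G.coord B k (\<phi> k)) = (\<Sum>k\<in>BK. K.coord BK k (\<phi> k))"
  proof (rule sum.cong)
    fix k assume k: "k \<in> BK"
    then have "\<phi> k \<in> carrier K" using \<phi>K BKf cK by (auto simp: hom_def)
    then show "G.coord B k (\<phi> k) = K.coord BK k (\<phi> k)" using ck k by blast
  qed simp
  also have "(\<Sum>b\<in>BI. G.coord B (l b) (\<phi> (l b))) = (\<Sum>b\<in>BI. I.coord BI b (\<psi> b))"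
  proof (rule sum.cong)
    fix b assume b: "b \<in> BI"
    then show "G.coord B (l b) (\<phi> (l b)) = I.coord BI b (\<psi> b)"
      using cl[OF b, of "\<phi> (l b)"] \<phi>c[of "l b"] comm[of "l b"] l by simp
  qed simp
  finally show ?thesis
    using K.rational_trace_eq[OF BK \<phi>K] I.rational_trace_eq[OF BI \<psi>I]
    by (simp add: K_def I_def)
qed

section \<open>Spaces of finite homological type\<close>

lemma rational_trace_trivial_subgroup:
  assumes G: "comm_group G" and \<phi>: "\<phi> \<in> hom G G" and S: "S \<subseteq> {\<one>\<^bsub>G\<^esub>}"
  shows "rational_trace (subgroup_generated G S) \<phi> = 0"
proof -
  interpret G: comm_group G by (rule G)
  have triv: "trivial_group (subgroup_generated G S)"
    by (rule G.trivial_group_subgroup_generated[OF S])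
  have \<phi>1: "\<phi> \<one>\<^bsub>G\<^esub> = \<one>\<^bsub>G\<^esub>"
    using \<phi> G.is_group hom_one by blast
  have "carrier (subgroup_generated G S) = {\<one>\<^bsub>G\<^esub>}"
    using triv by (auto simp: trivial_group_def)
  then have "\<phi> \<in> hom (subgroup_generated G S) (subgroup_generated G S)"
    using \<phi>1 by (auto simp: hom_def)
  then show ?thesis
    using rational_trace_trivial_group triv G.abelian_subgroup_generated[OF G] by blast
qed

text \<open>The kernel-image formula with trivial kernel and full image.\<close>

lemma rational_trace_iso:
  assumes G: "comm_group G" and H: "comm_group H" and fin: "finite_rank G"
    and g: "g \<in> iso G H" and \<phi>: "\<phi> \<in> hom G G" and \<psi>: "\<psi> \<in> hom H H"
    and comm: "\<And>x. x \<in> carrier G \<Longrightarrow> \<psi> (g x) = g (\<phi> x)"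
  shows "rational_trace H \<psi> = rational_trace G \<phi>"
proof -
  interpret G: comm_group G by (rule G)
  interpret H: comm_group H by (rule H)
  have gh: "g \<in> hom G H" "g ` carrier G = carrier H" "inj_on g (carrier G)"
    using g by (auto simp: iso_iff)
  interpret gh: group_hom G H g by (unfold_locales) (rule gh)
  have ker: "kernel G H g = {\<one>\<^bsub>G\<^esub>}"
    using gh(3) gh.inj_iff_trivial_ker by blast
  have "rational_trace (subgroup_generated G {\<one>\<^bsub>G\<^esub>}) \<phi> = 0"
    by (rule rational_trace_trivial_subgroup[OF G \<phi>]) simp
  then show ?thesis
    using rational_trace_kernel_image[OF G H fin gh(1) \<phi> \<psi> comm] ker gh(2)
    by (simp add: H.subgroup_generated_group_carrier)
qed

lemma finite_rank_infinite_cyclic: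
  assumes G: "comm_group G" "G \<cong> integer_group" shows "finite_rank G"
proof -
  have "group G" using G(1) by (simp add: comm_group_def)
  then show ?thesis
    using finite_rank_iso[OF abelian_integer_group finite_rank_integer_group G(1)] group.iso_sym G(2)
    by blast
qed

text \<open>This turns the sum over all degrees in \<open>lefschetz_number\<close> into a sum over
  an initial segment of degrees with well-defined traces. Only high degrees are bounded, since
  homology in negative degrees is trivial.\<close>

definition finite_type_pair :: "'a topology \<Rightarrow> 'a set \<Rightarrow> bool" where
  "finite_type_pair X S \<longleftrightarrow>
     (\<forall>k. finite_rank (relative_homology_group k X S)) \<and>
     (\<exists>K::nat. \<forall>k\<ge>int K. trivial_group (relative_homology_group k X S))"

abbreviation finite_type :: "'a topology \<Rightarrow> bool" where
  "finite_type X \<equiv> finite_type_pair X {}"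

lemma trivial_group_exact:
  assumes "exact_seq ([C, B, A], [g, f])" "trivial_group A" "trivial_group C"
  shows "trivial_group B"
proof -
  have ex: "f \<in> hom A B" "g \<in> hom B C" "f ` carrier A = kernel B C g" "group A" "group B"
    using assms(1) by (auto simp: group_hom_def group_hom_axioms_def)
  have "f \<one>\<^bsub>A\<^esub> = \<one>\<^bsub>B\<^esub>" using ex hom_one by blast
  then have "kernel B C g = {\<one>\<^bsub>B\<^esub>}"
    using ex(3) assms(2) by (simp add: trivial_group_def)
  moreover have "kernel B C g = carrier B"
    using assms(3) ex(2) by (auto simp: kernel_def trivial_group_def hom_def)
  ultimately show ?thesis using ex(5) by (simp add: trivial_group_def)
qed

lemma finite_type_pairI:
  assumes "\<And>k. finite_rank (relative_homology_group k X S)"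
    "\<And>k. k \<ge> int K \<Longrightarrow> trivial_group (relative_homology_group k X S)"
  shows "finite_type_pair X S"
  using assms by (auto simp: finite_type_pair_def)

lemma finite_type_pairE:
  assumes "finite_type_pair X S"
  obtains K where "\<And>k. k \<ge> int K \<Longrightarrow> trivial_group (relative_homology_group k X S)"
  using assms by (auto simp: finite_type_pair_def)

lemma finite_rank_exact_seq:
  assumes "exact_seq ([C, B, A], [g, f])" "comm_group A" "comm_group B" "comm_group C"
    "finite_rank A" "finite_rank C"
  shows "finite_rank B"
  by (rule finite_rank_exact[of A C B f g]) (use assms in auto)

lemma finite_type_total:
  assumes S: "finite_type (subtopology X S)" and XS: "finite_type_pair X S"
  shows "finite_type X"
proof -
  obtain K1 where K1: "\<And>k. k \<ge> int K1 \<Longrightarrow> trivial_group (homology_group k (subtopology X S))"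
    using finite_type_pairE[OF S] by blast
  obtain K2 where K2: "\<And>k. k \<ge> int K2 \<Longrightarrow> trivial_group (relative_homology_group k X S)"
    using finite_type_pairE[OF XS] by blast
  show ?thesis
  proof (rule finite_type_pairI[where K = "max K1 K2"])
    fix k
    note ex = homology_exactness_axiom_3[of k X S]
    show "finite_rank (homology_group k X)"
      by (rule finite_rank_exact_seq[OF ex]) (use S XS in \<open>auto simp: finite_type_pair_def\<close>)
    show "trivial_group (homology_group k X)" if "k \<ge> int (max K1 K2)"
      by (rule trivial_group_exact[OF ex]) (use K1 K2 that in auto)
  qed
qed

lemma finite_type_relative:
  assumes S: "finite_type (subtopology X S)" and X: "finite_type X"
  shows "finite_type_pair X S"
proof -
  obtain K1 where K1: "\<And>k. k \<ge> int K1 \<Longrightarrow> trivial_group (homology_group k (subtopology X S))"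
    using finite_type_pairE[OF S] by blast
  obtain K2 where K2: "\<And>k. k \<ge> int K2 \<Longrightarrow> trivial_group (homology_group k X)"
    using finite_type_pairE[OF X] by blast
  show ?thesis
  \<comment> \<open>H_k(X, S) sits between H_k(X) and H_(k-1)(S), which shifts the bound for S by
    one.\<close>
  proof (rule finite_type_pairI[where K = "max (Suc K1) K2"])
    fix k
    note ex = homology_exactness_axiom_1[of k X S]
    show "finite_rank (relative_homology_group k X S)"
      by (rule finite_rank_exact_seq[OF ex]) (use S X in \<open>auto simp: finite_type_pair_def\<close>)
    show "trivial_group (relative_homology_group k X S)" if "k \<ge> int (max (Suc K1) K2)"
      by (rule trivial_group_exact[OF ex]) (use K1 K2 that in auto)
  qed
qed

lemma finite_type_pair_iso:
  assumes "finite_type_pair X S"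
    "\<And>k. relative_homology_group k X S \<cong> relative_homology_group k Y T"
  shows "finite_type_pair Y T"
proof -
  obtain K where K: "\<And>k. k \<ge> int K \<Longrightarrow> trivial_group (relative_homology_group k X S)"
    using finite_type_pairE[OF assms(1)] by blast
  show ?thesis
  proof (rule finite_type_pairI[where K = K])
    show "finite_rank (relative_homology_group k Y T)" for k
      using finite_rank_iso[OF _ _ _ assms(2)] assms(1) by (auto simp: finite_type_pair_def)
    show "trivial_group (relative_homology_group k Y T)" if "k \<ge> int K" for k
      using K[OF that] isomorphic_group_triviality[OF assms(2)] by simp
  qed
qed

lemma finite_type_homeomorphic:
  "finite_type X \<Longrightarrow> X homeomorphic_space Y \<Longrightarrow> finite_type Y"
  using finite_type_pair_iso homeomorphic_space_imp_isomorphic_homology_groups by blast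

text \<open>Mayer-Vietoris in the form needed for finiteness: excision identifies the pair (U, U
  \<inter> V) with (X, V), and the sequences of these two pairs carry finite type from U and U
  \<inter> V to (X, V) and then to X.\<close>

lemma finite_type_union:
  assumes U: "openin X U" "finite_type (subtopology X U)"
    and V: "openin X V" "finite_type (subtopology X V)"
    and UV: "U \<union> V = topspace X" "finite_type (subtopology X (U \<inter> V))"
  shows "finite_type X"
proof -
  have "finite_type_pair (subtopology X U) (U \<inter> V)"
    using finite_type_relative[of "subtopology X U" "U \<inter> V"] U(2) UV(2)
    by (simp add: subtopology_subtopology Int_absorb1)
  moreover have "relative_homology_group k (subtopology X U) (U \<inter> V) \<cong> relative_homology_group k X V" for k
  proof -
    have "X closure_of (topspace X - U) \<subseteq> X interior_of V"
      using U(1) V(1) UV(1) by (auto simp: closure_of_closedin closedin_def interior_of_openin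
          openin_subset double_diff)
    moreover have "V \<subseteq> topspace X" using V(1) openin_subset by blast
    ultimately have "hom_induced k (subtopology X (topspace X - (topspace X - U))) (V - (topspace X - U))
        (subtopology X (topspace X)) V id
      \<in> iso (relative_homology_group k (subtopology X (topspace X - (topspace X - U))) (V - (topspace X - U)))
            (relative_homology_group k (subtopology X (topspace X)) V)"
      by (rule homology_excision_axiom)
    moreover have "topspace X - (topspace X - U) = U" "V - (topspace X - U) = U \<inter> V"
      using openin_subset[OF U(1)] openin_subset[OF V(1)] by auto
    ultimately show ?thesis by (auto simp: is_iso_def)
  qed
  ultimately have "finite_type_pair X V" by (rule finite_type_pair_iso)
  then show ?thesis using finite_type_total V(2) by blast
qed

section \<open>Contractible spaces and spheres\<close>

lemma finite_type_empty:
  assumes "topspace X = {}" shows "finite_type X"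
  by (rule finite_type_pairI[where K = 0])
    (use assms trivial_homology_group_empty in \<open>auto intro!: finite_rank_trivial_group\<close>)

lemma finite_type_contractible:
  assumes "contractible_space X" shows "finite_type X"
proof (cases "topspace X = {}")
  case True
  then show ?thesis by (rule finite_type_empty)
next
  case False
  have triv: "trivial_group (homology_group k X)" if "k \<noteq> 0" for k
    using trivial_reduced_homology_group_contractible_space[OF assms, of k]
      un_reduced_homology_group[OF that, of X] by simp
  have "homology_group 0 X \<cong> integer_group"
    using contractible_imp_path_connected_space[OF assms] False
    by (rule isomorphic_integer_zeroth_homology_group)
  then have "finite_rank (homology_group 0 X)"
    by (simp add: finite_rank_infinite_cyclic)
  moreover have "finite_rank (homology_group k X)" if "k \<noteq> 0" for k
    using triv[OF that] by (simp add: finite_rank_trivial_group)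
  ultimately show ?thesis
    by (intro finite_type_pairI[where K = 1]) (use triv in auto, metis)
qed

lemma finite_type_nsphere: "finite_type (nsphere n)"
proof (rule finite_type_pairI[where K = "Suc n"])
  show "trivial_group (homology_group k (nsphere n))" if "k \<ge> int (Suc n)" for k
    using reduced_homology_group_nsphere(2)[of k n] un_reduced_homology_group[of k "nsphere n"] that
    by auto
  show "finite_rank (homology_group k (nsphere n))" for k
  proof (cases "k = 0")
    case False
    then have eq: "homology_group k (nsphere n) = reduced_homology_group k (nsphere n)"
      by (simp add: un_reduced_homology_group)
    show ?thesis
    proof (cases "k = n")
      case True
      then show ?thesis
        using reduced_homology_group_nsphere(1)[of n] eq abelian_relative_homology_group[of k "nsphere n" "{}"]
        by (intro finite_rank_infinite_cyclic) auto
    next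
      case False
      then show ?thesis using reduced_homology_group_nsphere(2)[of k n] eq
        by (metis abelian_relative_homology_group finite_rank_trivial_group)
    qed
  next
    case True
    \<comment> \<open>In degree 0 the known group is the reduced one. It is the kernel of the map to
      a point, so the unreduced group is an extension and exactness applies.\<close>
    let ?h = "hom_induced 0 (nsphere n) {} (discrete_topology {()}) {} (\<lambda>x. ())"
    let ?P = "homology_group 0 (discrete_topology {()})"
    have "?P \<cong> integer_group" by (rule homology_coefficients[of _ "()"]) simp
    then have P: "finite_rank ?P"
      by (simp add: finite_rank_infinite_cyclic)
    have R: "finite_rank (reduced_homology_group 0 (nsphere n))"
    proof (cases "n = 0")
      case True
      then show ?thesis
        using reduced_homology_group_nsphere(1)[of n]
        by (intro finite_rank_infinite_cyclic)
          (simp_all add: reduced_homology_group_def group.abelian_subgroup_generated)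
    next
      case False
      then show ?thesis using reduced_homology_group_nsphere(2)[of 0 n]
        by (intro finite_rank_trivial_group)
          (simp_all add: reduced_homology_group_def group.abelian_subgroup_generated)
    qed
    have "finite_rank (homology_group 0 (nsphere n))"
    proof (rule finite_rank_exact[of "reduced_homology_group 0 (nsphere n)" ?P _ id ?h])
      show "comm_group (reduced_homology_group 0 (nsphere n))"
        by (simp add: reduced_homology_group_def group.abelian_subgroup_generated)
      show "id \<in> hom (reduced_homology_group 0 (nsphere n)) (homology_group 0 (nsphere n))"
        using carrier_reduced_homology_group_subset[of 0 "nsphere n"]
        by (auto simp: hom_def reduced_homology_group_def)
      show "kernel (homology_group 0 (nsphere n)) ?P ?h = id ` carrier (reduced_homology_group 0 (nsphere n))"
        by (simp add: carrier_reduced_homology_group)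
    qed (use P R hom_induced_hom in auto)
    then show ?thesis using True by simp
  qed
qed

section \<open>Lefschetz numbers of pairs\<close>

definition relative_homology_trace :: "int \<Rightarrow> 'a topology \<Rightarrow> 'a set \<Rightarrow> ('a \<Rightarrow> 'a) \<Rightarrow> real" where
  "relative_homology_trace k X S f =
     rational_trace (relative_homology_group k X S) (hom_induced k X S X S f)"

definition relative_lefschetz_number :: "('a \<Rightarrow> 'a) \<Rightarrow> 'a topology \<Rightarrow> 'a set \<Rightarrow> real" where
  "relative_lefschetz_number f X S =
     (\<Sum>k | relative_homology_trace (int k) X S f \<noteq> 0. (-1) ^ k * relative_homology_trace (int k) X S f)"

lemma lefschetz_number_eq_relative: "lefschetz_number f X = relative_lefschetz_number f X {}"
  by (simp add: lefschetz_number_def relative_lefschetz_number_def homology_trace_def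
      relative_homology_trace_def)

lemma relative_lefschetz_number_eq_sum:
  assumes "\<And>k. k \<ge> int K \<Longrightarrow> trivial_group (relative_homology_group k X S)"
  shows "relative_lefschetz_number f X S = (\<Sum>k<K. (-1) ^ k * relative_homology_trace (int k) X S f)"
proof -
  have "relative_homology_trace (int k) X S f = 0" if "k \<ge> K" for k
    using rational_trace_trivial_group[OF _ assms hom_induced_hom, of "int k"] that
    by (simp add: relative_homology_trace_def)
  then show ?thesis
    unfolding relative_lefschetz_number_def
    by (intro sum.mono_neutral_left) (auto simp: not_le[symmetric])
qed

text \<open>By functoriality the relation between q, f and g becomes a conjugation on homology,
  because q induces an isomorphism.\<close>

lemma relative_homology_trace_conjugate:
  assumes "finite_type_pair X S"
    and q: "hom_induced k X S Y T q \<in> iso (relative_homology_group k X S) (relative_homology_group k Y T)"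
    and "continuous_map X Y q" "q \<in> S \<rightarrow> T" "continuous_map X X f" "f \<in> S \<rightarrow> S"
    and "continuous_map Y Y g" "g \<in> T \<rightarrow> T" "\<And>x. x \<in> topspace X \<Longrightarrow> g (q x) = q (f x)"
  shows "relative_homology_trace k Y T g = relative_homology_trace k X S f"
  unfolding relative_homology_trace_def
proof (rule rational_trace_iso[OF _ _ _ q hom_induced_hom hom_induced_hom])
  show "finite_rank (relative_homology_group k X S)"
    using assms(1) by (simp add: finite_type_pair_def)
  fix x
  have "hom_induced k Y T Y T g (hom_induced k X S Y T q x) = hom_induced k X S Y T (g \<circ> q) x"
    by (rule hom_induced_compose') (use assms in auto)
  also have "\<dots> = hom_induced k X S Y T (q \<circ> f) x"
    using assms(9) hom_induced_eq[of X "g \<circ> q" "q \<circ> f" k S Y T] by simp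
  also have "\<dots> = hom_induced k X S Y T q (hom_induced k X S X S f x)"
    by (rule hom_induced_compose'[symmetric]) (use assms in auto)
  finally show "hom_induced k Y T Y T g (hom_induced k X S Y T q x) =
      hom_induced k X S Y T q (hom_induced k X S X S f x)" .
qed auto

lemma relative_lefschetz_number_conjugate:
  assumes "finite_type_pair X S"
    and q: "\<And>k. hom_induced k X S Y T q \<in> iso (relative_homology_group k X S) (relative_homology_group k Y T)"
    and "continuous_map X Y q" "q \<in> S \<rightarrow> T" "continuous_map X X f" "f \<in> S \<rightarrow> S"
    and "continuous_map Y Y g" "g \<in> T \<rightarrow> T" "\<And>x. x \<in> topspace X \<Longrightarrow> g (q x) = q (f x)"
  shows "relative_lefschetz_number g Y T = relative_lefschetz_number f X S"
  unfolding relative_lefschetz_number_def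
  by (simp add: relative_homology_trace_conjugate[OF assms])

text \<open>Each trace in the long exact sequence is the trace on a kernel plus the trace on an
  image. In the alternating sum the contributions of the maps within one degree cancel, and those of
  the boundary map telescope.\<close>

lemma lefschetz_number_pair:
  fixes f :: "'a \<Rightarrow> 'a"
  assumes f: "continuous_map X X f" "f \<in> S \<rightarrow> S"
    and ftS: "finite_type (subtopology X S)" and ftXS: "finite_type_pair X S"
  shows "lefschetz_number f X = lefschetz_number f (subtopology X S) + relative_lefschetz_number f X S"
proof -
  let ?S = "subtopology X S"
  let ?A = "\<lambda>k. homology_group k ?S" and ?B = "\<lambda>k. homology_group k X"
  let ?C = "\<lambda>k. relative_homology_group k X S"
  let ?fA = "\<lambda>k. hom_induced k ?S {} ?S {} f" and ?fB = "\<lambda>k. hom_induced k X {} X {} f"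
  let ?fC = "\<lambda>k. hom_induced k X S X S f"
  let ?i = "\<lambda>k. hom_induced k ?S {} X {} id" and ?j = "\<lambda>k. hom_induced k X {} X S id"
  let ?d = "\<lambda>k. hom_boundary k X S"
  have ftX: "finite_type X" using finite_type_total[OF ftS ftXS] .
  have fS: "continuous_map ?S ?S f"
    using f by (auto simp: continuous_map_in_subtopology continuous_map_from_subtopology)
  have idS: "continuous_map ?S X id" by (simp add: continuous_map_from_subtopology)
  have ij: "?j k ` carrier (?B k) = kernel (?C k) (?A (k - 1)) (?d k)" for k
    using homology_exactness_axiom_1[of k X S] by auto
  have di: "?d k ` carrier (?C k) = kernel (?A (k - 1)) (?B (k - 1)) (?i (k - 1))" for k
    using homology_exactness_axiom_2[of k X S] by auto
  have ji: "?i k ` carrier (?A k) = kernel (?B k) (?C k) (?j k)" for k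
    using homology_exactness_axiom_3[of k X S] by auto
  have fin: "finite_rank (?A k)" "finite_rank (?B k)" "finite_rank (?C k)" for k
    using ftS ftX ftXS by (auto simp: finite_type_pair_def)
  \<comment> \<open>Traces on the images of the three maps; by exactness each of these images is the
    kernel of the next map. Note that \<gamma> k is a trace in degree k - 1 of S.\<close>
  define \<alpha> where "\<alpha> k = rational_trace (subgroup_generated (?B k) (?i k ` carrier (?A k))) (?fB k)" for k
  define \<beta> where "\<beta> k = rational_trace (subgroup_generated (?C k) (?j k ` carrier (?B k))) (?fC k)" for k
  define \<gamma> where "\<gamma> k = rational_trace (subgroup_generated (?A (k - 1)) (?d k ` carrier (?C k))) (?fA (k - 1))" for k
  have natd: "?fA (k - 1) (?d k x) = ?d k (?fC k x)" for k x
    using naturality_hom_induced[OF f(1) f(2), of k, THEN fun_cong, of x] by simp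
  have nati: "?fB k (?i k x) = ?i k (?fA k x)" for k x
    using hom_induced_compose'[OF idS _ f(1), of "{}" "{}" "{}" k x]
      hom_induced_compose'[OF fS _ idS, of "{}" "{}" "{}" k x] by simp
  have natj: "?fC k (?j k x) = ?j k (?fB k x)" for k x
    using hom_induced_compose'[OF continuous_map_id _ f(1,2), of "{}" k x]
      hom_induced_compose'[OF f(1) _ continuous_map_id, of "{}" "{}" S k x] by simp
  have A: "rational_trace (?A k) (?fA k) = \<gamma> (k + 1) + \<alpha> k" for k
    using rational_trace_kernel_image[of "?A k" "?B k" "?i k" "?fA k" "?fB k"] fin(1)[of k] di[of "k + 1"] nati[of k]
    by (simp add: hom_induced_hom hom_boundary_hom \<alpha>_def \<gamma>_def)
  have B: "rational_trace (?B k) (?fB k) = \<alpha> k + \<beta> k" for k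
    using rational_trace_kernel_image[of "?B k" "?C k" "?j k" "?fB k" "?fC k"] fin(2)[of k] ji[of k] natj[of k]
    by (simp add: hom_induced_hom hom_boundary_hom \<alpha>_def \<beta>_def)
  have C: "rational_trace (?C k) (?fC k) = \<beta> k + \<gamma> k" for k
    using rational_trace_kernel_image[of "?C k" "?A (k - 1)" "?d k" "?fC k" "?fA (k - 1)"] fin(3)[of k] ij[of k] natd[of k]
    by (simp add: hom_induced_hom hom_boundary_hom \<beta>_def \<gamma>_def)
  obtain KA where KA: "\<And>k. k \<ge> int KA \<Longrightarrow> trivial_group (?A k)"
    using finite_type_pairE[OF ftS] by blast
  obtain KB where KB: "\<And>k. k \<ge> int KB \<Longrightarrow> trivial_group (?B k)"
    using finite_type_pairE[OF ftX] by blast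
  obtain KC where KC: "\<And>k. k \<ge> int KC \<Longrightarrow> trivial_group (?C k)"
    using finite_type_pairE[OF ftXS] by blast
  \<comment> \<open>The successor makes \<gamma> vanish at K, where it is a trace in degree K - 1 of
    S.\<close>
  define K where "K = Suc (max KA (max KB KC))"
  have K_ge: "int KA \<le> k" "int KB \<le> k" "int KC \<le> k" if "int K \<le> k" for k
    using that by (auto simp: K_def)
  have triv\<gamma>: "\<gamma> k = 0" if "trivial_group (?A (k - 1))" for k
  proof -
    have "?d k ` carrier (?C k) \<subseteq> {\<one>\<^bsub>?A (k - 1)\<^esub>}"
      using that hom_boundary_carrier[of k X S] unfolding trivial_group_def by blast
    then show ?thesis
      unfolding \<gamma>_def by (intro rational_trace_trivial_subgroup hom_induced_hom) simp_all
  qed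
  have \<gamma>0: "\<gamma> 0 = 0" by (rule triv\<gamma>) simp
  have \<gamma>K: "\<gamma> (int K) = 0" by (rule triv\<gamma>) (simp add: KA K_def)
  have tele: "(\<Sum>k<n. (-1) ^ k * (\<gamma> (int k + 1) + \<gamma> (int k))) = \<gamma> 0 - (-1) ^ n * \<gamma> (int n)" for n
    by (induction n) (auto simp: algebra_simps)
  have "relative_lefschetz_number f X {} - relative_lefschetz_number f ?S {} - relative_lefschetz_number f X S
      = (\<Sum>k<K. (-1) ^ k * rational_trace (?B k) (?fB k)) - (\<Sum>k<K. (-1) ^ k * rational_trace (?A k) (?fA k))
        - (\<Sum>k<K. (-1) ^ k * rational_trace (?C k) (?fC k))"
    using relative_lefschetz_number_eq_sum[of K X "{}" f] relative_lefschetz_number_eq_sum[of K ?S "{}" f]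
      relative_lefschetz_number_eq_sum[of K X S f] KA KB KC K_ge
    by (simp add: relative_homology_trace_def)
  also have "\<dots> = - (\<Sum>k<K. (-1) ^ k * (\<gamma> (int k + 1) + \<gamma> (int k)))"
    unfolding A B C
    by (simp add: sum_subtractf[symmetric] sum_negf[symmetric] algebra_simps)
  also have "\<dots> = 0" by (simp add: tele \<gamma>0 \<gamma>K)
  finally show ?thesis by (simp add: lefschetz_number_eq_relative)
qed

section \<open>The Lefschetz number of a point\<close>

lemma rational_basis_integer_group: "rational_basis integer_group {1}"
proof -
  interpret comm_group integer_group by (rule abelian_integer_group)
  have "int_comb integer_group {1} c = c 1" for c
    by (simp add: int_comb_def)
  then show ?thesis
    by (auto simp: rational_basis_iff intro!: exI[of _ 1])
qed

text \<open>The only self-map is the identity, and the homology is infinite cyclic in degree 0 and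
  trivial above.\<close>

lemma lefschetz_number_singleton:
  assumes X: "topspace X = {a}" and f: "continuous_map X X f"
  shows "lefschetz_number f X = 1"
proof -
  let ?H = "homology_group 0 X" and ?f = "hom_induced 0 X {} X {} f"
  interpret Z: comm_group integer_group by (rule abelian_integer_group)
  have id: "?f c = c" if "c \<in> carrier ?H" for c
    using that X f by (intro hom_induced_id_gen) (auto dest: continuous_map_image_subset_topspace)
  have "?H \<cong> integer_group" using X by (rule homology_coefficients)
  then have "integer_group \<cong> ?H" by (simp add: group.iso_sym)
  then obtain g where g: "g \<in> iso integer_group ?H" by (auto simp: is_iso_def)
  have "g x \<in> carrier ?H" for x using g by (auto simp: iso_iff)
  then have "rational_trace ?H ?f = rational_trace integer_group id"
    using id by (intro rational_trace_iso[OF _ _ finite_rank_integer_group g] hom_induced_hom)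
      (auto simp: hom_def abelian_integer_group)
  also have "\<dots> = Z.coord {1} 1 1"
    using Z.rational_trace_eq[OF rational_basis_integer_group, of id] by (simp add: hom_def)
  also have "\<dots> = 1"
    using Z.coord_basis[OF rational_basis_integer_group, of 1 1] by simp
  finally have "relative_homology_trace 0 X {} f = 1"
    by (simp add: relative_homology_trace_def)
  moreover have "trivial_group (homology_group k X)" if "k \<ge> int 1" for k
    using homology_dimension_axiom[OF X, of k] that by auto
  then have "lefschetz_number f X = relative_homology_trace 0 X {} f"
    using relative_lefschetz_number_eq_sum[of 1 X "{}" f] by (simp add: lefschetz_number_eq_relative)
  ultimately show ?thesis by simp
qed

section \<open>The homology of the torus has finite type\<close>

lemma contractible_punctured_circle:
  assumes "b \<in> sphere (0::complex) 1" shows "contractible (sphere (0::complex) 1 - {b})"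
proof -
  have "(sphere (0::complex) 1 - {b}) homeomorphic {x::complex. 1 \<bullet> x = 0}"
    by (rule homeomorphic_punctured_sphere_hyperplane) (use assms in auto)
  then show ?thesis
    using homeomorphic_contractible_eq convex_imp_contractible[OF convex_hyperplane] by blast
qed

text \<open>The real part maps the half circle homeomorphically onto an open interval; s is the sign
  that selects the upper or the lower half.\<close>

lemma contractible_half_circle:
  assumes "\<bar>s\<bar> = 1" shows "contractible {z \<in> sphere (0::complex) 1. 0 < s * Im z}"
proof -
  let ?A = "{z \<in> sphere (0::complex) 1. 0 < s * Im z}"
  have s: "s = 1 \<or> s = -1" using assms by auto
  have "{-1<..<1::real} homeomorphic ?A"
    unfolding homeomorphic_minimal
  proof (intro exI[of _ "\<lambda>x. Complex x (s * sqrt (1 - x\<^sup>2))"] exI[of _ Re] conjI ballI)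
    fix x :: real assume x: "x \<in> {-1<..<1}"
    then have x2: "x\<^sup>2 < 1" by (simp add: abs_square_less_1 abs_less_iff)
    show "Complex x (s * sqrt (1 - x\<^sup>2)) \<in> ?A"
      using s x2 by (auto simp: cmod_def)
  next
    fix z assume z: "z \<in> ?A"
    then have n: "(Re z)\<^sup>2 + (Im z)\<^sup>2 = 1" by (simp add: cmod_def)
    have "Im z \<noteq> 0" using z by auto
    then have "(Re z)\<^sup>2 < 1" using n zero_less_power2[of "Im z"] by linarith
    then show "Re z \<in> {-1<..<1}" by (auto simp: abs_square_less_1)
    have "1 - (Re z)\<^sup>2 = (Im z)\<^sup>2" using n by simp
    then show "Complex (Re z) (s * sqrt (1 - (Re z)\<^sup>2)) = z"
      using s z by (auto simp: complex_eq_iff)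
  next
    show "continuous_on {-1<..<1} (\<lambda>x. Complex x (s * sqrt (1 - x\<^sup>2)))"
      by (intro continuous_intros)
  qed (auto intro: continuous_intros)
  then show ?thesis
    using homeomorphic_contractible_eq convex_imp_contractible convex_real_interval(8) by blast
qed

text \<open>Replacing one circle factor by a punctured circle or by a pair of half circles lowers the number
  of circles, and two punctured circles cover the circle: Mayer-Vietoris applies.\<close>

lemma finite_type_product_circles:
  fixes s :: "nat \<Rightarrow> complex set"
  assumes "finite J" "J \<subseteq> I" "\<And>i. i \<in> J \<Longrightarrow> s i = sphere 0 1"
    "\<And>i. i \<in> I - J \<Longrightarrow> contractible (s i)"
  shows "finite_type (product_topology (\<lambda>i. top_of_set (s i)) I)"
  using assms
proof (induction J arbitrary: s rule: finite_induct)
  case empty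
  then show ?case
    by (intro finite_type_contractible) (simp add: contractible_space_product_topology)
next
  case (insert j J)
  define X where "X s = product_topology (\<lambda>i. top_of_set (s i)) I" for s :: "nat \<Rightarrow> complex set"
  have j: "j \<in> I" using insert.prems by auto
  \<comment> \<open>Restricting one coordinate to A gives a product of the same kind, so the
    induction hypothesis can speak about open subsets of this form.\<close>
  have sub: "subtopology (X s) {x \<in> topspace (X s). x j \<in> A} = X (s(j := s j \<inter> A))" for s A
  proof -
    have "{x \<in> topspace (X s). x j \<in> A} = (\<Pi>\<^sub>E i\<in>I. (s(j := s j \<inter> A)) i)"
    proof (rule Set.set_eqI, rule iffI)
      fix x assume "x \<in> (\<Pi>\<^sub>E i\<in>I. (s(j := s j \<inter> A)) i)"
      then have x: "x \<in> extensional I" "\<And>i. i \<in> I \<Longrightarrow> x i \<in> (if i = j then s j \<inter> A else s i)"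
        by (auto simp: PiE_iff)
      then have "x i \<in> s i" if "i \<in> I" for i
        using x(2)[OF that] by (auto split: if_splits)
      then show "x \<in> {x \<in> topspace (X s). x j \<in> A}"
        using x(1) x(2)[OF j] by (simp add: X_def PiE_iff)
    qed (use j in \<open>auto simp: X_def PiE_iff\<close>)
    then have "subtopology (X s) {x \<in> topspace (X s). x j \<in> A} =
        product_topology (\<lambda>i. subtopology (top_of_set (s i)) ((s(j := s j \<inter> A)) i)) I"
      unfolding X_def by (simp only: subtopology_product_topology)
    also have "(\<lambda>i. subtopology (top_of_set (s i)) ((s(j := s j \<inter> A)) i)) =
        (\<lambda>i. top_of_set ((s(j := s j \<inter> A)) i))"
    proof
      fix i
      have "s i \<inter> (s(j := s j \<inter> A)) i = (s(j := s j \<inter> A)) i" by auto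
      then show "subtopology (top_of_set (s i)) ((s(j := s j \<inter> A)) i) =
          top_of_set ((s(j := s j \<inter> A)) i)"
        by (simp only: subtopology_subtopology)
    qed
    also have "product_topology \<dots> I = X (s(j := s j \<inter> A))"
      by (simp only: X_def)
    finally show ?thesis .
  qed
  have op: "openin (X s) {x \<in> topspace (X s). x j \<in> A}" if "open A" for s A
  proof -
    have "continuous_map (X s) euclidean (\<lambda>x. x j)"
      using continuous_map_product_projection[OF j, of "\<lambda>i. top_of_set (s i)"]
      by (simp add: X_def continuous_map_in_subtopology)
    then show ?thesis by (rule openin_continuous_map_preimage) (use that in simp)
  qed
  have arc: "finite_type (X (s(j := A)))" if "contractible A" for A
    unfolding X_def
  proof (rule insert.IH)
    show "J \<subseteq> I" using insert.prems by auto
    show "(s(j := A)) i = sphere 0 1" if "i \<in> J" for i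
      using insert.prems insert.hyps that by auto
    show "contractible ((s(j := A)) i)" if "i \<in> I - J" for i
      using insert.prems \<open>contractible A\<close> that by auto
  qed
  have sj: "s j = sphere 0 1" using insert.prems by simp
  define U where "U = {x \<in> topspace (X s). x j \<in> - {1}}"
  define V where "V = {x \<in> topspace (X s). x j \<in> - {-1}}"
  let ?Y = "X (s(j := s j \<inter> - {1,-1}))"
  have UV: "U \<inter> V = {x \<in> topspace (X s). x j \<in> - {1, -1}}" by (auto simp: U_def V_def)
  \<comment> \<open>In the factor j the overlap of the two punctured circles is not contractible but
    a disjoint union of two half circles, which takes a second union, with empty
    intersection.\<close>
  have "finite_type ?Y"
  proof (rule finite_type_union)
    define P where "P \<sigma> = {x \<in> topspace ?Y. x j \<in> {z. 0 < (\<sigma>::real) * Im z}}" for \<sigma>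
    have opP: "openin ?Y (P \<sigma>)" for \<sigma>
      unfolding P_def by (rule op) (auto intro!: open_Collect_less continuous_intros)
    then show "openin ?Y (P 1)" "openin ?Y (P (-1))" by auto
    have arcs: "finite_type (subtopology ?Y (P \<sigma>))" if "\<bar>\<sigma>\<bar> = 1" for \<sigma>
    proof -
      have eq: "s j \<inter> - {1, - 1} \<inter> {z. 0 < \<sigma> * Im z} = {z \<in> sphere 0 1. 0 < \<sigma> * Im z}"
      proof -
        have "z \<notin> {1, - 1}" if "0 < \<sigma> * Im z" for z
          using that by (cases "z = 1"; cases "z = - 1") simp_all
        then show ?thesis unfolding sj by blast
      qed
      show ?thesis
        unfolding P_def sub using arc[OF contractible_half_circle[OF that]] by (simp add: eq)
    qed
    show "finite_type (subtopology ?Y (P 1))" "finite_type (subtopology ?Y (P (-1)))"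
      by (auto intro: arcs)
    have disj: "P 1 \<inter> P (-1) = {}" by (auto simp: P_def)
    show "finite_type (subtopology ?Y (P 1 \<inter> P (- 1)))"
      unfolding disj by (rule finite_type_empty) simp
    have "0 < Im z \<or> 0 < - Im z" if "z \<in> s j \<inter> - {1, - 1}" for z
    proof (rule ccontr)
      assume "\<not> ?thesis"
      then have "Im z = 0" by auto
      moreover have "(Re z)\<^sup>2 + (Im z)\<^sup>2 = 1" using that sj by (simp add: cmod_def)
      ultimately have "z = 1 \<or> z = -1" by (auto simp: complex_eq_iff power2_eq_1_iff)
      then show False using that by auto
    qed
    moreover have "x j \<in> s j \<inter> - {1, - 1}" if "x \<in> topspace ?Y" for x
    proof -
      have "x \<in> (\<Pi>\<^sub>E i\<in>I. (s(j := s j \<inter> - {1, - 1})) i)" using that by (simp add: X_def)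
      from PiE_mem[OF this j] show ?thesis by simp
    qed
    ultimately show "P 1 \<union> P (-1) = topspace ?Y" by (auto simp: P_def)
  qed
  then have W: "finite_type (subtopology (X s) (U \<inter> V))"
    by (simp only: UV sub)
  have arcs: "finite_type (X (s(j := s j \<inter> - {b})))" if "b \<in> sphere 0 1" for b
  proof -
    have "s j \<inter> - {b} = sphere 0 1 - {b}" using sj by blast
    then show ?thesis using arc[OF contractible_punctured_circle[OF that]] by (simp only:)
  qed
  have "finite_type (X s)"
  proof (rule finite_type_union[OF _ _ _ _ _ W])
    show "openin (X s) U" unfolding U_def by (rule op[OF open_Compl]) simp
    show "openin (X s) V" unfolding V_def by (rule op[OF open_Compl]) simp
    show "finite_type (subtopology (X s) U)" unfolding U_def sub by (rule arcs) simp
    show "finite_type (subtopology (X s) V)" unfolding V_def sub by (rule arcs) simp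
    show "U \<union> V = topspace (X s)" by (auto simp: U_def V_def)
  qed
  then show ?case unfolding X_def .
qed

lemma finite_type_torus: "finite_type (torus p)"
  unfolding torus_def
  using finite_type_product_circles[of "{..<p}" "{..<p}" "\<lambda>_. sphere 0 1"] by simp

section \<open>Collapsing the complement of an open set\<close>

definition collapse :: "'a set \<Rightarrow> 'a \<Rightarrow> 'a option" where
  "collapse T x = (if x \<in> T then Some x else None)"

text \<open>Unlike \<open>map_option h\<close>, this makes sense for a map h that preserves only the
  complement of T: a point of T that h moves out of T goes to infinity. The stages of a triad
  homotopy are of this kind.\<close>

definition collapse_map :: "'a set \<Rightarrow> ('a \<Rightarrow> 'a) \<Rightarrow> 'a option \<Rightarrow> 'a option" where
  "collapse_map T h y = (case y of None \<Rightarrow> None | Some x \<Rightarrow> collapse T (h x))"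

abbreviation (input) collapsed_space :: "'a topology \<Rightarrow> 'a set \<Rightarrow> 'a option topology" where
  "collapsed_space X T \<equiv> Alexandroff_compactification (subtopology X T)"

lemma collapse_map_collapse:
  "h ` (topspace X - T) \<subseteq> topspace X - T \<Longrightarrow> x \<in> topspace X \<Longrightarrow>
     collapse_map T h (collapse T x) = collapse T (h x)"
  by (auto simp: collapse_map_def collapse_def)

lemma collapse_map_eq_map_option:
  "f ` T \<subseteq> T \<Longrightarrow> y \<in> topspace (collapsed_space X T) \<Longrightarrow> collapse_map T f y = map_option f y"
  by (auto simp: collapse_map_def collapse_def)

lemma continuous_map_collapse:
  assumes X: "Hausdorff_space X" and T: "openin X T"
  shows "continuous_map X (collapsed_space X T) (collapse T)"
  unfolding continuous_map_def
proof (intro conjI allI impI)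
  show "collapse T \<in> topspace X \<rightarrow> topspace (collapsed_space X T)"
    by (auto simp: collapse_def)
  fix V assume "openin (collapsed_space X T) V"
  then consider U where "openin (subtopology X T) U" "V = Some ` U"
    | C where "compactin (subtopology X T) C" "V = insert None (Some ` (topspace (subtopology X T) - C))"
    by (auto simp: openin_Alexandroff_compactification)
  then show "openin X {x \<in> topspace X. collapse T x \<in> V}"
  proof cases
    case 1
    then have U: "openin X U" "U \<subseteq> T" using T by (auto simp: openin_open_subtopology)
    then have "U \<subseteq> topspace X" using openin_subset by blast
    then have "{x \<in> topspace X. collapse T x \<in> V} = U"
      using 1 U by (auto simp: collapse_def split: if_splits)
    then show ?thesis using U by simp
  next
    case 2
    then have C: "compactin X C" "C \<subseteq> T" by (auto simp: compactin_subtopology)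
    then have "{x \<in> topspace X. collapse T x \<in> V} = topspace X - C"
      using 2 by (auto simp: collapse_def split: if_splits)
    moreover have "closedin X C" using C X compactin_imp_closedin by blast
    ultimately show ?thesis by auto
  qed
qed

text \<open>Infinity is separated from the other points by local compactness, which open subsets of
  compact Hausdorff spaces inherit.\<close>

lemma Hausdorff_collapsed_space:
  assumes "Hausdorff_space X" "compact_space X" "openin X T"
  shows "Hausdorff_space (collapsed_space X T)"
proof -
  have "locally_compact_space (subtopology X T)"
    using assms by (intro locally_compact_space_open_subset)
      (auto intro: compact_imp_locally_compact_space)
  then show ?thesis
    using assms by (simp add: Hausdorff_space_Alexandroff_compactification Hausdorff_space_subtopology)
qed

text \<open>The product of the interval with the collapse maps a compact space onto a Hausdorff
  space, so it is closed and hence a quotient map; the homotopy descends because it keeps the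
  complement of T inside itself.\<close>

lemma continuous_map_collapse_homotopy:
  fixes X :: "'a topology" and k :: "real \<times> 'a \<Rightarrow> 'a"
  assumes X: "Hausdorff_space X" "compact_space X" and T: "openin X T" "T \<noteq> topspace X"
    and k: "continuous_map (prod_topology (top_of_set {0..1}) X) X k"
    and kT: "\<And>t x. t \<in> {0..1} \<Longrightarrow> x \<in> topspace X - T \<Longrightarrow> k (t, x) \<in> topspace X - T"
  shows "continuous_map (prod_topology (top_of_set {0..1}) (collapsed_space X T)) (collapsed_space X T)
           (\<lambda>(t, y). collapse_map T (\<lambda>x. k (t, x)) y)"
proof -
  let ?I = "top_of_set {0..1::real}" and ?C = "collapsed_space X T"
  let ?q = "\<lambda>(t::real, x). (t, collapse T x)"
  have q: "continuous_map X ?C (collapse T)"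
    by (rule continuous_map_collapse[OF X(1) T(1)])
  have cq: "continuous_map (prod_topology ?I X) (prod_topology ?I ?C) ?q"
    using continuous_map_prod_top[of ?I X ?I ?C id "collapse T"] q by simp
  have "compact_space ?I" by (simp add: compact_space_subtopology)
  then have c: "compact_space (prod_topology ?I X)"
    using X(2) by (simp add: compact_space_prod_topology)
  have h: "Hausdorff_space (prod_topology ?I ?C)"
    using Hausdorff_collapsed_space[OF X T(1)]
    by (simp add: Hausdorff_space_prod_topology Hausdorff_space_subtopology)
  have Tsub: "T \<subseteq> topspace X" using T(1) openin_subset by blast
  \<comment> \<open>A point outside T is what makes the collapse reach \<open>None\<close>.\<close>
  then obtain a where a: "a \<in> topspace X" "a \<notin> T" using T(2) by blast
  have "collapse T ` topspace X = topspace ?C"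
    using Tsub a by (force simp: collapse_def image_iff)
  then have "map_prod id (collapse T) ` ({0..1} \<times> topspace X) = {0..1::real} \<times> topspace ?C"
    by (intro map_prod_surj_on) simp_all
  moreover have "?q = map_prod id (collapse T)" by auto
  ultimately have "?q ` topspace (prod_topology ?I X) = topspace (prod_topology ?I ?C)"
    by (simp only: topspace_prod_topology topspace_euclidean_subtopology)
  then have quot: "quotient_map (prod_topology ?I X) (prod_topology ?I ?C) ?q"
    by (rule continuous_closed_imp_quotient_map[OF cq continuous_imp_closed_map[OF cq c h]])
  have eq: "(\<lambda>(t, y). collapse_map T (\<lambda>x. k (t, x)) y) (?q z) = collapse T (k z)"
    if "z \<in> topspace (prod_topology ?I X)" for z
  proof -
    obtain t x where z: "z = (t, x)" by (cases z)
    then show ?thesis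
      using that kT collapse_map_collapse[of "\<lambda>x. k (t, x)" X T x] by auto
  qed
  have "continuous_map (prod_topology ?I X) ?C (collapse T \<circ> k)"
    by (rule continuous_map_compose[OF k q])
  then have "continuous_map (prod_topology ?I X) ?C ((\<lambda>(t, y). collapse_map T (\<lambda>x. k (t, x)) y) \<circ> ?q)"
    by (rule continuous_map_eq) (use eq in simp)
  then show ?thesis
    using continuous_compose_quotient_map[OF quot] by blast
qed

lemma continuous_map_collapse_map:
  assumes X: "Hausdorff_space X" "compact_space X" and T: "openin X T" "T \<noteq> topspace X"
    and h: "continuous_map X X h" and hT: "h ` (topspace X - T) \<subseteq> topspace X - T"
  shows "continuous_map (collapsed_space X T) (collapsed_space X T) (collapse_map T h)"
proof -
  let ?I = "top_of_set {0..1::real}"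
  have "continuous_map (prod_topology ?I X) X (h \<circ> snd)"
    using h by (intro continuous_map_compose[OF continuous_map_snd])
  then have "continuous_map (prod_topology ?I (collapsed_space X T)) (collapsed_space X T)
      (\<lambda>(t::real, y). collapse_map T (\<lambda>x. (h \<circ> snd) (t, x)) y)"
    by (rule continuous_map_collapse_homotopy[OF X T]) (use hT in auto)
  then have "continuous_map (collapsed_space X T) (collapsed_space X T)
      ((\<lambda>(t::real, y). collapse_map T (\<lambda>x. (h \<circ> snd) (t, x)) y) \<circ> Pair 0)"
    by (rule continuous_map_o_Pair) simp
  then show ?thesis by (simp add: o_def)
qed

section \<open>Collars and the homology of a collapse\<close>

lemma iso_cancel_right:
  assumes f: "f \<in> iso A B" and h: "h \<in> hom B C" and g: "g \<in> iso A C"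
    and comm: "\<And>x. x \<in> carrier A \<Longrightarrow> h (f x) = g x"
  shows "h \<in> iso B C"
proof -
  have "bij_betw f (carrier A) (carrier B)" "bij_betw g (carrier A) (carrier C)"
    using f g unfolding iso_def by blast+
  moreover from this(2) have "bij_betw (h \<circ> f) (carrier A) (carrier C)"
    by (rule bij_betw_cong[THEN iffD1, rotated]) (simp add: comm)
  ultimately have "bij_betw h (carrier B) (carrier C)"
    using bij_betw_comp_iff by blast
  then show ?thesis using h unfolding iso_def by blast
qed

lemma iso_cancel_left:
  assumes g: "g \<in> iso B C" and h: "h \<in> hom A B" and k: "k \<in> iso A C"
    and comm: "\<And>x. x \<in> carrier A \<Longrightarrow> g (h x) = k x"
  shows "h \<in> iso A B"
proof -
  have "bij_betw g (carrier B) (carrier C)" "bij_betw k (carrier A) (carrier C)"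
    using g k unfolding iso_def by blast+
  moreover from this(2) have "bij_betw (g \<circ> h) (carrier A) (carrier C)"
    by (rule bij_betw_cong[THEN iffD1, rotated]) (simp add: comm)
  moreover have "h ` carrier A \<subseteq> carrier B" using h by (auto simp: hom_def)
  ultimately have "bij_betw h (carrier A) (carrier B)"
    using bij_betw_comp_iff2 by blast
  then show ?thesis using h unfolding iso_def by blast
qed

text \<open>A deformation of the neighbourhood N into A during which A need not be fixed pointwise.
  Invariance of A and of N at all times makes every stage a map of the pairs (X, A) and (X,
  N).\<close>

definition collar_homotopy :: "'a topology \<Rightarrow> 'a set \<Rightarrow> 'a set \<Rightarrow> (real \<times> 'a \<Rightarrow> 'a) \<Rightarrow> bool" where
  "collar_homotopy X A N k \<longleftrightarrow>
     closedin X A \<and> A \<noteq> {} \<and> openin X N \<and> A \<subseteq> N \<and>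
     continuous_map (prod_topology (top_of_set {0..1}) X) X k \<and>
     (\<forall>x\<in>topspace X. k (0, x) = x) \<and> (\<forall>x\<in>N. k (1, x) \<in> A) \<and>
     (\<forall>t\<in>{0..1}. \<forall>x\<in>A. k (t, x) \<in> A) \<and> (\<forall>t\<in>{0..1}. \<forall>x\<in>N. k (t, x) \<in> N)"

text \<open>The final stage maps (X, N) to (X, A), and the homotopy itself shows that it is inverse
  to the inclusion up to homotopy of pairs, on either side.\<close>

lemma collar_homotopy_iso:
  fixes X :: "'a topology" and k :: "real \<times> 'a \<Rightarrow> 'a"
  assumes k: "continuous_map (prod_topology (top_of_set {0..1}) X) X k"
    "\<And>x. x \<in> topspace X \<Longrightarrow> k (0, x) = x" "\<And>x. x \<in> N \<Longrightarrow> k (1, x) \<in> A"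
    "\<And>t x. t \<in> {0..1} \<Longrightarrow> x \<in> A \<Longrightarrow> k (t, x) \<in> A" "\<And>t x. t \<in> {0..1} \<Longrightarrow> x \<in> N \<Longrightarrow> k (t, x) \<in> N"
    and AN: "A \<subseteq> N" "N \<subseteq> topspace X"
  shows "hom_induced p X A X N id \<in> iso (relative_homology_group p X A) (relative_homology_group p X N)"
proof -
  have c1: "continuous_map X X (k \<circ> Pair 1)"
    by (rule continuous_map_o_Pair[OF k(1)]) simp
  have hom: "homotopic_with (\<lambda>h. h \<in> S \<rightarrow> S) X X (k \<circ> Pair 1) id"
    if S: "S \<subseteq> topspace X" "\<And>t x. t \<in> {0..1} \<Longrightarrow> x \<in> S \<Longrightarrow> k (t, x) \<in> S" for S
  proof -
    have "homotopic_with (\<lambda>h. h \<in> S \<rightarrow> S) X X id (k \<circ> Pair 1)"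
    proof (subst homotopic_with)
      show "(h \<in> S \<rightarrow> S) = (h' \<in> S \<rightarrow> S)" if "\<And>x. x \<in> topspace X \<Longrightarrow> h x = h' x" for h h' :: "'a \<Rightarrow> 'a"
        using that S(1) by (auto simp: Pi_iff subset_iff)
      show "\<exists>h. continuous_map (prod_topology (top_of_set {0..1::real}) X) X h \<and>
          (\<forall>x\<in>topspace X. h (0, x) = id x) \<and> (\<forall>x\<in>topspace X. h (1, x) = (k \<circ> Pair 1) x) \<and>
          (\<forall>t\<in>{0..1}. (\<lambda>x. h (t, x)) \<in> S \<rightarrow> S)"
        using k S by (intro exI[of _ k]) auto
    qed
    then show ?thesis by (rule homotopic_with_symD)
  qed
  show ?thesis
  proof (rule homotopy_equivalence_relative_homology_group_isomorphism[of X X id A N "k \<circ> Pair 1"])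
    have A: "A \<subseteq> topspace X" using AN by blast
    show "homotopic_with (\<lambda>h. h \<in> A \<rightarrow> A) X X ((k \<circ> Pair 1) \<circ> id) id"
      unfolding comp_id by (rule hom[OF A k(4)])
    show "homotopic_with (\<lambda>h. h \<in> N \<rightarrow> N) X X (id \<circ> (k \<circ> Pair 1)) id"
      unfolding id_comp by (rule hom[OF AN(2) k(5)])
    show "id \<in> A \<rightarrow> N" using AN(1) by auto
    show "k \<circ> Pair 1 \<in> N \<rightarrow> A" using k(3) by simp
  qed (use c1 in simp_all)
qed

text \<open>In general A cannot be excised from (X, A) itself. Thickening A to N, and
  \<open>None\<close> to the image of N, makes excision possible on both sides, and on what remains
  the collapse is the homeomorphism \<open>Some\<close>. The thickening downstairs is harmless
  because the collar homotopy descends.\<close>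

theorem collapse_relative_homology_iso:
  fixes X :: "'a topology"
  assumes X: "Hausdorff_space X" "compact_space X" and k: "collar_homotopy X A N k"
  defines "T \<equiv> topspace X - A"
  shows "hom_induced p X A (collapsed_space X T) {None} (collapse T)
    \<in> iso (relative_homology_group p X A) (relative_homology_group p (collapsed_space X T) {None})"
proof -
  have A: "closedin X A" "A \<noteq> {}" and N: "openin X N" "A \<subseteq> N"
    and kc: "continuous_map (prod_topology (top_of_set {0..1}) X) X k"
    and k0: "\<And>x. x \<in> topspace X \<Longrightarrow> k (0, x) = x" and k1: "\<And>x. x \<in> N \<Longrightarrow> k (1, x) \<in> A"
    and kA: "\<And>t x. t \<in> {0..1} \<Longrightarrow> x \<in> A \<Longrightarrow> k (t, x) \<in> A"
    and kN: "\<And>t x. t \<in> {0..1} \<Longrightarrow> x \<in> N \<Longrightarrow> k (t, x) \<in> N"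
    using k by (auto simp: collar_homotopy_def)
  note A = A closedin_subset[OF A(1)] and N = N openin_subset[OF N(1)]
  have T: "openin X T" "T \<noteq> topspace X" "T \<subseteq> topspace X" "topspace X - T = A"
    using A by (auto simp: T_def)
  let ?C = "collapsed_space X T" and ?c = "collapse T"
  let ?N = "insert None (Some ` (N \<inter> T))"
  let ?k = "\<lambda>(t, y). collapse_map T (\<lambda>x. k (t, x)) y"
  have c: "continuous_map X ?C ?c" by (rule continuous_map_collapse[OF X(1) T(1)])
  have i1: "hom_induced p X A X N id \<in> iso (relative_homology_group p X A) (relative_homology_group p X N)"
    by (rule collar_homotopy_iso[OF kc k0 k1 kA kN N(2,3)])
  have kc': "continuous_map (prod_topology (top_of_set {0..1}) ?C) ?C ?k"
    by (rule continuous_map_collapse_homotopy[OF X T(1,2) kc]) (use T(4) kA in auto)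
  have i2: "hom_induced p ?C {None} ?C ?N id
      \<in> iso (relative_homology_group p ?C {None}) (relative_homology_group p ?C ?N)"
  proof (rule collar_homotopy_iso[OF kc'])
    show "?k (0, y) = y" if "y \<in> topspace ?C" for y
      using that k0 by (auto simp: collapse_map_def collapse_def)
    show "?k (1, y) \<in> {None}" if "y \<in> ?N" for y
      using that k1 by (auto simp: collapse_map_def collapse_def T_def)
    show "?k (t, y) \<in> ?N" if "t \<in> {0..1}" "y \<in> ?N" for t y
      using that kN by (auto simp: collapse_map_def collapse_def)
  qed (use N in \<open>auto simp: collapse_map_def\<close>)
  have "closedin (subtopology X T) (T - N)"
    using N(1) T(3) by (auto simp: closedin_subtopology T_def intro!: exI[of _ "topspace X - N"])
  moreover have "closedin X (T - N)"
  proof -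
    have "T - N = topspace X - N" using N by (auto simp: T_def)
    then show ?thesis using closedin_diff[OF closedin_topspace N(1)] by (simp only:)
  qed
  then have "compactin X (T - N)" using X(2) closedin_compact_space by blast
  then have "compactin (subtopology X T) (T - N)" by (simp add: compactin_subtopology)
  ultimately have "openin ?C (insert None (Some ` (topspace (subtopology X T) - (T - N))))"
    unfolding openin_Alexandroff_compactification by blast
  moreover have "topspace (subtopology X T) - (T - N) = N \<inter> T" using N T by auto
  ultimately have N': "openin ?C ?N" by simp
  have "closedin ?C {None}"
    using X T Hausdorff_collapsed_space closedin_Hausdorff_singleton
    by (metis insertI1 topspace_Alexandroff_compactification)
  have e1: "hom_induced p (subtopology X T) (N - A) X N id
      \<in> iso (relative_homology_group p (subtopology X T) (N - A)) (relative_homology_group p X N)"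
    using homology_excision_axiom[of X A N "topspace X" p] A N
    by (simp add: closure_of_closedin interior_of_openin T_def)
  have e2: "hom_induced p (subtopology ?C (topspace ?C - {None})) (?N - {None}) ?C ?N id
      \<in> iso (relative_homology_group p (subtopology ?C (topspace ?C - {None})) (?N - {None}))
            (relative_homology_group p ?C ?N)"
    using homology_excision_axiom[of ?C "{None}" ?N "topspace ?C" p] N' \<open>closedin ?C {None}\<close>
      openin_subset[OF N']
    by (simp add: closure_of_closedin interior_of_openin del: topspace_Alexandroff_compactification)
  have e3: "hom_induced p (subtopology X T) (N - A) (subtopology ?C (topspace ?C - {None})) (?N - {None}) Some
      \<in> iso (relative_homology_group p (subtopology X T) (N - A))
            (relative_homology_group p (subtopology ?C (topspace ?C - {None})) (?N - {None}))"
  proof (rule homeomorphic_map_relative_homology_iso)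
    have "topspace ?C - {None} = Some ` topspace (subtopology X T)" by auto
    then show "homeomorphic_map (subtopology X T) (subtopology ?C (topspace ?C - {None})) Some"
      using embedding_map_Some[of "subtopology X T"] by (simp add: embedding_map_def)
    show "N - A \<subseteq> topspace (subtopology X T)" "Some ` (N - A) = ?N - {None}"
      using N by (auto simp: T_def)
  qed
  have Some: "continuous_map (subtopology X T) (subtopology ?C (topspace ?C - {None})) Some"
    using continuous_map_Some[of "subtopology X T"] by (auto simp: continuous_map_in_subtopology)
  have e4: "hom_induced p X N ?C ?N ?c \<in> iso (relative_homology_group p X N) (relative_homology_group p ?C ?N)"
  proof (rule iso_cancel_right[OF e1 hom_induced_hom iso_set_trans[OF e3 e2]])
    fix x
    have "hom_induced p X N ?C ?N ?c (hom_induced p (subtopology X T) (N - A) X N id x) =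
        hom_induced p (subtopology X T) (N - A) ?C ?N (?c \<circ> id) x"
      using N c by (intro hom_induced_compose')
        (auto simp: collapse_def T_def continuous_map_from_subtopology)
    also have "\<dots> = hom_induced p (subtopology X T) (N - A) ?C ?N (id \<circ> Some) x"
      using hom_induced_eq[of "subtopology X T" "?c \<circ> id" "id \<circ> Some"] by (simp add: collapse_def)
    also have "\<dots> = hom_induced p (subtopology ?C (topspace ?C - {None})) (?N - {None}) ?C ?N id
        (hom_induced p (subtopology X T) (N - A) (subtopology ?C (topspace ?C - {None})) (?N - {None}) Some x)"
      using N Some by (intro hom_induced_compose'[symmetric])
        (auto simp: T_def continuous_map_from_subtopology)
    finally show "hom_induced p X N ?C ?N ?c (hom_induced p (subtopology X T) (N - A) X N id x) =
        (hom_induced p (subtopology ?C (topspace ?C - {None})) (?N - {None}) ?C ?N id \<circ>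
         hom_induced p (subtopology X T) (N - A) (subtopology ?C (topspace ?C - {None})) (?N - {None}) Some) x"
      by simp
  qed
  show ?thesis
  proof (rule iso_cancel_left[OF i2 hom_induced_hom iso_set_trans[OF i1 e4]])
    fix x
    have "hom_induced p ?C {None} ?C ?N id (hom_induced p X A ?C {None} ?c x) =
        hom_induced p X A ?C ?N (id \<circ> ?c) x"
      using c by (intro hom_induced_compose') (auto simp: collapse_def T_def)
    also have "id \<circ> ?c = ?c \<circ> id" by simp
    also have "hom_induced p X A ?C ?N (?c \<circ> id) x = hom_induced p X N ?C ?N ?c (hom_induced p X A X N id x)"
      by (rule hom_induced_compose'[symmetric]) (use c N in \<open>auto simp: collapse_def T_def\<close>)
    finally show "hom_induced p ?C {None} ?C ?N id (hom_induced p X A ?C {None} ?c x) =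
        (hom_induced p X N ?C ?N ?c \<circ> hom_induced p X A X N id) x"
      by (simp only: comp_apply id_def)
  qed
qed

text \<open>A continuous map need not extend to the point at infinity; here preimages of compact
  sets are images under the continuous inverse, hence compact.\<close>

lemma continuous_map_Alexandroff_map_option:
  assumes h: "homeomorphic_maps Y Z f g"
  shows "continuous_map (Alexandroff_compactification Y) (Alexandroff_compactification Z) (map_option f)"
  unfolding continuous_map_def
proof (intro conjI allI impI)
  have fc: "continuous_map Y Z f" and gc: "continuous_map Z Y g"
    and gf: "\<And>x. x \<in> topspace Y \<Longrightarrow> g (f x) = x" and fg: "\<And>y. y \<in> topspace Z \<Longrightarrow> f (g y) = y"
    using h by (auto simp: homeomorphic_maps_def)
  have fim: "f x \<in> topspace Z" if "x \<in> topspace Y" for x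
    using that fc continuous_map_image_subset_topspace by fastforce
  have gim: "g x \<in> topspace Y" if "x \<in> topspace Z" for x
    using that gc continuous_map_image_subset_topspace by fastforce
  show "map_option f \<in> topspace (Alexandroff_compactification Y) \<rightarrow> topspace (Alexandroff_compactification Z)"
    using fim by auto
  fix V assume "openin (Alexandroff_compactification Z) V"
  then consider U where "openin Z U" "V = Some ` U"
    | C where "compactin Z C" "closedin Z C" "V = insert None (Some ` (topspace Z - C))"
    by (auto simp: openin_Alexandroff_compactification)
  then show "openin (Alexandroff_compactification Y)
      {x \<in> topspace (Alexandroff_compactification Y). map_option f x \<in> V}"
  proof cases
    case 1
    have "{x \<in> topspace (Alexandroff_compactification Y). map_option f x \<in> V} =
        Some ` {x \<in> topspace Y. f x \<in> U}"
      using 1 by auto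
    then show ?thesis
      using openin_continuous_map_preimage[OF fc 1(1)] by simp
  next
    case 2
    have C: "C \<subseteq> topspace Z" using 2(2) closedin_subset by blast
    have "{x \<in> topspace Y. f x \<in> C} = g ` C"
    proof (intro equalityI subsetI)
      fix x assume "x \<in> {x \<in> topspace Y. f x \<in> C}"
      then show "x \<in> g ` C" using gf[of x] by (intro image_eqI[of _ _ "f x"]) auto
    next
      fix x assume "x \<in> g ` C"
      then show "x \<in> {x \<in> topspace Y. f x \<in> C}" using C gim fg by auto
    qed
    then have "compactin Y {x \<in> topspace Y. f x \<in> C}" "closedin Y {x \<in> topspace Y. f x \<in> C}"
      using image_compactin[OF 2(1) gc] closedin_continuous_map_preimage[OF fc 2(2)] by auto
    moreover have "{x \<in> topspace (Alexandroff_compactification Y). map_option f x \<in> V} =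
        insert None (Some ` (topspace Y - {x \<in> topspace Y. f x \<in> C}))"
      using 2 fim by auto
    ultimately show ?thesis
      unfolding openin_Alexandroff_compactification by blast
  qed
qed

lemma homeomorphic_maps_Alexandroff:
  assumes h: "homeomorphic_maps Y Z f g"
  shows "homeomorphic_maps (Alexandroff_compactification Y) (Alexandroff_compactification Z)
           (map_option f) (map_option g)"
proof -
  have "homeomorphic_maps Z Y g f" using h homeomorphic_maps_sym by blast
  from continuous_map_Alexandroff_map_option[OF h] continuous_map_Alexandroff_map_option[OF this]
  show ?thesis using h by (auto simp: homeomorphic_maps_def)
qed

lemma relative_homology_Alexandroff_homeomorphic:
  assumes "Y homeomorphic_space Z"
  shows "relative_homology_group p (Alexandroff_compactification Y) {None} \<cong>
         relative_homology_group p (Alexandroff_compactification Z) {None}"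
proof -
  obtain f g where "homeomorphic_maps Y Z f g"
    using assms homeomorphic_space_def by blast
  then have h: "homeomorphic_map (Alexandroff_compactification Y) (Alexandroff_compactification Z) (map_option f)"
    using homeomorphic_maps_Alexandroff homeomorphic_map_maps by blast
  have "hom_induced p (Alexandroff_compactification Y) {None} (Alexandroff_compactification Z) {None} (map_option f)
    \<in> iso (relative_homology_group p (Alexandroff_compactification Y) {None})
        (relative_homology_group p (Alexandroff_compactification Z) {None})"
    by (rule homeomorphic_map_relative_homology_iso[OF h]) auto
  then show ?thesis by (rule is_isoI)
qed

text \<open>The 1 is the Lefschetz number of the point at infinity; the part relative to that point
  is conjugate, by the collapse, to the part relative to A.\<close>

lemma lefschetz_number_collapse:
  assumes X: "Hausdorff_space X" "compact_space X" and k: "collar_homotopy X A N k"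
    and ft: "finite_type_pair X A"
    and f: "continuous_map X X f" "f ` A \<subseteq> A" "f ` (topspace X - A) \<subseteq> topspace X - A"
  shows "lefschetz_number (map_option f) (collapsed_space X (topspace X - A)) = 1 + relative_lefschetz_number f X A"
proof -
  define T where "T = topspace X - A"
  let ?C = "collapsed_space X T"
  have A: "closedin X A" "A \<noteq> {}" "A \<subseteq> topspace X"
    using k closedin_subset by (auto simp: collar_homotopy_def)
  then have T: "openin X T" "T \<noteq> topspace X" "topspace X - T = A"
    by (auto simp: T_def)
  have iso: "hom_induced p X A ?C {None} (collapse T) \<in> iso (relative_homology_group p X A) (relative_homology_group p ?C {None})" for p
    unfolding T_def by (rule collapse_relative_homology_iso[OF X k])
  have "continuous_map ?C ?C (collapse_map T f)"
    by (rule continuous_map_collapse_map[OF X T(1,2) f(1)]) (use f(2) T(3) in auto)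
  then have fc: "continuous_map ?C ?C (map_option f)"
    using f(3) collapse_map_eq_map_option[of f T _ X] T_def by (elim continuous_map_eq) auto
  have rel: "relative_lefschetz_number (map_option f) ?C {None} = relative_lefschetz_number f X A"
  proof (rule relative_lefschetz_number_conjugate[OF ft iso])
    show "continuous_map X ?C (collapse T)" by (rule continuous_map_collapse[OF X(1) T(1)])
    show "map_option f (collapse T x) = collapse T (f x)" if "x \<in> topspace X" for x
      using that f(2,3) by (auto simp: collapse_def T_def)
  qed (use f fc in \<open>auto simp: collapse_def T_def\<close>)
  have ftC: "finite_type_pair ?C {None}"
    by (rule finite_type_pair_iso[OF ft]) (use iso in \<open>auto intro: is_isoI\<close>)
  have s: "topspace (subtopology ?C {None}) = {None}" by auto
  have "lefschetz_number (map_option f) ?C = lefschetz_number (map_option f) (subtopology ?C {None})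
      + relative_lefschetz_number (map_option f) ?C {None}"
    by (rule lefschetz_number_pair[OF fc _ _ ftC])
      (auto intro!: finite_type_contractible)
  moreover have "lefschetz_number (map_option f) (subtopology ?C {None}) = 1"
    by (rule lefschetz_number_singleton[OF s])
      (use fc in \<open>auto simp: continuous_map_in_subtopology continuous_map_from_subtopology\<close>)
  ultimately show ?thesis using rel by (simp add: T_def)
qed

section \<open>Radial geometry of the torus\<close>

lemma continuous_map_compose_on:
  assumes "continuous_map Z euclidean g" "\<And>z. z \<in> topspace Z \<Longrightarrow> g z \<in> S" "continuous_on S f"
  shows "continuous_map Z euclidean (\<lambda>z. f (g z))"
proof -
  have "continuous_map Z (top_of_set S) g"
    using assms(1,2) by (auto simp: continuous_map_in_subtopology)
  moreover have "continuous_map (top_of_set S) euclidean f" using assms(3) by simp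
  ultimately show ?thesis
    using continuous_map_compose[of Z "top_of_set S" g euclidean f] by (simp add: o_def)
qed

lemma in_topspace_torus: "x \<in> topspace (torus p) \<longleftrightarrow> x \<in> extensional {..<p} \<and> (\<forall>i<p. cmod (x i) = 1)"
  by (auto simp: torus_def PiE_iff)

lemma continuous_map_torus_coordinate: "i < p \<Longrightarrow> continuous_map (torus p) euclidean (\<lambda>x. x i)"
  using continuous_map_product_projection[of i "{..<p}" "\<lambda>_. top_of_set (sphere (0::complex) 1)"]
  by (simp add: torus_def continuous_map_in_subtopology)

lemma continuous_map_into_torus:
  assumes "\<And>z. z \<in> topspace Z \<Longrightarrow> g z \<in> topspace (torus p)"
    "\<And>i. i < p \<Longrightarrow> continuous_map Z euclidean (\<lambda>z. g z i)"
  shows "continuous_map Z (torus p) g"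
  unfolding torus_def continuous_map_componentwise
  using assms by (auto simp: in_topspace_torus continuous_map_in_subtopology)

lemma compact_Hausdorff_torus: "compact_space (torus p)" "Hausdorff_space (torus p)"
  unfolding torus_def
  by (auto simp: compact_space_product_topology compact_space_subtopology Hausdorff_space_product_topology
      Hausdorff_space_subtopology)

text \<open>The Euclidean norm of the vector of angles in [-pi, pi]. The absolute value of an angle
  is arccos of the real part, which is continuous on the whole circle, while the angle itself is
  not.\<close>

definition torus_radius :: "nat \<Rightarrow> (nat \<Rightarrow> complex) \<Rightarrow> real" where
  "torus_radius p x = sqrt (\<Sum>i<p. (arccos (Re (x i)))\<^sup>2)"

text \<open>The angles themselves, correct as long as they are at most pi/2 in absolute value. The
  value 0 beyond p places the vector in \<open>Euclidean_space p\<close>, as \<open>nsphere\<close>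
  requires.\<close>

definition torus_angle :: "nat \<Rightarrow> (nat \<Rightarrow> complex) \<Rightarrow> nat \<Rightarrow> real" where
  "torus_angle p x = (\<lambda>i. if i < p then arcsin (Im (x i)) else 0)"

text \<open>Multiplies the angles by \<open>1 + l\<close> as long as they are at most \<open>\<pi>/2\<close>; being defined through
  \<open>arcsin\<close>, it is continuous on the whole torus.\<close>

definition torus_scale :: "nat \<Rightarrow> real \<Rightarrow> (nat \<Rightarrow> complex) \<Rightarrow> nat \<Rightarrow> complex" where
  "torus_scale p l x = (\<lambda>i\<in>{..<p}. x i * cis (l * arcsin (Im (x i))))"

lemma torus_coordinate_bounds:
  assumes "x \<in> topspace (torus p)" "i < p"
  shows "\<bar>Re (x i)\<bar> \<le> 1" "\<bar>Im (x i)\<bar> \<le> 1"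
  using assms abs_Re_le_cmod[of "x i"] abs_Im_le_cmod[of "x i"] by (auto simp: in_topspace_torus)

lemma continuous_map_torus_radius: "continuous_map (torus p) euclideanreal (torus_radius p)"
proof -
  have "continuous_map (torus p) euclideanreal (\<lambda>x. arccos (Re (x i)))" if "i < p" for i
    by (rule continuous_map_compose_on[OF continuous_map_torus_coordinate[OF that],
          of "{z. \<bar>Re z\<bar> \<le> 1}" "\<lambda>z. arccos (Re z)"])
      (use torus_coordinate_bounds that in \<open>auto intro!: continuous_intros simp: abs_le_iff\<close>)
  then have "continuous_map (torus p) euclideanreal (\<lambda>x. \<Sum>i<p. (arccos (Re (x i)))\<^sup>2)"
    by (intro continuous_map_sum continuous_map_real_pow) auto
  then show ?thesis
    unfolding torus_radius_def
    by (rule continuous_map_compose_on[where S = UNIV]) (auto intro: continuous_intros)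
qed

lemma torus_radius_nonneg [simp]: "torus_radius p x \<ge> 0"
  by (simp add: torus_radius_def sum_nonneg)

lemma torus_exp_in_torus: "torus_exp p \<theta> \<in> topspace (torus p)"
  by (auto simp: in_topspace_torus torus_exp_def)

lemma torus_radius_exp:
  assumes "\<And>i. i < p \<Longrightarrow> \<bar>\<theta> i\<bar> \<le> pi"
  shows "torus_radius p (torus_exp p \<theta>) = sqrt (\<Sum>i<p. (\<theta> i)\<^sup>2)"
  unfolding torus_radius_def using assms by (simp add: torus_exp_def arccos_cos_eq_abs)

lemma abs_le_sqrt_sum_squares:
  assumes "i < (p::nat)" shows "\<bar>\<theta> i :: real\<bar> \<le> sqrt (\<Sum>i<p. (\<theta> i)\<^sup>2)"
proof -
  have "(\<theta> i)\<^sup>2 \<le> (\<Sum>i<p. (\<theta> i)\<^sup>2)"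
    using assms by (intro member_le_sum) auto
  then show ?thesis by (rule real_le_rsqrt[of "\<bar>\<theta> i\<bar>", simplified])
qed

lemma torus_exp_Arg:
  assumes "x \<in> topspace (torus p)" shows "torus_exp p (\<lambda>i. Arg (x i)) = x"
proof
  fix i
  show "torus_exp p (\<lambda>i. Arg (x i)) i = x i"
  proof (cases "i < p")
    case True
    then have n: "cmod (x i) = 1" using assms by (simp add: in_topspace_torus)
    then have "x i \<noteq> 0" by auto
    then show ?thesis using True n by (simp add: torus_exp_def cis_Arg sgn_div_norm)
  next
    case False
    then show ?thesis using assms by (simp add: in_topspace_torus torus_exp_def extensional_def)
  qed
qed

lemma torus_exp_surj:
  assumes "x \<in> topspace (torus p)"
  obtains \<theta> where "x = torus_exp p \<theta>" "torus_radius p x = sqrt (\<Sum>i<p. (\<theta> i)\<^sup>2)"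
    "\<And>i. i < p \<Longrightarrow> \<bar>\<theta> i\<bar> \<le> torus_radius p x"
proof
  have "\<bar>Arg (x i)\<bar> \<le> pi" for i using Arg_bounded[of "x i"] by (simp add: abs_le_iff)
  then have r: "torus_radius p (torus_exp p (\<lambda>i. Arg (x i))) = sqrt (\<Sum>i<p. (Arg (x i))\<^sup>2)"
    by (intro torus_radius_exp)
  show "x = torus_exp p (\<lambda>i. Arg (x i))" using torus_exp_Arg[OF assms] by simp
  show "torus_radius p x = sqrt (\<Sum>i<p. (Arg (x i))\<^sup>2)" using r torus_exp_Arg[OF assms] by simp
  then show "\<bar>Arg (x i)\<bar> \<le> torus_radius p x" if "i < p" for i
    using abs_le_sqrt_sum_squares[OF that, of "\<lambda>i. Arg (x i)"] by simp
qed

lemma torus_disc_eq: "torus_disc p = {x \<in> topspace (torus p). torus_radius p x \<le> 1}"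
proof (intro equalityI subsetI)
  fix x assume "x \<in> torus_disc p"
  then obtain \<theta> where \<theta>: "x = torus_exp p \<theta>" "(\<Sum>i<p. (\<theta> i)\<^sup>2) \<le> 1" by (auto simp: torus_disc_def)
  then have "sqrt (\<Sum>i<p. (\<theta> i)\<^sup>2) \<le> 1" by simp
  then have "\<bar>\<theta> i\<bar> \<le> pi" if "i < p" for i
    using abs_le_sqrt_sum_squares[OF that, of \<theta>] pi_gt3 by linarith
  then show "x \<in> {x \<in> topspace (torus p). torus_radius p x \<le> 1}"
    using \<theta> torus_exp_in_torus torus_radius_exp[of p \<theta>] by auto
next
  fix x assume x: "x \<in> {x \<in> topspace (torus p). torus_radius p x \<le> 1}"
  then obtain \<theta> where "x = torus_exp p \<theta>" "torus_radius p x = sqrt (\<Sum>i<p. (\<theta> i)\<^sup>2)"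
    using torus_exp_surj by blast
  then show "x \<in> torus_disc p" using x by (auto simp: torus_disc_def)
qed

lemma torus_disc_boundary_eq: "torus_disc_boundary p = {x \<in> topspace (torus p). torus_radius p x = 1}"
proof (intro equalityI subsetI)
  fix x assume "x \<in> torus_disc_boundary p"
  then obtain \<theta> where \<theta>: "x = torus_exp p \<theta>" "(\<Sum>i<p. (\<theta> i)\<^sup>2) = 1" by (auto simp: torus_disc_boundary_def)
  then have "\<bar>\<theta> i\<bar> \<le> pi" if "i < p" for i
    using abs_le_sqrt_sum_squares[OF that, of \<theta>] pi_gt3 by simp
  then show "x \<in> {x \<in> topspace (torus p). torus_radius p x = 1}"
    using \<theta> torus_exp_in_torus torus_radius_exp[of p \<theta>] by auto
next
  fix x assume x: "x \<in> {x \<in> topspace (torus p). torus_radius p x = 1}"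
  then obtain \<theta> where "x = torus_exp p \<theta>" "torus_radius p x = sqrt (\<Sum>i<p. (\<theta> i)\<^sup>2)"
    using torus_exp_surj by blast
  then show "x \<in> torus_disc_boundary p" using x by (auto simp: torus_disc_boundary_def)
qed

lemma torus_scale_in_torus: "x \<in> topspace (torus p) \<Longrightarrow> torus_scale p l x \<in> topspace (torus p)"
  by (auto simp: in_topspace_torus torus_scale_def norm_mult)

lemma torus_scale_0: "x \<in> topspace (torus p) \<Longrightarrow> torus_scale p 0 x = x"
  by (force simp: in_topspace_torus torus_scale_def extensional_def)

lemma torus_scale_exp:
  assumes "\<And>i. i < p \<Longrightarrow> \<bar>\<theta> i\<bar> \<le> pi / 2"
  shows "torus_scale p l (torus_exp p \<theta>) = torus_exp p (\<lambda>i. (1 + l) * \<theta> i)"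
proof
  fix i
  have "arcsin (sin (\<theta> i)) = \<theta> i" if "i < p"
    using assms[OF that] by (intro arcsin_sin) (auto simp: abs_le_iff)
  then show "torus_scale p l (torus_exp p \<theta>) i = torus_exp p (\<lambda>i. (1 + l) * \<theta> i) i"
    by (auto simp: torus_scale_def torus_exp_def cis_mult algebra_simps)
qed

text \<open>Two bounds meet here: angles up to 3/2 < pi/2 are recovered exactly by arcsin, and after
  scaling by at most 2 they are at most 3 < pi, so that the radius is still the norm of the angle
  vector.\<close>

lemma torus_scale_small:
  assumes x: "x \<in> topspace (torus p)" and r: "torus_radius p x \<le> 3/2" and l: "-1 \<le> l" "l \<le> 1"
  shows "torus_radius p (torus_scale p l x) = (1 + l) * torus_radius p x"
proof -
  obtain \<theta> where \<theta>: "x = torus_exp p \<theta>" "torus_radius p x = sqrt (\<Sum>i<p. (\<theta> i)\<^sup>2)"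
      "\<And>i. i < p \<Longrightarrow> \<bar>\<theta> i\<bar> \<le> torus_radius p x"
    using torus_exp_surj[OF x] by blast
  have b: "\<bar>\<theta> i\<bar> \<le> 3/2" if "i < p" for i using \<theta>(3)[OF that] r by simp
  have scale: "torus_scale p l x = torus_exp p (\<lambda>i. (1 + l) * \<theta> i)"
    unfolding \<theta>(1) by (rule torus_scale_exp) (use b pi_gt3 in force)
  have "\<bar>(1 + l) * \<theta> i\<bar> \<le> pi" if "i < p" for i
  proof -
    have "\<bar>1 + l\<bar> * \<bar>\<theta> i\<bar> \<le> 2 * (3/2)"
      using b[OF that] l by (intro mult_mono) auto
    then show ?thesis using pi_gt3 by (simp add: abs_mult)
  qed
  then have "torus_radius p (torus_scale p l x) = sqrt (\<Sum>i<p. ((1 + l) * \<theta> i)\<^sup>2)"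
    unfolding scale by (rule torus_radius_exp)
  also have "\<dots> = sqrt ((1 + l)\<^sup>2 * (\<Sum>i<p. (\<theta> i)\<^sup>2))"
    by (simp add: power_mult_distrib sum_distrib_left)
  also have "\<dots> = (1 + l) * torus_radius p x"
    using l by (simp add: real_sqrt_mult \<theta>(2))
  finally show ?thesis .
qed

lemma continuous_map_torus_scale:
  assumes l: "continuous_map Z euclideanreal l" and g: "continuous_map Z (torus p) g"
  shows "continuous_map Z (torus p) (\<lambda>z. torus_scale p (l z) (g z))"
proof (rule continuous_map_into_torus)
  have gz: "g z \<in> topspace (torus p)" if "z \<in> topspace Z" for z
    using g that continuous_map_image_subset_topspace by fastforce
  then show "torus_scale p (l z) (g z) \<in> topspace (torus p)" if "z \<in> topspace Z" for z
    using that torus_scale_in_torus by blast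
  fix i assume i: "i < p"
  have "continuous_map Z euclidean ((\<lambda>x. x i) \<circ> g)"
    by (rule continuous_map_compose[OF g continuous_map_torus_coordinate[OF i]])
  then have "continuous_map Z (prod_topology euclideanreal euclidean) (\<lambda>z. (l z, g z i))"
    using l by (simp add: continuous_map_pairwise o_def del: prod_topology_euclidean)
  then have pair: "continuous_map Z euclidean (\<lambda>z. (l z, g z i))" by simp
  have "continuous_map Z euclidean (\<lambda>z. (\<lambda>lw. snd lw * cis (fst lw * arcsin (Im (snd lw)))) (l z, g z i))"
  proof (rule continuous_map_compose_on[OF pair])
    show "(l z, g z i) \<in> {lw. \<bar>Im (snd lw)\<bar> \<le> 1}" if "z \<in> topspace Z" for z
      using torus_coordinate_bounds(2)[OF gz[OF that] i] by simp
    show "continuous_on {lw. \<bar>Im (snd lw)\<bar> \<le> 1} (\<lambda>lw. snd lw * cis (fst lw * arcsin (Im (snd lw))))"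
      by (intro continuous_intros) (auto simp: abs_le_iff)
  qed
  then show "continuous_map Z euclidean (\<lambda>z. torus_scale p (l z) (g z) i)"
    using i by (simp add: torus_scale_def)
qed

text \<open>\<open>collar_radius 1\<close> collapses \<open>[1, 5/4]\<close> to \<open>1\<close>, stretches \<open>[5/4, 3/2]\<close> to \<open>[1, 3/2]\<close> and is the
  identity elsewhere.\<close>

definition collar_radius :: "real \<Rightarrow> real \<Rightarrow> real" where
  "collar_radius t r = (1 - t) * r + t * min r (max 1 (2 * r - 3/2))"

text \<open>Scaling by 1 + l with l = (c - r) / r turns radius r into c. The denominator max 1 r
  removes the singularity at r = 0 and has no other effect, because c = r for r \<le> 1. Since c = r
  also for r \<ge> 3/2, only radii at which \<open>torus_scale\<close> is a true dilation are
  moved.\<close>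

definition torus_collar :: "nat \<Rightarrow> real \<times> (nat \<Rightarrow> complex) \<Rightarrow> nat \<Rightarrow> complex" where
  "torus_collar p = (\<lambda>(t, x). torus_scale p
     ((collar_radius t (torus_radius p x) - torus_radius p x) / max 1 (torus_radius p x)) x)"

lemma collar_radius_props:
  assumes "0 \<le> t" "t \<le> 1" "0 \<le> r"
  shows "collar_radius t r \<le> r" "r \<ge> 1 \<Longrightarrow> collar_radius t r \<ge> 1"
    "r \<le> 1 \<Longrightarrow> collar_radius t r = r" "r \<ge> 3/2 \<Longrightarrow> collar_radius t r = r"
    "collar_radius 0 r = r" "1 \<le> r \<Longrightarrow> r \<le> 5/4 \<Longrightarrow> collar_radius 1 r = 1"
proof -
  let ?m = "min r (max 1 (2 * r - 3/2))"
  have eq: "collar_radius t r = r + t * (?m - r)" by (simp add: collar_radius_def algebra_simps)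
  have "t * (?m - r) \<le> 0" using assms by (intro mult_nonneg_nonpos) auto
  then show "collar_radius t r \<le> r" using eq by simp
  show "collar_radius t r \<ge> 1" if "r \<ge> 1"
  proof -
    have "(1 - t) * 1 + t * 1 \<le> (1 - t) * r + t * ?m"
      using assms that by (intro add_mono mult_left_mono) auto
    then show ?thesis by (simp add: collar_radius_def)
  qed
  show "collar_radius t r = r" if "r \<le> 1" using that eq by (auto simp: min_def max_def)
  show "collar_radius t r = r" if "r \<ge> 3/2" using that eq by (auto simp: min_def max_def)
  show "collar_radius 0 r = r" by (simp add: collar_radius_def)
  show "collar_radius 1 r = 1" if "1 \<le> r" "r \<le> 5/4"
    using that by (auto simp: collar_radius_def min_def max_def)
qed

lemma torus_collar_in_torus:
  "x \<in> topspace (torus p) \<Longrightarrow> torus_collar p (t, x) \<in> topspace (torus p)"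
  by (simp add: torus_collar_def torus_scale_in_torus)

lemma torus_collar_fixed:
  assumes "x \<in> topspace (torus p)" "t \<in> {0..1}"
    "t = 0 \<or> torus_radius p x \<le> 1 \<or> torus_radius p x \<ge> 3/2"
  shows "torus_collar p (t, x) = x"
  using assms collar_radius_props[of t "torus_radius p x"]
  by (auto simp: torus_collar_def torus_scale_0)

lemma torus_radius_collar:
  assumes x: "x \<in> topspace (torus p)" and t: "t \<in> {0..1}"
  shows "torus_radius p (torus_collar p (t, x)) = collar_radius t (torus_radius p x)"
proof (cases "torus_radius p x \<le> 1 \<or> torus_radius p x \<ge> 3/2")
  case True
  then show ?thesis
    using torus_collar_fixed[OF x t] collar_radius_props[of t "torus_radius p x"] t by auto
next
  case False
  define r where "r = torus_radius p x"
  define l where "l = (collar_radius t r - r) / r"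
  have r: "1 < r" "r < 3/2" using False by (auto simp: r_def)
  have c: "collar_radius t r \<le> r" "1 \<le> collar_radius t r"
    using collar_radius_props(1,2)[of t r] t r by auto
  have "l \<le> 0" "-1 \<le> l"
    using r c by (auto simp: l_def divide_le_0_iff field_simps)
  moreover have "torus_collar p (t, x) = torus_scale p l x"
    using r by (simp add: torus_collar_def l_def r_def max_def)
  ultimately have "torus_radius p (torus_collar p (t, x)) = (1 + l) * r"
    using torus_scale_small[OF x, of l] r by (simp add: r_def)
  also have "\<dots> = collar_radius t r" using r by (simp add: l_def field_simps)
  finally show ?thesis by (simp add: r_def)
qed

lemma continuous_map_torus_collar:
  assumes \<tau>: "continuous_map Z euclideanreal \<tau>" and g: "continuous_map Z (torus p) g"
  shows "continuous_map Z (torus p) (\<lambda>z. torus_collar p (\<tau> z, g z))"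
proof -
  have "continuous_map Z euclideanreal (torus_radius p \<circ> g)"
    by (rule continuous_map_compose[OF g continuous_map_torus_radius])
  then have "continuous_map Z (prod_topology euclideanreal euclideanreal) (\<lambda>z. (\<tau> z, torus_radius p (g z)))"
    using \<tau> by (simp add: continuous_map_pairwise o_def del: prod_topology_euclidean)
  then have pair: "continuous_map Z euclidean (\<lambda>z. (\<tau> z, torus_radius p (g z)))" by simp
  have "continuous_map Z euclideanreal
      (\<lambda>z. (\<lambda>tr. (collar_radius (fst tr) (snd tr) - snd tr) / max 1 (snd tr)) (\<tau> z, torus_radius p (g z)))"
  proof (rule continuous_map_compose_on[OF pair])
    show "continuous_on UNIV (\<lambda>tr. (collar_radius (fst tr) (snd tr) - snd tr) / max 1 (snd tr))"
      unfolding collar_radius_def by (intro continuous_intros) (auto simp: max_def)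
  qed simp
  then show ?thesis
    using continuous_map_torus_scale[OF _ g] by (simp add: torus_collar_def)
qed

section \<open>The pair formed by the torus and its disc\<close>

lemma closedin_torus_disc: "closedin (torus p) (torus_disc p)"
proof -
  have "torus_disc p = {x \<in> topspace (torus p). torus_radius p x \<in> {..1}}"
    by (auto simp: torus_disc_eq)
  moreover have "closedin (torus p) {x \<in> topspace (torus p). torus_radius p x \<in> {..1}}"
    by (rule closedin_continuous_map_preimage[OF continuous_map_torus_radius]) simp
  ultimately show ?thesis by simp
qed

lemma torus_unit_in_torus: "torus_exp p (\<lambda>_. 0) \<in> torus_disc p"
  by (auto simp: torus_disc_def intro!: imageI)

text \<open>Scaling the angles by 1 - t contracts the disc radially to the point with all angles
  0.\<close>

lemma contractible_torus_disc: "contractible_space (subtopology (torus p) (torus_disc p))"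
proof -
  let ?D = "subtopology (torus p) (torus_disc p)" and ?I = "top_of_set {0..1::real}"
  have D: "topspace ?D = torus_disc p" by (auto simp: torus_disc_eq)
  have "continuous_map (prod_topology ?I ?D) euclideanreal (\<lambda>z. - fst z)"
    by (intro continuous_map_minus continuous_map_into_fulltopology[OF continuous_map_fst])
  then have "continuous_map (prod_topology ?I ?D) (torus p) (\<lambda>z. torus_scale p (- fst z) (snd z))"
    by (rule continuous_map_torus_scale[OF _ continuous_map_into_fulltopology[OF continuous_map_snd]])
  moreover have "torus_scale p (- t) x \<in> torus_disc p" if "t \<in> {0..1}" "x \<in> torus_disc p" for t x
  proof -
    have "torus_radius p (torus_scale p (- t) x) = (1 + - t) * torus_radius p x"
      using that by (intro torus_scale_small) (auto simp: torus_disc_eq)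
    also have "\<dots> \<le> 1 * 1"
      using that by (intro mult_mono) (auto simp: torus_disc_eq)
    finally show ?thesis
      using that torus_scale_in_torus by (auto simp: torus_disc_eq)
  qed
  ultimately have "continuous_map (prod_topology ?I ?D) ?D (\<lambda>z. torus_scale p (- fst z) (snd z))"
    using D by (auto simp: continuous_map_in_subtopology)
  moreover have "torus_scale p (- 1) x = torus_exp p (\<lambda>_. 0)" if "x \<in> torus_disc p" for x
  proof -
    obtain \<theta> where "x = torus_exp p \<theta>" "\<And>i. i < p \<Longrightarrow> \<bar>\<theta> i\<bar> \<le> torus_radius p x"
    proof (rule torus_exp_surj)
      show "x \<in> topspace (torus p)" using \<open>x \<in> torus_disc p\<close> by (simp add: torus_disc_eq)
    qed (use that in blast)
    moreover have "torus_radius p x \<le> pi / 2" using that pi_gt3 by (auto simp: torus_disc_eq)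
    ultimately show ?thesis
      using torus_scale_exp[of p \<theta> "-1"] by fastforce
  qed
  ultimately have "homotopic_with (\<lambda>x. True) ?D ?D id (\<lambda>x. torus_exp p (\<lambda>_. 0))"
    by (subst homotopic_with)
      (auto simp: D torus_scale_0 torus_disc_eq intro!: exI[of _ "\<lambda>z. torus_scale p (- fst z) (snd z)"])
  then show ?thesis by (auto simp: contractible_space_def)
qed

lemma finite_type_torus_disc: "finite_type_pair (torus p) (torus_disc p)"
  by (rule finite_type_relative[OF finite_type_contractible[OF contractible_torus_disc] finite_type_torus])

text \<open>Points of radius between 1 and 5/4 end at radius 1, and points of the disc do not
  move.\<close>

lemma collar_homotopy_torus:
  "collar_homotopy (torus p) (torus_disc p) {x \<in> topspace (torus p). torus_radius p x < 5/4} (torus_collar p)"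
  unfolding collar_homotopy_def
proof (intro conjI ballI)
  have "openin (torus p) {x \<in> topspace (torus p). torus_radius p x \<in> {..<5/4}}"
    by (rule openin_continuous_map_preimage[OF continuous_map_torus_radius]) simp
  then show "openin (torus p) {x \<in> topspace (torus p). torus_radius p x < 5/4}" by simp
  have "continuous_map (prod_topology (top_of_set {0..1}) (torus p)) (torus p)
      (\<lambda>z. torus_collar p (fst z, snd z))"
    by (intro continuous_map_torus_collar continuous_map_snd)
      (use continuous_map_fst[of "top_of_set {0..1::real}" "torus p"] in
        \<open>auto dest: continuous_map_into_fulltopology\<close>)
  then show "continuous_map (prod_topology (top_of_set {0..1}) (torus p)) (torus p) (torus_collar p)"
    by simp
  show "torus_disc p \<noteq> {}" using torus_unit_in_torus by auto
  show "torus_collar p (0, x) = x" if "x \<in> topspace (torus p)" for x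
    using that by (intro torus_collar_fixed) auto
  show "torus_collar p (1, x) \<in> torus_disc p" if "x \<in> {x \<in> topspace (torus p). torus_radius p x < 5/4}" for x
    using that torus_radius_collar[of x p 1] torus_collar_in_torus collar_radius_props(3,6)[of 1 "torus_radius p x"]
    by (cases "torus_radius p x \<le> 1") (auto simp: torus_disc_eq)
  show "torus_collar p (t, x) \<in> torus_disc p" if "t \<in> {0..1}" "x \<in> torus_disc p" for t x
    using that torus_collar_fixed[of x p t] by (auto simp: torus_disc_eq)
  show "torus_collar p (t, x) \<in> {x \<in> topspace (torus p). torus_radius p x < 5/4}"
    if "t \<in> {0..1}" "x \<in> {x \<in> topspace (torus p). torus_radius p x < 5/4}" for t x
    using that torus_radius_collar[of x p t] torus_collar_in_torus collar_radius_props(1)[of t "torus_radius p x"]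
    by auto
qed (rule closedin_torus_disc, simp add: torus_disc_eq subset_iff)

text \<open>The collapse of the disc depends only on the complement of the disc, which is
  homeomorphic to each open part of the double torus. This is how the finiteness of the torus
  reaches those parts.\<close>

lemma finite_type_collapsed_torus:
  "finite_type_pair (collapsed_space (torus p) (topspace (torus p) - torus_disc p)) {None}"
  by (rule finite_type_pair_iso[OF finite_type_torus_disc])
    (rule is_isoI[OF collapse_relative_homology_iso[OF compact_Hausdorff_torus(2,1) collar_homotopy_torus]])

section \<open>Topology of the double torus\<close>

lemma topspace_bordered_torus: "topspace (bordered_torus p) = {x \<in> topspace (torus p). 1 \<le> torus_radius p x}"
  by (auto simp: bordered_torus_def torus_disc_eq torus_disc_boundary_eq)

lemma torus_part_eq: "torus_part p i = {i} \<times> {x \<in> topspace (torus p). 1 < torus_radius p x}"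
  by (auto simp: torus_part_def torus_disc_eq)

lemma connecting_sphere_eq: "connecting_sphere p = {0} \<times> {x \<in> topspace (torus p). torus_radius p x = 1}"
  by (auto simp: connecting_sphere_def torus_disc_boundary_eq)

lemma glue_eq:
  "x \<in> topspace (torus p) \<Longrightarrow> glue p (i, x) = (if torus_radius p x = 1 then 0 else i, x)"
  by (auto simp: glue_def torus_disc_boundary_eq)

lemma topspace_double_torus_glue:
  "topspace (double_torus p) = glue p ` ({1, 2} \<times> topspace (bordered_torus p))"
  by (simp add: double_torus_def)

lemma openin_double_torus:
  "openin (double_torus p) U \<longleftrightarrow> U \<subseteq> topspace (double_torus p) \<and>
     (\<forall>i\<in>{1, 2}. openin (bordered_torus p) {x \<in> topspace (bordered_torus p). glue p (i, x) \<in> U})"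
  by (auto simp: double_torus_def openin_quotient_topology openin_sum_topology cong: conj_cong)

lemma continuous_map_from_double_torus:
  assumes "\<And>i. i \<in> {1, 2} \<Longrightarrow> continuous_map (bordered_torus p) Y (\<lambda>x. f (glue p (i, x)))"
  shows "continuous_map (double_torus p) Y f"
  unfolding continuous_map_def
proof (intro conjI allI impI)
  have im: "f (glue p (i, x)) \<in> topspace Y" if "i \<in> {1, 2}" "x \<in> topspace (bordered_torus p)" for i x
    using assms[OF that(1)] that(2) continuous_map_image_subset_topspace by fastforce
  then show "f \<in> topspace (double_torus p) \<rightarrow> topspace Y"
    unfolding topspace_double_torus_glue by blast
  fix V assume V: "openin Y V"
  show "openin (double_torus p) {x \<in> topspace (double_torus p). f x \<in> V}"
    unfolding openin_double_torus
  proof (intro conjI ballI)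
    fix i :: nat assume i: "i \<in> {1, 2}"
    have "{x \<in> topspace (bordered_torus p). glue p (i, x) \<in> {x \<in> topspace (double_torus p). f x \<in> V}} =
        {x \<in> topspace (bordered_torus p). f (glue p (i, x)) \<in> V}"
      using i unfolding topspace_double_torus_glue by blast
    then show "openin (bordered_torus p)
        {x \<in> topspace (bordered_torus p). glue p (i, x) \<in> {x \<in> topspace (double_torus p). f x \<in> V}}"
      using openin_continuous_map_preimage[OF assms[OF i] V] by simp
  qed auto
qed

lemma continuous_map_glue:
  assumes "i \<in> {1, 2}"
  shows "continuous_map (bordered_torus p) (double_torus p) (\<lambda>x. glue p (i, x))"
  unfolding continuous_map_def
proof (intro conjI allI impI)
  show "(\<lambda>x. glue p (i, x)) \<in> topspace (bordered_torus p) \<rightarrow> topspace (double_torus p)"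
    using assms unfolding topspace_double_torus_glue by blast
  show "openin (bordered_torus p) {x \<in> topspace (bordered_torus p). glue p (i, x) \<in> U}"
    if "openin (double_torus p) U" for U
    using that assms unfolding openin_double_torus by blast
qed

section \<open>Signed height and collar of the double torus\<close>

definition side_sign :: "nat \<Rightarrow> real" where
  "side_sign i = (if i = 1 then 1 else if i = 2 then -1 else 0)"

text \<open>The radial distance to the connecting sphere, with a sign that is positive on the side
  tagged 1. The pieces of the decomposition become sign conditions on one continuous
  function.\<close>

definition dt_height :: "nat \<Rightarrow> nat \<times> (nat \<Rightarrow> complex) \<Rightarrow> real" where
  "dt_height p = (\<lambda>(i, x). side_sign i * (torus_radius p x - 1))"

definition dt_collar :: "nat \<Rightarrow> real \<times> nat \<times> (nat \<Rightarrow> complex) \<Rightarrow> nat \<times> (nat \<Rightarrow> complex)" where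
  "dt_collar p = (\<lambda>(t, i, x). glue p (i, torus_collar p (t, x)))"

lemma dt_height_glue:
  "x \<in> topspace (torus p) \<Longrightarrow> dt_height p (glue p (i, x)) = side_sign i * (torus_radius p x - 1)"
  by (auto simp: glue_eq dt_height_def side_sign_def)

lemma continuous_map_bordered_radius: "continuous_map (bordered_torus p) euclideanreal (torus_radius p)"
  unfolding bordered_torus_def by (rule continuous_map_from_subtopology[OF continuous_map_torus_radius])

lemma continuous_map_dt_height: "continuous_map (double_torus p) euclideanreal (dt_height p)"
proof (rule continuous_map_from_double_torus)
  fix i
  have "continuous_map (bordered_torus p) euclideanreal (\<lambda>x. side_sign i * (torus_radius p x - 1))"
    by (intro continuous_intros continuous_map_bordered_radius)
  then show "continuous_map (bordered_torus p) euclideanreal (\<lambda>x. dt_height p (glue p (i, x)))"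
    by (rule continuous_map_eq) (simp add: dt_height_glue topspace_bordered_torus)
qed

lemma continuous_map_dt_snd: "continuous_map (double_torus p) (bordered_torus p) snd"
  by (rule continuous_map_from_double_torus)
    (simp add: glue_def continuous_map_id[unfolded id_def])

lemma dt_cases:
  assumes "z \<in> topspace (double_torus p)"
  obtains i x where "i \<in> {1, 2}" "x \<in> topspace (torus p)" "1 \<le> torus_radius p x" "z = glue p (i, x)"
  using assms unfolding topspace_double_torus_glue topspace_bordered_torus by blast

lemma compact_double_torus: "compact_space (double_torus p)"
proof -
  have "openin (torus p) {x \<in> topspace (torus p). torus_radius p x \<in> {..<1}}"
    by (rule openin_continuous_map_preimage[OF continuous_map_torus_radius]) simp
  then have "closedin (torus p) (topspace (torus p) - {x \<in> topspace (torus p). torus_radius p x \<in> {..<1}})"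
    by blast
  moreover have "topspace (torus p) - {x \<in> topspace (torus p). torus_radius p x \<in> {..<1}} = topspace (bordered_torus p)"
    by (auto simp: topspace_bordered_torus)
  ultimately have "compactin (torus p) (topspace (bordered_torus p))"
    using compact_Hausdorff_torus(1) closedin_compact_space by metis
  then have "compact_space (bordered_torus p)"
    by (simp add: bordered_torus_def compactin_subspace subtopology_restrict)
  then have "compactin (double_torus p) ((\<lambda>x. glue p (i, x)) ` topspace (bordered_torus p))" if "i \<in> {1, 2}" for i
    using image_compactin[OF _ continuous_map_glue[OF that]] by (simp add: compact_space_def)
  then have "compactin (double_torus p) ((\<lambda>x. glue p (1, x)) ` topspace (bordered_torus p) \<union>
      (\<lambda>x. glue p (2, x)) ` topspace (bordered_torus p))"
    by (intro compactin_Un) auto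
  moreover have "(\<lambda>x. glue p (1, x)) ` topspace (bordered_torus p) \<union>
      (\<lambda>x. glue p (2, x)) ` topspace (bordered_torus p) = topspace (double_torus p)"
    unfolding topspace_double_torus_glue by blast
  ultimately show ?thesis by (simp add: compact_space_def)
qed

lemma dt_height_eq_iff:
  assumes z: "z \<in> topspace (double_torus p)" "w \<in> topspace (double_torus p)"
    and eq: "snd z = snd w" "dt_height p z = dt_height p w"
  shows "z = w"
proof -
  obtain i x where z': "i \<in> {1, 2}" "x \<in> topspace (torus p)" "z = glue p (i, x)"
    using dt_cases[OF z(1)] by metis
  obtain j y where w': "j \<in> {1, 2}" "y \<in> topspace (torus p)" "w = glue p (j, y)"
    using dt_cases[OF z(2)] by metis
  have "x = y" using z'(3) w'(3) eq(1) by (simp add: glue_def)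
  moreover from this have "side_sign i * (torus_radius p x - 1) = side_sign j * (torus_radius p x - 1)"
    using z' w' eq(2) by (simp add: dt_height_glue)
  then have "i = j \<or> torus_radius p x = 1"
    using z'(1) w'(1) by (auto simp: side_sign_def)
  ultimately show ?thesis
    using z' w' by (auto simp: glue_eq)
qed

text \<open>Folding the two copies onto one forgets only the side, which the sign of the height
  restores. Together they form an injective continuous map into a Hausdorff space.\<close>

lemma Hausdorff_double_torus: "Hausdorff_space (double_torus p)"
proof -
  have "Hausdorff_space (bordered_torus p)"
    by (simp add: bordered_torus_def Hausdorff_space_subtopology compact_Hausdorff_torus)
  then have "Hausdorff_space (prod_topology (bordered_torus p) euclideanreal)"
    by (simp add: Hausdorff_space_prod_topology)
  then show ?thesis
  proof (rule Hausdorff_space_injective_preimage)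
    show "continuous_map (double_torus p) (prod_topology (bordered_torus p) euclideanreal)
        (\<lambda>z. (snd z, dt_height p z))"
      using continuous_map_dt_snd continuous_map_dt_height
      by (simp add: continuous_map_pairwise o_def)
    show "inj_on (\<lambda>z. (snd z, dt_height p z)) (topspace (double_torus p))"
      using dt_height_eq_iff by (auto simp: inj_on_def)
  qed
qed

lemma in_double_torus:
  "(j, x) \<in> topspace (double_torus p) \<longleftrightarrow> x \<in> topspace (torus p) \<and>
     (j \<in> {1, 2} \<and> 1 < torus_radius p x \<or> j = 0 \<and> torus_radius p x = 1)"
  unfolding topspace_double_torus torus_part_eq connecting_sphere_eq by auto

text \<open>The factor \<open>side_sign i\<close> treats both sides at once, and 3 - i is the index
  of the opposite side.\<close>

lemma dt_parts:
  assumes i: "i \<in> {1, 2}"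
  shows "torus_part p i = {z \<in> topspace (double_torus p). 0 < side_sign i * dt_height p z}"
    "connecting_sphere p = {z \<in> topspace (double_torus p). side_sign i * dt_height p z = 0}"
    "torus_part p i \<union> connecting_sphere p = {z \<in> topspace (double_torus p). 0 \<le> side_sign i * dt_height p z}"
    "topspace (double_torus p) - torus_part p i = {z \<in> topspace (double_torus p). side_sign i * dt_height p z \<le> 0}"
    "topspace (double_torus p) - torus_part p i = torus_part p (3 - i) \<union> connecting_sphere p"
proof -
  have *: "(j, x) \<in> torus_part p i \<longleftrightarrow> (j, x) \<in> topspace (double_torus p) \<and> 0 < side_sign i * dt_height p (j, x)"
    "(j, x) \<in> torus_part p (3 - i) \<longleftrightarrow> (j, x) \<in> topspace (double_torus p) \<and> side_sign i * dt_height p (j, x) < 0"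
    "(j, x) \<in> connecting_sphere p \<longleftrightarrow> (j, x) \<in> topspace (double_torus p) \<and> side_sign i * dt_height p (j, x) = 0" for j x
    using i by (auto simp: in_double_torus torus_part_eq connecting_sphere_eq dt_height_def side_sign_def)
  show "torus_part p i = {z \<in> topspace (double_torus p). 0 < side_sign i * dt_height p z}"
    using *(1) by auto
  show "connecting_sphere p = {z \<in> topspace (double_torus p). side_sign i * dt_height p z = 0}"
    using *(3) by auto
  show "torus_part p i \<union> connecting_sphere p = {z \<in> topspace (double_torus p). 0 \<le> side_sign i * dt_height p z}"
    using *(1,3) by (auto simp: order_le_less)
  show "topspace (double_torus p) - torus_part p i = {z \<in> topspace (double_torus p). side_sign i * dt_height p z \<le> 0}"
    using *(1) by (auto simp: not_less)
  show "topspace (double_torus p) - torus_part p i = torus_part p (3 - i) \<union> connecting_sphere p"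
    using *(1,2,3) by (auto simp: not_less order_le_less)
qed

lemma continuous_map_into_bordered_torus:
  assumes "continuous_map Z (torus p) g" "\<And>z. z \<in> topspace Z \<Longrightarrow> 1 \<le> torus_radius p (g z)"
  shows "continuous_map Z (bordered_torus p) g"
proof -
  have "g z \<in> topspace (torus p)" if "z \<in> topspace Z" for z
    using assms(1) that continuous_map_funspace by fastforce
  then show ?thesis
    using assms unfolding bordered_torus_def continuous_map_in_subtopology
    by (auto simp: torus_disc_eq torus_disc_boundary_eq not_le order_le_less dest: assms(2))
qed

text \<open>Gluing loses the tag on the sphere, but there the collar is stationary.\<close>

lemma dt_collar_glue:
  assumes "x \<in> topspace (torus p)" "t \<in> {0..1}"
  shows "dt_collar p (t, glue p (i, x)) = glue p (i, torus_collar p (t, x))"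
proof (cases "torus_radius p x = 1")
  case True
  then have "torus_collar p (t, x) = x" using assms by (intro torus_collar_fixed) auto
  then show ?thesis using assms True by (simp add: dt_collar_def glue_eq)
next
  case False
  then show ?thesis using assms by (simp add: dt_collar_def glue_eq)
qed

text \<open>Later arguments see the collar only through the height. It is multiplied by a factor
  between 0 and 1, so points never cross the connecting sphere, and it becomes 0 at time 1 if it was
  below 1/4 in absolute value, which corresponds to the radius 5/4.\<close>

lemma dt_collar:
  assumes z: "z \<in> topspace (double_torus p)" and t: "t \<in> {0..1}"
  shows "dt_collar p (t, z) \<in> topspace (double_torus p)"
    and "t = 0 \<or> dt_height p z = 0 \<Longrightarrow> dt_collar p (t, z) = z"
    and "\<exists>s\<ge>0. s \<le> 1 \<and> dt_height p (dt_collar p (t, z)) = s * dt_height p z"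
    and "t = 1 \<Longrightarrow> \<bar>dt_height p z\<bar> < 1/4 \<Longrightarrow> dt_height p (dt_collar p (t, z)) = 0"
proof -
  obtain i x where x: "i \<in> {1, 2}" "x \<in> topspace (torus p)" "1 \<le> torus_radius p x" "z = glue p (i, x)"
    using dt_cases[OF z] by metis
  define r c where "r = torus_radius p x" and "c = collar_radius t r"
  have K: "dt_collar p (t, z) = glue p (i, torus_collar p (t, x))"
    unfolding x(4) by (rule dt_collar_glue[OF x(2) t])
  have rad: "torus_radius p (torus_collar p (t, x)) = c"
    unfolding c_def r_def by (rule torus_radius_collar[OF x(2) t])
  have c: "1 \<le> c" "c \<le> r" "r \<ge> 1"
    using collar_radius_props(1,2)[of t r] t x(3) by (auto simp: c_def r_def)
  have inT: "torus_collar p (t, x) \<in> topspace (torus p)" by (rule torus_collar_in_torus[OF x(2)])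
  then show "dt_collar p (t, z) \<in> topspace (double_torus p)"
    unfolding K topspace_double_torus_glue topspace_bordered_torus using x(1) rad c by blast
  have hz: "dt_height p z = side_sign i * (r - 1)"
    unfolding x(4) r_def by (rule dt_height_glue[OF x(2)])
  have hK: "dt_height p (dt_collar p (t, z)) = side_sign i * (c - 1)"
    unfolding K using dt_height_glue[OF inT] rad by simp
  have sg: "side_sign i = 1 \<or> side_sign i = -1" using x(1) by (auto simp: side_sign_def)
  show "dt_collar p (t, z) = z" if "t = 0 \<or> dt_height p z = 0"
  proof -
    have "t = 0 \<or> r \<le> 1" using that hz sg by auto
    then have "torus_collar p (t, x) = x"
      using torus_collar_fixed[OF x(2) t] by (auto simp: r_def)
    then show ?thesis using K x(4) by simp
  qed
  show "\<exists>s\<ge>0. s \<le> 1 \<and> dt_height p (dt_collar p (t, z)) = s * dt_height p z"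
  proof (cases "r = 1")
    case True
    then show ?thesis using c hK hz by (intro exI[of _ 0]) auto
  next
    case False
    then show ?thesis
      using c by (intro exI[of _ "(c - 1) / (r - 1)"]) (simp add: hK hz)
  qed
  show "dt_height p (dt_collar p (t, z)) = 0" if "t = 1" "\<bar>dt_height p z\<bar> < 1/4"
  proof -
    have "r \<le> 5/4" using that(2) hz sg c by auto
    then have "c = 1" using collar_radius_props(6)[of 1 r] c that(1) by (simp add: c_def)
    then show ?thesis using hK by simp
  qed
qed

lemma closedin_dt_height:
  assumes "closed C"
  shows "closedin (double_torus p) {z \<in> topspace (double_torus p). a * dt_height p z \<in> C}"
proof -
  have "continuous_map (double_torus p) euclideanreal (\<lambda>z. a * dt_height p z)"
    by (intro continuous_map_real_mult continuous_map_dt_height) simp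
  then show ?thesis by (rule closedin_continuous_map_preimage) (use assms in simp)
qed

lemma openin_dt_height:
  assumes "open C"
  shows "openin (double_torus p) {z \<in> topspace (double_torus p). a * dt_height p z \<in> C}"
proof -
  have "continuous_map (double_torus p) euclideanreal (\<lambda>z. a * dt_height p z)"
    by (intro continuous_map_real_mult continuous_map_dt_height) simp
  then show ?thesis by (rule openin_continuous_map_preimage) (use assms in simp)
qed

text \<open>Pasting over the two closed halves. On the half with index i the projection
  \<open>snd\<close> inverts the gluing, so the collar of the torus can be applied there and its
  result glued again.\<close>

lemma continuous_map_dt_collar:
  "continuous_map (prod_topology (top_of_set {0..1}) (double_torus p)) (double_torus p) (dt_collar p)"
proof -
  let ?IX = "prod_topology (top_of_set {0..1::real}) (double_torus p)"
  define A where "A i = {z \<in> topspace (double_torus p). side_sign i * dt_height p z \<in> {0..}}" for i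
  define h where "h i = (\<lambda>w :: real \<times> nat \<times> (nat \<Rightarrow> complex). glue p (i, torus_collar p (fst w, snd (snd w))))" for i :: nat
  have A: "z \<in> A i \<longleftrightarrow> (\<exists>x. x \<in> topspace (torus p) \<and> 1 \<le> torus_radius p x \<and> z = glue p (i, x))"
    if i: "i \<in> {1, 2}" for i z
  proof
    assume z: "z \<in> A i"
    then obtain j x where x: "j \<in> {1, 2}" "x \<in> topspace (torus p)" "1 \<le> torus_radius p x" "z = glue p (j, x)"
      unfolding A_def using dt_cases by blast
    have "0 \<le> side_sign i * (side_sign j * (torus_radius p x - 1))"
      using z dt_height_glue[OF x(2), of j] by (simp add: A_def x(4))
    then have "i = j \<or> torus_radius p x = 1" using i x(1,3) by (auto simp: side_sign_def)
    then show "\<exists>x. x \<in> topspace (torus p) \<and> 1 \<le> torus_radius p x \<and> z = glue p (i, x)"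
      using x by (intro exI[of _ x]) (auto simp: glue_eq)
  next
    assume "\<exists>x. x \<in> topspace (torus p) \<and> 1 \<le> torus_radius p x \<and> z = glue p (i, x)"
    then obtain x where x: "x \<in> topspace (torus p)" "1 \<le> torus_radius p x" "z = glue p (i, x)" by blast
    then have "z \<in> topspace (double_torus p)"
      using i unfolding topspace_double_torus_glue topspace_bordered_torus by blast
    moreover have "dt_height p z = side_sign i * (torus_radius p x - 1)"
      unfolding x(3) by (rule dt_height_glue[OF x(1)])
    ultimately show "z \<in> A i" using x(2) i by (auto simp: A_def side_sign_def)
  qed
  show ?thesis
  proof (rule pasting_lemma_closed[of "{1, 2::nat}" ?IX "\<lambda>i. {0..1} \<times> A i" _ h])
    show "closedin ?IX ({0..1} \<times> A i)" for i
      using closedin_dt_height[of "{0..}" p "side_sign i"] by (simp add: closedin_prod_Times_iff A_def)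
    show "continuous_map (subtopology ?IX ({0..1} \<times> A i)) (double_torus p) (h i)" if i: "i \<in> {1, 2}" for i
    proof -
      let ?Z = "subtopology ?IX ({0..1} \<times> A i)"
      have c1: "continuous_map ?Z euclideanreal fst"
        by (intro continuous_map_from_subtopology continuous_map_into_fulltopology[OF continuous_map_fst])
      have "continuous_map ?IX (bordered_torus p) (snd \<circ> snd)"
        by (rule continuous_map_compose[OF continuous_map_snd continuous_map_dt_snd])
      then have c2: "continuous_map ?Z (torus p) (snd \<circ> snd)"
        unfolding bordered_torus_def
        by (intro continuous_map_from_subtopology) (rule continuous_map_into_fulltopology)
      have "continuous_map ?Z (torus p) (\<lambda>w. torus_collar p (fst w, (snd \<circ> snd) w))"
        by (rule continuous_map_torus_collar[OF c1 c2])
      moreover have "1 \<le> torus_radius p (torus_collar p (fst w, (snd \<circ> snd) w))" if w: "w \<in> topspace ?Z" for w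
      proof -
        obtain t z where tz: "w = (t, z)" "t \<in> {0..1}" "z \<in> A i" using w by auto
        then obtain x where x: "x \<in> topspace (torus p)" "1 \<le> torus_radius p x" "z = glue p (i, x)"
          using A[OF i] by blast
        then show ?thesis
          using torus_radius_collar[OF x(1) tz(2)] collar_radius_props(2)[of t "torus_radius p x"] tz
          by (simp add: glue_def)
      qed
      ultimately have "continuous_map ?Z (bordered_torus p) (\<lambda>w. torus_collar p (fst w, (snd \<circ> snd) w))"
        by (rule continuous_map_into_bordered_torus)
      then have "continuous_map ?Z (double_torus p)
          ((\<lambda>x. glue p (i, x)) \<circ> (\<lambda>w. torus_collar p (fst w, (snd \<circ> snd) w)))"
        by (rule continuous_map_compose[OF _ continuous_map_glue[OF i]])
      then show ?thesis by (simp add: h_def o_def)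
    qed
    have hA: "h i w = dt_collar p w" if i: "i \<in> {1, 2}" and w: "w \<in> {0..1} \<times> A i" for i w
    proof -
      obtain t z where tz: "w = (t, z)" "t \<in> {0..1}" "z \<in> A i" using w by blast
      then obtain x where x: "x \<in> topspace (torus p)" "z = glue p (i, x)"
        using A[OF i] by blast
      then show ?thesis
        using dt_collar_glue[OF x(1) tz(2), of i] tz(1) by (simp add: h_def glue_def)
    qed
    show "h i w = h j w" if "i \<in> {1, 2}" "j \<in> {1, 2}" "w \<in> topspace ?IX \<inter> {0..1} \<times> A i \<inter> {0..1} \<times> A j" for i j w
      using hA[OF that(1)] hA[OF that(2)] that(3) by simp
    show "\<exists>j. j \<in> {1, 2} \<and> w \<in> {0..1} \<times> A j \<and> dt_collar p w = h j w" if w: "w \<in> topspace ?IX" for w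
    proof -
      have "w \<in> {0..1} \<times> topspace (double_torus p)" using w by simp
      then obtain t z where tz: "w = (t, z)" "t \<in> {0..1}" "z \<in> topspace (double_torus p)" by blast
      have "z \<in> A 1 \<or> z \<in> A 2" using tz(3) by (auto simp: A_def side_sign_def)
      then show ?thesis using hA[of 1 w] hA[of 2 w] tz by auto
    qed
  qed simp
qed

section \<open>Collars and finite type of the pieces, and the Lefschetz formula\<close>

lemma connecting_sphere_nonempty:
  assumes "0 < p" shows "connecting_sphere p \<noteq> {}"
proof -
  have "torus_exp p (\<lambda>i. if i = 0 then 1 else 0) \<in> torus_disc_boundary p"
    unfolding torus_disc_boundary_def using assms
    by (intro imageI) (simp add: if_distrib[where f = "\<lambda>x. x\<^sup>2"] cong: if_cong)
  then show ?thesis by (auto simp: connecting_sphere_def)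
qed

text \<open>The set deformed into is the closed half opposite to part i; collapsing it produces
  \<open>compactified_part p i\<close>. The neighbourhood contains that whole half and a strip of
  part i.\<close>

lemma collar_homotopy_double_torus:
  assumes p: "0 < p" and i: "i \<in> {1, 2}"
  shows "collar_homotopy (double_torus p) (topspace (double_torus p) - torus_part p i)
    {z \<in> topspace (double_torus p). side_sign i * dt_height p z < 1/4} (dt_collar p)"
proof -
  let ?X = "double_torus p"
  define h where "h z = side_sign i * dt_height p z" for z
  have dt: "dt_collar p (t, z) \<in> topspace ?X" "\<exists>s\<ge>0. s \<le> 1 \<and> h (dt_collar p (t, z)) = s * h z"
    "t = 1 \<Longrightarrow> \<bar>h z\<bar> < 1/4 \<Longrightarrow> h (dt_collar p (t, z)) = 0"
    if zt: "z \<in> topspace ?X" "t \<in> {0..1}" for z t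
  proof -
    show "dt_collar p (t, z) \<in> topspace ?X" using dt_collar(1)[OF zt] .
    obtain s where "0 \<le> s" "s \<le> 1" "dt_height p (dt_collar p (t, z)) = s * dt_height p z"
      using dt_collar(3)[OF zt] by blast
    then show "\<exists>s\<ge>0. s \<le> 1 \<and> h (dt_collar p (t, z)) = s * h z"
      by (intro exI[of _ s]) (simp add: h_def)
    have "\<bar>h z\<bar> = \<bar>dt_height p z\<bar>" using i by (auto simp: h_def side_sign_def)
    then show "h (dt_collar p (t, z)) = 0" if "t = 1" "\<bar>h z\<bar> < 1/4"
      using dt_collar(4)[OF zt that(1)] that(2) by (simp add: h_def)
  qed
  show ?thesis
    unfolding collar_homotopy_def h_def[symmetric]
  proof (intro conjI ballI)
  have eq: "topspace ?X - torus_part p i = {z \<in> topspace ?X. h z \<le> 0}"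
    unfolding h_def by (rule dt_parts(4)[OF i])
  show "closedin ?X (topspace ?X - torus_part p i)"
    unfolding eq h_def using closedin_dt_height[of "{..0}"] by simp
  show "topspace ?X - torus_part p i \<noteq> {}"
    using connecting_sphere_nonempty[OF p] dt_parts(5)[OF i] by blast
  show "openin ?X {z \<in> topspace ?X. h z < 1/4}"
    unfolding h_def using openin_dt_height[of "{..<1/4}"] by simp
  show "topspace ?X - torus_part p i \<subseteq> {z \<in> topspace ?X. h z < 1/4}"
    unfolding eq by auto
  show "dt_collar p (0, z) = z" if "z \<in> topspace ?X" for z
    using dt_collar(2)[OF that] by simp
  show "dt_collar p (1, z) \<in> topspace ?X - torus_part p i" if "z \<in> {z \<in> topspace ?X. h z < 1/4}" for z
  proof (cases "h z \<le> 0")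
    case True
    then show ?thesis
      unfolding eq using dt(1,2)[of z 1] that by (auto simp: mult_nonneg_nonpos)
  next
    case False
    then have "\<bar>h z\<bar> < 1/4" using that by simp
    then show ?thesis unfolding eq using dt(1,3)[of z 1] that by auto
  qed
  show "dt_collar p (t, z) \<in> topspace ?X - torus_part p i"
    if "t \<in> {0..1}" "z \<in> topspace ?X - torus_part p i" for t z
    using that dt(1,2)[of z t] unfolding eq by (auto simp: mult_nonneg_nonpos)
  show "dt_collar p (t, z) \<in> {z \<in> topspace ?X. h z < 1/4}"
    if t: "t \<in> {0..1}" and z: "z \<in> {z \<in> topspace ?X. h z < 1/4}" for t z
  proof -
    obtain s where s: "0 \<le> s" "s \<le> 1" "h (dt_collar p (t, z)) = s * h z" using dt(2)[of z t] t z by auto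
    have "s * h z < 1/4"
    proof (cases "h z \<le> 0")
      case True
      then show ?thesis using s mult_nonneg_nonpos[of s "h z"] by linarith
    next
      case False
      then have "s * h z \<le> 1 * h z" using s by (intro mult_right_mono) auto
      moreover have "h z < 1/4" using z by simp
      ultimately show ?thesis by linarith
    qed
    then show ?thesis using s dt(1)[of z t] t z by simp
  qed
  qed (rule continuous_map_dt_collar)
qed

text \<open>The same collar inside one closed half. Collapsing only the sphere there gives
  \<open>compactified_part p i\<close> again, so the double torus can be filtered in two
  stages.\<close>

lemma collar_homotopy_double_torus_half:
  assumes p: "0 < p" and i: "i \<in> {1, 2}"
  shows "collar_homotopy (subtopology (double_torus p) (torus_part p i \<union> connecting_sphere p)) (connecting_sphere p)
    {z \<in> torus_part p i \<union> connecting_sphere p. side_sign i * dt_height p z < 1/4} (dt_collar p)"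
proof -
  let ?X = "double_torus p"
  define h where "h z = side_sign i * dt_height p z" for z
  have dt: "dt_collar p (t, z) \<in> topspace ?X" "\<exists>s\<ge>0. s \<le> 1 \<and> h (dt_collar p (t, z)) = s * h z"
    "t = 1 \<Longrightarrow> \<bar>h z\<bar> < 1/4 \<Longrightarrow> h (dt_collar p (t, z)) = 0"
    if zt: "z \<in> topspace ?X" "t \<in> {0..1}" for z t
  proof -
    show "dt_collar p (t, z) \<in> topspace ?X" using dt_collar(1)[OF zt] .
    obtain s where "0 \<le> s" "s \<le> 1" "dt_height p (dt_collar p (t, z)) = s * dt_height p z"
      using dt_collar(3)[OF zt] by blast
    then show "\<exists>s\<ge>0. s \<le> 1 \<and> h (dt_collar p (t, z)) = s * h z"
      by (intro exI[of _ s]) (simp add: h_def)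
    have "\<bar>h z\<bar> = \<bar>dt_height p z\<bar>" using i by (auto simp: h_def side_sign_def)
    then show "h (dt_collar p (t, z)) = 0" if "t = 1" "\<bar>h z\<bar> < 1/4"
      using dt_collar(4)[OF zt that(1)] that(2) by (simp add: h_def)
  qed
  show ?thesis
    unfolding collar_homotopy_def h_def[symmetric]
  proof (intro conjI ballI)
  let ?A = "torus_part p i \<union> connecting_sphere p"
  have A: "?A = {z \<in> topspace ?X. 0 \<le> h z}" and S: "connecting_sphere p = {z \<in> topspace ?X. h z = 0}"
    unfolding h_def by (rule dt_parts[OF i])+
  have Asub: "topspace (subtopology ?X ?A) = ?A" unfolding A by auto
  show "closedin (subtopology ?X ?A) (connecting_sphere p)"
  proof (rule closedin_subset_topspace)
    show "closedin ?X (connecting_sphere p)"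
      unfolding S h_def using closedin_dt_height[of "{0}" p "side_sign i"] by simp
  qed simp
  show "connecting_sphere p \<noteq> {}" by (rule connecting_sphere_nonempty[OF p])
  have "openin (subtopology ?X ?A) (?A \<inter> {z \<in> topspace ?X. h z \<in> {..<1/4}})"
    unfolding h_def using openin_dt_height[of "{..<1/4}" p "side_sign i"] by (intro openin_subtopology_Int2) simp
  moreover have "?A \<inter> {z \<in> topspace ?X. h z \<in> {..<1/4}} = {z \<in> ?A. h z < 1/4}" unfolding A by auto
  ultimately show "openin (subtopology ?X ?A) {z \<in> ?A. h z < 1/4}" by simp
  show "connecting_sphere p \<subseteq> {z \<in> ?A. h z < 1/4}" unfolding A S by auto
  have inA: "dt_collar p (t, z) \<in> ?A" if "t \<in> {0..1}" "z \<in> ?A" for t z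
    using that dt(1,2)[of z t] unfolding A by auto
  have inA': "dt_collar p w \<in> ?A" if "w \<in> {0..1} \<times> ?A" for w
    using inA that by (metis SigmaE)
  have "continuous_map (subtopology (prod_topology (top_of_set {0..1}) ?X) (UNIV \<times> ?A)) ?X (dt_collar p)"
    by (rule continuous_map_from_subtopology[OF continuous_map_dt_collar])
  moreover have "subtopology (prod_topology (top_of_set {0..1::real}) ?X) (UNIV \<times> ?A) =
      prod_topology (top_of_set {0..1}) (subtopology ?X ?A)"
    by (simp add: subtopology_Times)
  ultimately show "continuous_map (prod_topology (top_of_set {0..1}) (subtopology ?X ?A)) (subtopology ?X ?A) (dt_collar p)"
    using inA' unfolding continuous_map_in_subtopology topspace_prod_topology Asub by auto
  show "dt_collar p (0, z) = z" if "z \<in> topspace (subtopology ?X ?A)" for z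
    using dt_collar(2)[of z p 0] that by simp
  show "dt_collar p (1, z) \<in> connecting_sphere p" if "z \<in> {z \<in> ?A. h z < 1/4}" for z
  proof -
    have "\<bar>h z\<bar> < 1/4" "z \<in> topspace ?X" using that unfolding A by auto
    then show ?thesis unfolding S using dt(1,3)[of z 1] by auto
  qed
  show "dt_collar p (t, z) \<in> connecting_sphere p" if "t \<in> {0..1}" "z \<in> connecting_sphere p" for t z
    using that dt(1,2)[of z t] unfolding S by auto
  show "dt_collar p (t, z) \<in> {z \<in> ?A. h z < 1/4}"
    if t: "t \<in> {0..1}" and z: "z \<in> {z \<in> ?A. h z < 1/4}" for t z
  proof -
    have zX: "z \<in> topspace ?X" "0 \<le> h z" using z unfolding A by auto
    then obtain s where s: "0 \<le> s" "s \<le> 1" "h (dt_collar p (t, z)) = s * h z" using dt(2)[of z t] t by auto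
    have "s * h z \<le> h z" using s zX mult_right_mono[of s 1 "h z"] by simp
    then have "h (dt_collar p (t, z)) < 1/4" using s(3) z by simp
    then show ?thesis using inA[OF t, of z] z by simp
  qed
qed
qed

text \<open>At radius 1 all angles are at most 1 < pi/2, so \<open>torus_exp\<close> and
  \<open>torus_angle\<close> are mutually inverse between the standard sphere of dimension p - 1 and
  the connecting sphere.\<close>

lemma finite_type_connecting_sphere:
  assumes "0 < p"
  shows "finite_type (subtopology (double_torus p) (connecting_sphere p))"
proof (rule finite_type_homeomorphic[OF finite_type_nsphere])
  let ?S = "subtopology (double_torus p) (connecting_sphere p)"
  let ?f = "\<lambda>u. glue p (1, torus_exp p u)" and ?g = "\<lambda>z. torus_angle p (snd z)"
  have sum: "(\<Sum>i\<le>p - 1. (u i)\<^sup>2) = (\<Sum>i<p. (u i)\<^sup>2)" for u :: "nat \<Rightarrow> real"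
    using assms by (intro sum.cong) auto
  have ns: "u \<in> topspace (nsphere (p - 1)) \<longleftrightarrow> (\<Sum>i<p. (u i)\<^sup>2) = 1 \<and> (\<forall>i\<ge>p. u i = 0)" for u
    using assms unfolding nsphere sum by (auto simp: Suc_le_eq)
  have exp: "torus_radius p (torus_exp p u) = 1" "\<bar>u i\<bar> \<le> pi / 2"
    if "u \<in> topspace (nsphere (p - 1))" for u i
  proof -
    have b: "\<bar>u i\<bar> \<le> 1" for i
      using that abs_le_sqrt_sum_squares[of i p u] ns by (cases "i < p") auto
    show "\<bar>u i\<bar> \<le> pi / 2" using b[of i] pi_gt3 by simp
    have "\<bar>u i\<bar> \<le> pi" for i using b[of i] pi_gt3 by simp
    then show "torus_radius p (torus_exp p u) = 1"
      using torus_radius_exp[of p u] that ns by simp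
  qed
  have Stop: "topspace ?S = connecting_sphere p" unfolding topspace_subtopology topspace_double_torus by auto
  have "continuous_map (nsphere (p - 1)) (torus p) (torus_exp p)"
  proof (rule continuous_map_into_torus[OF torus_exp_in_torus])
    fix i assume i: "i < p"
    have "continuous_map (nsphere (p - 1)) euclidean (\<lambda>u. cis (u i))"
      by (rule continuous_map_compose_on[where S = UNIV, OF continuous_map_nsphere_projection])
        (auto intro: continuous_intros)
    then show "continuous_map (nsphere (p - 1)) euclidean (\<lambda>u. torus_exp p u i)"
      using i by (simp add: torus_exp_def)
  qed
  then have "continuous_map (nsphere (p - 1)) (bordered_torus p) (torus_exp p)"
    by (rule continuous_map_into_bordered_torus) (simp add: exp)
  then have "continuous_map (nsphere (p - 1)) (double_torus p) ((\<lambda>x. glue p (1, x)) \<circ> torus_exp p)"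
    by (rule continuous_map_compose[OF _ continuous_map_glue]) simp
  then have f: "continuous_map (nsphere (p - 1)) ?S ?f"
    by (auto simp: continuous_map_in_subtopology o_def glue_eq torus_exp_in_torus exp connecting_sphere_eq)
  have snd: "continuous_map ?S (torus p) snd"
    by (rule continuous_map_from_subtopology)
      (use continuous_map_dt_snd in \<open>auto simp: bordered_torus_def dest: continuous_map_into_fulltopology\<close>)
  have ang: "torus_exp p (torus_angle p x) = x" "(\<Sum>i<p. (torus_angle p x i)\<^sup>2) = 1"
    if "x \<in> topspace (torus p)" "torus_radius p x = 1" for x
  proof -
    obtain \<theta> where \<theta>: "x = torus_exp p \<theta>" "torus_radius p x = sqrt (\<Sum>i<p. (\<theta> i)\<^sup>2)"
      "\<And>i. i < p \<Longrightarrow> \<bar>\<theta> i\<bar> \<le> torus_radius p x"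
      using torus_exp_surj[OF \<open>x \<in> topspace (torus p)\<close>] by blast
    have a: "torus_angle p x i = \<theta> i" if "i < p" for i
    proof -
      have "\<bar>\<theta> i\<bar> \<le> pi / 2" using \<theta>(3)[OF that] \<open>torus_radius p x = 1\<close> pi_gt3 by simp
      then have "arcsin (sin (\<theta> i)) = \<theta> i" by (intro arcsin_sin) (auto simp: abs_le_iff)
      then show ?thesis using that by (simp add: torus_angle_def \<theta>(1) torus_exp_def)
    qed
    then show "torus_exp p (torus_angle p x) = x" by (auto simp: \<theta>(1) torus_exp_def)
    show "(\<Sum>i<p. (torus_angle p x i)\<^sup>2) = 1" using a \<theta>(2) that(2) by simp
  qed
  have "continuous_map ?S (powertop_real UNIV) ?g"
    unfolding continuous_map_componentwise_UNIV
  proof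
    fix i
    show "continuous_map ?S euclideanreal (\<lambda>z. torus_angle p (snd z) i)"
    proof (cases "i < p")
      case True
      have c: "continuous_map ?S euclidean ((\<lambda>x. x i) \<circ> snd)"
        by (rule continuous_map_compose[OF snd continuous_map_torus_coordinate[OF True]])
      have "continuous_map ?S euclidean (\<lambda>z. (\<lambda>w. arcsin (Im w)) (((\<lambda>x. x i) \<circ> snd) z))"
      proof (rule continuous_map_compose_on[OF c])
        show "((\<lambda>x. x i) \<circ> snd) z \<in> {w. \<bar>Im w\<bar> \<le> 1}" if "z \<in> topspace ?S" for z
          using that torus_coordinate_bounds(2)[of "snd z" p i] True unfolding Stop connecting_sphere_eq by auto
        show "continuous_on {w. \<bar>Im w\<bar> \<le> 1} (\<lambda>w. arcsin (Im w))"
          by (intro continuous_intros) (auto simp: abs_le_iff)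
      qed
      then show ?thesis using True by (simp add: torus_angle_def)
    qed (simp add: torus_angle_def)
  qed
  moreover have "?g z \<in> topspace (nsphere (p - 1))" if "z \<in> topspace ?S" for z
  proof -
    have "torus_angle p x i = 0" if "p \<le> i" for x i using that by (simp add: torus_angle_def)
    then show ?thesis using \<open>z \<in> topspace ?S\<close> unfolding Stop connecting_sphere_eq ns by (auto simp: ang)
  qed
  ultimately have g: "continuous_map ?S (nsphere (p - 1)) ?g"
    unfolding nsphere continuous_map_in_subtopology by auto
  have "homeomorphic_maps (nsphere (p - 1)) ?S ?f ?g"
    unfolding homeomorphic_maps_def
  proof (intro conjI ballI f g)
    show "?g (?f u) = u" if u: "u \<in> topspace (nsphere (p - 1))" for u
    proof
      fix i
      show "?g (?f u) i = u i"
      proof (cases "i < p")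
        case True
        have "arcsin (sin (u i)) = u i" using exp(2)[OF u, of i] by (intro arcsin_sin) (auto simp: abs_le_iff)
        then show ?thesis using True by (simp add: torus_angle_def glue_def torus_exp_def)
      next
        case False
        then show ?thesis using u[unfolded ns] by (simp add: torus_angle_def)
      qed
    qed
    show "?f (?g z) = z" if "z \<in> topspace ?S" for z
      using that unfolding Stop connecting_sphere_eq by (auto simp: ang glue_eq)
  qed
  then show "nsphere (p - 1) homeomorphic_space ?S" by (auto simp: homeomorphic_space_def)
qed

text \<open>Away from the boundary sphere the gluing only adds a tag.\<close>

lemma torus_complement_homeomorphic_part:
  assumes i: "i \<in> {1, 2}"
  shows "subtopology (torus p) (topspace (torus p) - torus_disc p) homeomorphic_space
    subtopology (double_torus p) (torus_part p i)"
proof -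
  let ?Y = "subtopology (torus p) (topspace (torus p) - torus_disc p)"
  let ?T = "subtopology (double_torus p) (torus_part p i)"
  have Y: "topspace ?Y = {x \<in> topspace (torus p). 1 < torus_radius p x}" by (auto simp: torus_disc_eq)
  have T: "topspace ?T = torus_part p i"
    using i unfolding topspace_subtopology topspace_double_torus by auto
  have "continuous_map ?Y (bordered_torus p) id"
    by (rule continuous_map_into_bordered_torus) (auto simp: Y torus_disc_eq continuous_map_from_subtopology)
  then have "continuous_map ?Y (double_torus p) ((\<lambda>x. glue p (i, x)) \<circ> id)"
    by (rule continuous_map_compose[OF _ continuous_map_glue[OF i]])
  then have f: "continuous_map ?Y ?T (\<lambda>x. glue p (i, x))"
    unfolding continuous_map_in_subtopology Y by (auto simp: glue_eq torus_part_eq)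
  have "continuous_map ?T (torus p) snd"
    by (rule continuous_map_from_subtopology)
      (use continuous_map_dt_snd in \<open>auto simp: bordered_torus_def dest: continuous_map_into_fulltopology\<close>)
  then have g: "continuous_map ?T ?Y snd"
    unfolding continuous_map_in_subtopology T by (auto simp: torus_part_def)
  have "homeomorphic_maps ?Y ?T (\<lambda>x. glue p (i, x)) snd"
    unfolding homeomorphic_maps_def
    using f g unfolding Y T by (auto simp: glue_eq torus_part_eq)
  then show ?thesis by (auto simp: homeomorphic_space_def)
qed

lemma finite_type_compactified_part:
  assumes "i \<in> {1, 2}" shows "finite_type_pair (compactified_part p i) {None}"
  by (rule finite_type_pair_iso[OF finite_type_collapsed_torus
        relative_homology_Alexandroff_homeomorphic[OF torus_complement_homeomorphic_part[OF assms]]])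

text \<open>Here finiteness runs backwards along the collapse, from the quotient to the
  pair.\<close>

lemma finite_type_pair_collapse:
  assumes "Hausdorff_space X" "compact_space X" "collar_homotopy X A N k"
    "finite_type_pair (collapsed_space X (topspace X - A)) {None}"
  shows "finite_type_pair X A"
proof (rule finite_type_pair_iso[OF assms(4)])
  fix k'
  have "relative_homology_group k' X A \<cong> relative_homology_group k' (collapsed_space X (topspace X - A)) {None}"
    by (rule is_isoI[OF collapse_relative_homology_iso[OF assms(1-3)]])
  then show "relative_homology_group k' (collapsed_space X (topspace X - A)) {None} \<cong> relative_homology_group k' X A"
    by (simp add: group.iso_sym)
qed

text \<open>Filter the double torus by the sphere, the closed second half A and the whole space. The
  two relative Lefschetz numbers are those of the collapsed tori minus 1 each, which produces the
  summand 2.\<close>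

theorem lefschetz_number_compactified_parts:
  assumes p: "0 < p" and f: "continuous_map (double_torus p) (double_torus p) f"
    and f1: "f ` torus_part p 1 \<subseteq> torus_part p 1" and f2: "f ` torus_part p 2 \<subseteq> torus_part p 2"
    and fS: "f ` connecting_sphere p \<subseteq> connecting_sphere p"
  shows "lefschetz_number (map_option f) (compactified_part p 1) + lefschetz_number (map_option f) (compactified_part p 2)
    = lefschetz_number f (double_torus p) - lefschetz_number f (subtopology (double_torus p) (connecting_sphere p)) + 2"
proof -
  let ?X = "double_torus p" and ?S = "connecting_sphere p"
  define A where "A = torus_part p 2 \<union> ?S"
  let ?XA = "subtopology ?X A"
  have A: "topspace ?X - torus_part p 1 = A" using dt_parts(5)[of 1 p] by (simp add: A_def)
  have T1: "topspace ?X - A = torus_part p 1" "A \<subseteq> topspace ?X"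
    unfolding A[symmetric] using topspace_double_torus by auto
  have T2: "topspace ?XA - ?S = torus_part p 2" "?S \<subseteq> A" "torus_part p 2 \<subseteq> A"
    using T1(2) dt_parts(1,2)[of 2 p] by (auto simp: A_def)
  have fA: "f ` A \<subseteq> A" using f2 fS by (auto simp: A_def)
  have fXA: "continuous_map ?XA ?XA f"
    using f fA by (auto simp: continuous_map_in_subtopology continuous_map_from_subtopology)
  have c1: "collar_homotopy ?X A {z \<in> topspace ?X. side_sign 1 * dt_height p z < 1/4} (dt_collar p)"
    using collar_homotopy_double_torus[OF p, of 1] A by simp
  have c2: "collar_homotopy ?XA ?S {z \<in> A. side_sign 2 * dt_height p z < 1/4} (dt_collar p)"
    using collar_homotopy_double_torus_half[OF p, of 2] by (simp add: A_def)
  have closed: "closedin ?X A" using c1 by (simp add: collar_homotopy_def)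
  have hc: "Hausdorff_space ?XA" "compact_space ?XA"
    using Hausdorff_double_torus compact_double_torus closed
    by (auto simp: Hausdorff_space_subtopology closedin_compact_space compact_space_subtopology)
  have sub: "subtopology ?XA (torus_part p 2) = subtopology ?X (torus_part p 2)"
    "subtopology ?XA ?S = subtopology ?X ?S"
    using T2 by (auto simp: subtopology_subtopology Int_absorb1)
  have ft1: "finite_type_pair ?X A"
    by (rule finite_type_pair_collapse[OF Hausdorff_double_torus compact_double_torus c1])
      (use finite_type_compactified_part[of 1 p] T1 in simp)
  have ft2: "finite_type_pair ?XA ?S"
    by (rule finite_type_pair_collapse[OF hc c2])
      (use finite_type_compactified_part[of 2 p] T2 sub in simp)
  have ftS: "finite_type (subtopology ?XA ?S)"
    unfolding sub by (rule finite_type_connecting_sphere[OF p])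
  have ftA: "finite_type ?XA" by (rule finite_type_total[OF ftS ft2])
  have "lefschetz_number f ?X = lefschetz_number f ?XA + relative_lefschetz_number f ?X A"
    by (rule lefschetz_number_pair[OF f _ ftA ft1]) (use fA in blast)
  moreover have "lefschetz_number f ?XA = lefschetz_number f (subtopology ?XA ?S) + relative_lefschetz_number f ?XA ?S"
    by (rule lefschetz_number_pair[OF fXA _ ftS ft2]) (use fS in blast)
  moreover have "lefschetz_number (map_option f) (collapsed_space ?X (topspace ?X - A)) = 1 + relative_lefschetz_number f ?X A"
    by (rule lefschetz_number_collapse[OF Hausdorff_double_torus compact_double_torus c1 ft1 f fA])
      (use f1 T1 in simp)
  moreover have "lefschetz_number (map_option f) (collapsed_space ?XA (topspace ?XA - ?S)) = 1 + relative_lefschetz_number f ?XA ?S"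
    by (rule lefschetz_number_collapse[OF hc c2 ft2 fXA fS]) (use f2 T2 in simp)
  ultimately show ?thesis using T1 T2 sub by simp
qed

section \<open>Homotopy invariance of the Euclidean fixed point index\<close>

lemma infinite_cyclic_generator:
  assumes "G \<cong> integer_group" "group G"
  obtains s where "s \<in> carrier G" "\<And>k::int. s [^]\<^bsub>G\<^esub> k = \<one>\<^bsub>G\<^esub> \<Longrightarrow> k = 0"
proof -
  obtain h where h: "h \<in> iso G integer_group" using assms(1) by (auto simp: is_iso_def)
  have hom: "h \<in> hom G integer_group" and bij: "h ` carrier G = UNIV"
    using h by (auto simp: iso_def bij_betw_def)
  interpret h: group_hom G integer_group h
    using assms(2) hom by (simp add: group_hom_def group_hom_axioms_def)
  obtain s where s: "s \<in> carrier G" "h s = 1" using bij by (metis UNIV_I imageE)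
  have "k = 0" if "s [^]\<^bsub>G\<^esub> (k::int) = \<one>\<^bsub>G\<^esub>" for k
    using h.hom_int_pow[OF s(1), of k] that s(2) by simp
  then show ?thesis using that s(1) by blast
qed

definition euclidean_ball :: "nat \<Rightarrow> real \<Rightarrow> (nat \<Rightarrow> real) set" where
  "euclidean_ball n R = {v \<in> topspace (Euclidean_space n). (\<Sum>i<n. (v i)\<^sup>2) \<le> R\<^sup>2}"

lemma continuous_map_Euclidean_projection:
  "continuous_map (Euclidean_space n) euclideanreal (\<lambda>x. x i)"
  unfolding Euclidean_space_def
  by (intro continuous_map_from_subtopology continuous_map_product_projection) simp

lemma continuous_map_into_Euclidean_space:
  assumes "\<And>i. i < n \<Longrightarrow> continuous_map Z euclideanreal (\<lambda>z. g z i)"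
    "\<And>z i. z \<in> topspace Z \<Longrightarrow> n \<le> i \<Longrightarrow> g z i = 0"
  shows "continuous_map Z (Euclidean_space n) g"
proof -
  have "continuous_map Z euclideanreal (\<lambda>z. g z i)" for i
  proof (cases "i < n")
    case False
    have "continuous_map Z euclideanreal (\<lambda>z. 0)" by simp
    then show ?thesis by (rule continuous_map_eq) (use assms(2) False in simp)
  qed (rule assms(1))
  then show ?thesis
    using assms(2) unfolding Euclidean_space_def continuous_map_in_subtopology continuous_map_componentwise_UNIV
    by auto
qed

lemma hom_induced_subsets:
  assumes "A \<subseteq> B" "B \<subseteq> C"
  shows "hom_induced p X B X C id (hom_induced p X A X B id x) = hom_induced p X A X C id x"
  using hom_induced_compose'[of X X id A B X id C p x] assms by fastforce

lemma homology_excision_open: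
  assumes U: "openin X U" and K: "closedin X K" "K \<subseteq> U"
  shows "hom_induced p (subtopology X U) (U - K) X (topspace X - K) id
    \<in> iso (relative_homology_group p (subtopology X U) (U - K)) (relative_homology_group p X (topspace X - K))"
proof -
  have U': "U \<subseteq> topspace X" using U openin_subset by blast
  have "X closure_of (topspace X - U) \<subseteq> X interior_of (topspace X - K)"
    unfolding closure_of_closedin[OF closedin_diff[OF closedin_topspace U]]
      interior_of_openin[OF openin_diff[OF openin_topspace K(1)]]
    using K(2) by blast
  moreover have "topspace X - K \<subseteq> topspace X" by blast
  ultimately have "hom_induced p (subtopology X (topspace X - (topspace X - U))) (topspace X - K - (topspace X - U))
      (subtopology X (topspace X)) (topspace X - K) id
    \<in> iso (relative_homology_group p (subtopology X (topspace X - (topspace X - U))) (topspace X - K - (topspace X - U)))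
        (relative_homology_group p (subtopology X (topspace X)) (topspace X - K))"
    by (rule homology_excision_axiom)
  moreover have "topspace X - (topspace X - U) = U" "topspace X - K - (topspace X - U) = U - K"
    using U' by auto
  ultimately show ?thesis by simp
qed

text \<open>Push a generator for the sphere of dimension n - 1 outwards into the complement of the
  ball and lift it along the boundary isomorphism of the contractible space E. Restricting to the
  complement of 0, taking the boundary and normalising radially gives back the generator, so no
  nontrivial power can vanish.\<close>

lemma exists_infinite_order_local_class:
  fixes R :: real
  assumes n: "0 < n" and R: "0 \<le> R"
  defines "E \<equiv> Euclidean_space n"
  shows "\<exists>c \<in> carrier (relative_homology_group (int n) E (topspace E - euclidean_ball n R)).
    \<forall>k::int. hom_induced (int n) E (topspace E - euclidean_ball n R) E (topspace E - {\<lambda>i. 0}) id c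
        [^]\<^bsub>relative_homology_group (int n) E (topspace E - {\<lambda>i. 0})\<^esub> k
      = \<one>\<^bsub>relative_homology_group (int n) E (topspace E - {\<lambda>i. 0})\<^esub> \<longrightarrow> k = 0"
proof -
  let ?D = "topspace E - euclidean_ball n R" and ?O = "topspace E - {\<lambda>i. 0}"
  let ?S = "nsphere (n - 1)"
  let ?G = "relative_homology_group (int n) E ?O"
  have sum: "(\<Sum>i\<le>n - 1. (u i)\<^sup>2) = (\<Sum>i<n. (u i)\<^sup>2)" for u :: "nat \<Rightarrow> real"
    using n by (intro sum.cong) auto
  have E: "v \<in> topspace E \<longleftrightarrow> (\<forall>i\<ge>n. v i = 0)" for v
    by (simp add: E_def topspace_Euclidean_space)
  have Sn: "u \<in> topspace ?S \<longleftrightarrow> u \<in> topspace E \<and> (\<Sum>i<n. (u i)\<^sup>2) = 1" for u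
    using n unfolding nsphere sum E by (auto simp: Suc_le_eq)
  have zero: "(\<Sum>i<n. (u i)\<^sup>2) = 0 \<longleftrightarrow> u = (\<lambda>i. 0)" if "u \<in> topspace E" for u :: "nat \<Rightarrow> real"
  proof -
    have "(\<Sum>i<n. (u i)\<^sup>2) = 0 \<longleftrightarrow> (\<forall>i\<in>{..<n}. (u i)\<^sup>2 = 0)"
      by (rule sum_nonneg_eq_0_iff) auto
    then show ?thesis using that unfolding E by (auto simp: fun_eq_iff) (metis lessThan_iff not_le)
  qed
  have scale: "(\<Sum>i<n. (a * u i)\<^sup>2) = a\<^sup>2 * (\<Sum>i<n. (u i)\<^sup>2)" for a and u :: "nat \<Rightarrow> real"
    by (simp add: power_mult_distrib sum_distrib_left)
  \<comment> \<open>The factor R + 1 puts the unit sphere strictly outside the ball of radius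
    R.\<close>
  define m where "m u = (\<lambda>i. (R + 1) * u i)" for u :: "nat \<Rightarrow> real"
  define \<nu> where "\<nu> v = (\<lambda>i. v i / sqrt (\<Sum>i<n. (v i)\<^sup>2))" for v :: "nat \<Rightarrow> real"
  have R2: "R\<^sup>2 < (R + 1)\<^sup>2" using R by (intro power_strict_mono) auto
  have mD: "m u \<in> ?D" if "u \<in> topspace ?S" for u
    using that R2 unfolding Sn m_def euclidean_ball_def E_def[symmetric] by (auto simp: E scale)
  have cm: "continuous_map ?S (subtopology E ?D) m"
    unfolding continuous_map_in_subtopology
  proof
    show "continuous_map ?S E m"
      unfolding E_def
    proof (rule continuous_map_into_Euclidean_space)
      show "continuous_map ?S euclideanreal (\<lambda>z. m z i)" for i
        unfolding m_def by (intro continuous_map_real_mult continuous_map_nsphere_projection) simp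
      show "m z i = 0" if "z \<in> topspace ?S" "n \<le> i" for z i
        using that unfolding Sn E m_def by simp
    qed
    show "m \<in> topspace ?S \<rightarrow> ?D" using mD by blast
  qed
  have DO: "?D \<subseteq> ?O"
    by (auto simp: euclidean_ball_def E_def[symmetric])
  have cinc: "continuous_map (subtopology E ?D) (subtopology E ?O) id"
    using DO by (auto simp: continuous_map_in_subtopology continuous_map_from_subtopology)
  have c\<nu>: "continuous_map (subtopology E ?O) ?S \<nu>"
  proof -
    let ?Z = "subtopology E ?O"
    have proj: "continuous_map ?Z euclideanreal (\<lambda>v. v i)" for i
      unfolding E_def by (rule continuous_map_from_subtopology[OF continuous_map_Euclidean_projection])
    have ssum: "continuous_map ?Z euclideanreal (\<lambda>v. \<Sum>i<n. (v i)\<^sup>2)"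
      by (intro continuous_map_sum continuous_map_real_pow proj) auto
    have nrm: "continuous_map ?Z euclideanreal (\<lambda>v. sqrt (\<Sum>i<n. (v i)\<^sup>2))"
      by (rule continuous_map_compose_on[OF ssum, of UNIV]) (auto intro: continuous_intros)
    have nz: "sqrt (\<Sum>i<n. (v i)\<^sup>2) \<noteq> 0" if "v \<in> topspace ?Z" for v
      using that zero[of v] by auto
    have "continuous_map ?Z E \<nu>"
      unfolding E_def
    proof (rule continuous_map_into_Euclidean_space)
      show "continuous_map (subtopology (Euclidean_space n) (topspace (Euclidean_space n) - {\<lambda>i. 0})) euclideanreal (\<lambda>v. \<nu> v i)" for i
        unfolding \<nu>_def using continuous_map_real_divide[OF proj nrm nz] unfolding E_def by blast
      show "\<nu> v i = 0" if "v \<in> topspace (subtopology (Euclidean_space n) (topspace (Euclidean_space n) - {\<lambda>i. 0}))" "n \<le> i" for v i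
        using that unfolding \<nu>_def by (simp add: topspace_Euclidean_space)
    qed
    moreover have "\<nu> v \<in> topspace ?S" if v: "v \<in> topspace ?Z" for v
    proof -
      define q where "q = (\<Sum>i<n. (v i)\<^sup>2)"
      have "q \<ge> 0" "q \<noteq> 0" using nz[OF v] by (auto simp: q_def sum_nonneg)
      moreover have "(\<Sum>i<n. (\<nu> v i)\<^sup>2) = q / (sqrt q)\<^sup>2"
        unfolding \<nu>_def q_def by (simp add: power_divide sum_divide_distrib)
      ultimately have "(\<Sum>i<n. (\<nu> v i)\<^sup>2) = 1" by simp
      moreover have "\<nu> v \<in> topspace E" proof -
        have "v \<in> topspace E" using v by simp
        then show ?thesis unfolding E \<nu>_def by simp
      qed
      ultimately show ?thesis unfolding Sn by simp
    qed
    ultimately show ?thesis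
      unfolding nsphere_def continuous_map_in_subtopology sum using n by (auto simp: E_def Sn)
  qed
  have \<nu>m: "\<nu> (m u) = u" if "u \<in> topspace ?S" for u
    using that R unfolding Sn \<nu>_def m_def scale by (simp add: real_sqrt_mult)
  obtain s where s: "s \<in> carrier (reduced_homology_group (int (n - 1)) ?S)"
    and ord: "\<And>k::int. s [^]\<^bsub>reduced_homology_group (int (n - 1)) ?S\<^esub> k
        = \<one>\<^bsub>reduced_homology_group (int (n - 1)) ?S\<^esub> \<Longrightarrow> k = 0"
    using infinite_cyclic_generator[OF reduced_homology_group_nsphere(1)[of "n - 1"]] by auto
  let ?p = "int n - 1"
  have p: "int (n - 1) = ?p" using n by simp
  note s = s[unfolded p] and ord = ord[unfolded p]
  define d where "d = hom_induced ?p ?S {} (subtopology E ?D) {} m s"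
  have d: "d \<in> carrier (reduced_homology_group ?p (subtopology E ?D))"
    unfolding d_def by (rule hom_induced_reduced[OF s])
  \<comment> \<open>A point of the unit sphere shows that the complement of the ball is nonempty, as
    the boundary isomorphism onto reduced homology requires.\<close>
  have "(\<lambda>i. 0) (0 := 1) \<in> topspace ?S"
    using n unfolding Sn E by (simp add: if_distrib[where f = "\<lambda>x. x\<^sup>2"] cong: if_cong)
  then have "topspace E \<inter> ?D \<noteq> {}" using mD by blast
  then have "hom_boundary (int n) E ?D \<in> iso (relative_homology_group (int n) E ?D)
      (reduced_homology_group ?p (subtopology E ?D))"
    by (intro iso_relative_homology_of_contractible) (simp add: E_def)
  then obtain c where c: "c \<in> carrier (relative_homology_group (int n) E ?D)" "hom_boundary (int n) E ?D c = d"
    using d unfolding iso_iff by (metis (no_types, lifting) imageE)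
  define c0 where "c0 = hom_induced (int n) E ?D E ?O id c"
  have c0: "c0 \<in> carrier ?G" unfolding c0_def by (rule hom_induced_carrier)
  have "hom_boundary (int n) E ?O c0 = hom_induced ?p (subtopology E ?D) {} (subtopology E ?O) {} id d"
  proof -
    have "hom_boundary (int n) E ?O \<circ> hom_induced (int n) E ?D E ?O id =
        hom_induced ?p (subtopology E ?D) {} (subtopology E ?O) {} id \<circ> hom_boundary (int n) E ?D"
      by (rule naturality_hom_induced) (use DO in auto)
    from fun_cong[OF this, of c] show ?thesis by (simp only: comp_apply c0_def c(2))
  qed
  also have "\<dots> = hom_induced ?p ?S {} (subtopology E ?O) {} (id \<circ> m) s"
    unfolding d_def by (rule hom_induced_compose') (use cm cinc in auto)
  finally have "hom_induced ?p (subtopology E ?O) {} ?S {} \<nu> (hom_boundary (int n) E ?O c0) =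
      hom_induced ?p (subtopology E ?O) {} ?S {} \<nu> (hom_induced ?p ?S {} (subtopology E ?O) {} (id \<circ> m) s)"
    by simp
  also have "\<dots> = hom_induced ?p ?S {} ?S {} (\<nu> \<circ> (id \<circ> m)) s"
    by (rule hom_induced_compose') (use continuous_map_compose[OF cm cinc] c\<nu> in auto)
  also have "\<dots> = s"
  proof (rule hom_induced_id_gen)
    show "continuous_map ?S ?S (\<nu> \<circ> (id \<circ> m))"
      by (rule continuous_map_compose[OF continuous_map_compose[OF cm cinc] c\<nu>])
    show "s \<in> carrier (homology_group ?p ?S)" using s carrier_reduced_homology_group_subset by blast
  qed (simp add: \<nu>m)
  finally have bk: "hom_induced ?p (subtopology E ?O) {} ?S {} \<nu> (hom_boundary (int n) E ?O c0) = s" .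
  \<comment> \<open>Normalisation after the boundary map is a homomorphism that sends
    \<open>c0\<close> to the generator s, so a trivial power of \<open>c0\<close> gives a trivial
    power of s.\<close>
  have "k = 0" if k: "c0 [^]\<^bsub>?G\<^esub> (k::int) = \<one>\<^bsub>?G\<^esub>" for k
  proof -
    let ?h = "hom_induced ?p (subtopology E ?O) {} ?S {} \<nu> \<circ> hom_boundary (int n) E ?O"
    have "?h \<in> hom ?G (homology_group ?p ?S)"
      by (rule Group.hom_compose[OF hom_boundary_hom hom_induced_hom])
    then interpret h: group_hom ?G "homology_group ?p ?S" ?h
      by (simp add: group_hom_def group_hom_axioms_def)
    have "s [^]\<^bsub>homology_group ?p ?S\<^esub> k = ?h (c0 [^]\<^bsub>?G\<^esub> k)"
      using h.hom_int_pow[OF c0, of k] by (simp only: comp_apply bk)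
    also have "\<dots> = \<one>\<^bsub>homology_group ?p ?S\<^esub>" unfolding k by (rule h.hom_one)
    finally have "s [^]\<^bsub>homology_group ?p ?S\<^esub> k = \<one>\<^bsub>homology_group ?p ?S\<^esub>" .
    moreover have "s [^]\<^bsub>reduced_homology_group ?p ?S\<^esub> k = s [^]\<^bsub>homology_group ?p ?S\<^esub> k"
      using s unfolding reduced_homology_group_def by (intro group.int_pow_subgroup_generated) auto
    ultimately show "k = 0" using ord[of k] by (simp add: one_reduced_homology_group)
  qed
  then show ?thesis using c(1) unfolding c0_def by blast
qed

text \<open>If the fixed point set of the homotopy over \<open>\<U>\<close> ends before time \<open>1\<close>, the class of \<open>H\<^sub>n(E, E - D)\<close>
  that computes the index at time \<open>0\<close> dies in \<open>H\<^sub>n(I \<times> E, (I \<times> E) - \<K>)\<close>, because it can be pushed to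
  time \<open>1\<close>, where it lives in the complement of \<open>\<K>\<close>.\<close>

lemma euclidean_index_zero:
  fixes G :: "real \<times> (nat \<Rightarrow> real) \<Rightarrow> nat \<Rightarrow> real"
  defines "I \<equiv> top_of_set {0..1::real}"
  assumes ind: "has_euclidean_index n U g k" and n: "0 < n"
    and \<U>: "openin (prod_topology I (Euclidean_space n)) \<U>"
    and G: "continuous_map (subtopology (prod_topology I (Euclidean_space n)) \<U>) (Euclidean_space n) G"
    and comp: "compactin (prod_topology I (Euclidean_space n)) {w \<in> \<U>. G w = snd w}"
    and at0: "\<And>v. (0, v) \<in> \<U> \<Longrightarrow> v \<in> U \<and> G (0, v) = g v"
    and fix0: "\<And>v. v \<in> U \<Longrightarrow> g v = v \<Longrightarrow> (0, v) \<in> \<U>"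
    and at1: "\<And>v. (1, v) \<in> \<U> \<Longrightarrow> G (1, v) \<noteq> v"
  shows "k = 0"
proof -
  define E where "E = Euclidean_space n"
  define K where "K = {v \<in> U. g v = v}"
  define \<K> where "\<K> = {w \<in> \<U>. G w = snd w}"
  let ?P = "prod_topology I E"
  let ?H = "relative_homology_group (int n)"
  let ?O = "topspace E - {\<lambda>i. 0}"
  note \<U> = \<U>[folded E_def] and G = G[folded E_def] and comp = comp[folded E_def \<K>_def]
  obtain R where U: "openin E U" and g: "continuous_map (subtopology E U) E g" and K: "compactin E K"
    and R: "0 \<le> R" "K \<subseteq> euclidean_ball n R"
    and index: "\<And>c z. c \<in> carrier (?H E (topspace E - euclidean_ball n R)) \<Longrightarrow>
        z \<in> carrier (?H (subtopology E U) (U - K)) \<Longrightarrow>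
        hom_induced (int n) (subtopology E U) (U - K) E (topspace E - K) id z =
        hom_induced (int n) E (topspace E - euclidean_ball n R) E (topspace E - K) id c \<Longrightarrow>
        hom_induced (int n) (subtopology E U) (U - K) E ?O (\<lambda>v i. v i - g v i) z =
        hom_induced (int n) E (topspace E - euclidean_ball n R) E ?O id c [^]\<^bsub>?H E ?O\<^esub> k"
    using ind unfolding has_euclidean_index_def Let_def K_def E_def euclidean_ball_def by blast
  have Haus: "Hausdorff_space E" "Hausdorff_space ?P"
    by (simp_all add: E_def I_def Hausdorff_Euclidean_space Hausdorff_space_prod_topology Hausdorff_space_subtopology)
  have \<U>sub: "\<U> \<subseteq> {0..1} \<times> topspace E" using openin_subset[OF \<U>] by (simp add: I_def)
  have norm2: "continuous_map E euclideanreal (\<lambda>v. \<Sum>i<n. (v i)\<^sup>2)"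
    unfolding E_def by (intro continuous_map_sum continuous_map_real_pow continuous_map_Euclidean_projection) auto
  have "compactin euclideanreal ((\<lambda>w. \<Sum>i<n. (snd w i)\<^sup>2) ` \<K>)"
    using image_compactin[OF comp continuous_map_compose[OF continuous_map_snd norm2]] by (simp add: o_def)
  then have "bounded ((\<lambda>w. \<Sum>i<n. (snd w i)\<^sup>2) ` \<K>)"
    using compact_imp_bounded by simp
  then obtain M where "\<And>w. w \<in> \<K> \<Longrightarrow> \<bar>\<Sum>i<n. (snd w i)\<^sup>2\<bar> \<le> M"
    unfolding bounded_real by blast
  then have M: "(\<Sum>i<n. (snd w i)\<^sup>2) \<le> M" if "w \<in> \<K>" for w
    using that abs_le_D1 by blast
  define R' where "R' = R + \<bar>M\<bar> + 1"
  have R': "R \<le> R'" "0 \<le> R'" using R by (auto simp: R'_def)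
  have "M \<le> R'\<^sup>2"
  proof -
    have "1 * (\<bar>M\<bar> + 1) \<le> R' * R'" unfolding R'_def using R by (intro mult_mono) auto
    then show ?thesis by (simp add: power2_eq_square)
  qed
  then have \<K>D: "\<K> \<subseteq> {0..1} \<times> euclidean_ball n R'"
    using M \<U>sub by (force simp: \<K>_def euclidean_ball_def E_def)
  let ?D = "topspace E - euclidean_ball n R" and ?D' = "topspace E - euclidean_ball n R'"
  have "R\<^sup>2 \<le> R'\<^sup>2" using R R' by (intro power_mono) auto
  then have D'D: "?D' \<subseteq> ?D" by (auto simp: euclidean_ball_def)
  have DK: "?D \<subseteq> topspace E - K" using R by auto
  have D0: "?D \<subseteq> ?O" by (auto simp: euclidean_ball_def E_def topspace_Euclidean_space)
  \<comment> \<open>The index formula is available only for the ball of radius R, while the homotopy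
    needs the larger ball. A class c' relative to the complement of the larger ball, restricted to
    c, serves both.\<close>
  obtain c' where c': "c' \<in> carrier (?H E ?D')"
    and ord: "\<And>k::int. hom_induced (int n) E ?D' E ?O id c' [^]\<^bsub>?H E ?O\<^esub> k = \<one>\<^bsub>?H E ?O\<^esub> \<Longrightarrow> k = 0"
    using exists_infinite_order_local_class[OF n R'(2)] unfolding E_def by blast
  define c where "c = hom_induced (int n) E ?D' E ?D id c'"
  have c: "c \<in> carrier (?H E ?D)" unfolding c_def by (rule hom_induced_carrier)
  have cK: "hom_induced (int n) E ?D E (topspace E - K) id c = hom_induced (int n) E ?D' E (topspace E - K) id c'"
    unfolding c_def by (rule hom_induced_subsets[OF D'D DK])
  have c0: "hom_induced (int n) E ?D E ?O id c = hom_induced (int n) E ?D' E ?O id c'"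
    unfolding c_def by (rule hom_induced_subsets[OF D'D D0])
  \<comment> \<open>The slice of \<U> at time 0 may be smaller than U, but it still contains K, so
    by excision the local class can be represented there.\<close>
  define U0 where "U0 = {v \<in> topspace E. (0, v) \<in> \<U>}"
  have slice: "continuous_map E ?P (Pair t)" if "t \<in> {0..1}" for t
    using that by (simp add: continuous_map_pairwise o_def I_def)
  have U0: "openin E U0" unfolding U0_def by (rule openin_continuous_map_preimage[OF slice \<U>]) simp
  have Ksub: "K \<subseteq> topspace E" using K compactin_subset_topspace by blast
  have KU0: "K \<subseteq> U0" "U0 \<subseteq> U" using fix0 at0 Ksub by (auto simp: K_def U0_def)
  have clK: "closedin E K" and cl\<K>: "closedin ?P \<K>"
    using K comp Haus compactin_imp_closedin by auto
  have exc0: "hom_induced (int n) (subtopology E U0) (U0 - K) E (topspace E - K) id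
      \<in> iso (?H (subtopology E U0) (U0 - K)) (?H E (topspace E - K))"
    by (rule homology_excision_open[OF U0 clK KU0(1)])
  have exc1: "hom_induced (int n) (subtopology ?P \<U>) (\<U> - \<K>) ?P (topspace ?P - \<K>) id
      \<in> iso (?H (subtopology ?P \<U>) (\<U> - \<K>)) (?H ?P (topspace ?P - \<K>))"
    by (rule homology_excision_open[OF \<U> cl\<K>]) (auto simp: \<K>_def)
  have "hom_induced (int n) E ?D' E (topspace E - K) id c' \<in> carrier (?H E (topspace E - K))"
    by (rule hom_induced_carrier)
  moreover have "hom_induced (int n) (subtopology E U0) (U0 - K) E (topspace E - K) id
      ` carrier (?H (subtopology E U0) (U0 - K)) = carrier (?H E (topspace E - K))"
    using exc0 by (simp only: iso_iff)
  ultimately have "hom_induced (int n) E ?D' E (topspace E - K) id c' \<in>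
      hom_induced (int n) (subtopology E U0) (U0 - K) E (topspace E - K) id ` carrier (?H (subtopology E U0) (U0 - K))"
    by (simp only:)
  then obtain z' where z': "hom_induced (int n) E ?D' E (topspace E - K) id c' =
      hom_induced (int n) (subtopology E U0) (U0 - K) E (topspace E - K) id z'"
    "z' \<in> carrier (?H (subtopology E U0) (U0 - K))"
    by (rule imageE)
  have incU: "continuous_map (subtopology E U0) (subtopology E U) id"
    using KU0 by (auto simp: continuous_map_in_subtopology continuous_map_from_subtopology)
  define z where "z = hom_induced (int n) (subtopology E U0) (U0 - K) (subtopology E U) (U - K) id z'"
  have z: "z \<in> carrier (?H (subtopology E U) (U - K))" unfolding z_def by (rule hom_induced_carrier)
  have "hom_induced (int n) (subtopology E U) (U - K) E (topspace E - K) id z =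
      hom_induced (int n) (subtopology E U0) (U0 - K) E (topspace E - K) (id \<circ> id) z'"
    unfolding z_def
    by (rule hom_induced_compose'[OF incU]) (use KU0 openin_subset[OF U] in \<open>auto simp: continuous_map_from_subtopology\<close>)
  also have "\<dots> = hom_induced (int n) E ?D E (topspace E - K) id c"
    using z'(1) cK by simp
  finally have power: "hom_induced (int n) (subtopology E U) (U - K) E ?O (\<lambda>v i. v i - g v i) z =
        hom_induced (int n) E ?D E ?O id c [^]\<^bsub>?H E ?O\<^esub> k"
    by (rule index[OF c z])
  \<comment> \<open>The displacement. Within \<U> it avoids 0 exactly off \<K>, so it is a map of
    pairs on (\<U>, \<U> - \<K>).\<close>
  define \<Psi> where "\<Psi> w = (\<lambda>i. snd w i - G w i)" for w
  have j0: "continuous_map (subtopology E U0) (subtopology ?P \<U>) (Pair 0)"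
    unfolding continuous_map_in_subtopology
    using continuous_map_from_subtopology[OF slice[of 0]] by (auto simp: U0_def)
  have c\<Psi>: "continuous_map (subtopology ?P \<U>) E \<Psi>"
  proof -
    have s: "continuous_map (subtopology ?P \<U>) E snd"
      by (rule continuous_map_from_subtopology[OF continuous_map_snd])
    have proj: "continuous_map (subtopology ?P \<U>) euclideanreal (\<lambda>w. snd w i)"
      "continuous_map (subtopology ?P \<U>) euclideanreal (\<lambda>w. G w i)" for i
      using continuous_map_compose[OF s continuous_map_Euclidean_projection[of n i, folded E_def]]
        continuous_map_compose[OF G continuous_map_Euclidean_projection[of n i, folded E_def]]
      by (simp_all add: o_def)
    show ?thesis
    proof (rule continuous_map_into_Euclidean_space[where n = n, folded E_def])
      show "continuous_map (subtopology ?P \<U>) euclideanreal (\<lambda>w. \<Psi> w i)" for i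
        unfolding \<Psi>_def by (rule continuous_map_diff[OF proj])
      show "\<Psi> w i = 0" if "w \<in> topspace (subtopology ?P \<U>)" "n \<le> i" for w i
      proof -
        have "snd w \<in> topspace E" "G w \<in> topspace E"
          using that(1) s G continuous_map_funspace by fastforce+
        then show ?thesis using that(2) by (simp add: \<Psi>_def E_def topspace_Euclidean_space)
      qed
    qed
  qed
  have \<Psi>0: "\<Psi> w \<in> ?O" if "w \<in> \<U> - \<K>" for w
  proof -
    have "w \<in> topspace (subtopology ?P \<U>)" using that openin_subset[OF \<U>] by auto
    then have "\<Psi> w \<in> topspace E" using c\<Psi> continuous_map_funspace by fastforce
    moreover have "\<Psi> w \<noteq> (\<lambda>i. 0)"
    proof
      assume "\<Psi> w = (\<lambda>i. 0)"
      then have "snd w i = G w i" for i unfolding \<Psi>_def by (metis eq_iff_diff_eq_0)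
      then have "G w = snd w" by auto
      then show False using that by (simp add: \<K>_def)
    qed
    ultimately show ?thesis by simp
  qed
  have pair\<K>: "(0, v) \<in> \<K> \<longleftrightarrow> v \<in> K" if "v \<in> U0" for v
    using that at0[of v] by (auto simp: \<K>_def K_def U0_def)
  have j0im: "Pair 0 \<in> (U0 - K) \<rightarrow> \<U> - \<K>" using pair\<K> by (auto simp: U0_def)
  have gim: "(\<lambda>v i. v i - g v i) \<in> (U - K) \<rightarrow> ?O"
  proof
    fix v assume v: "v \<in> U - K"
    have vE: "v \<in> topspace E" using v openin_subset[OF U] by auto
    then have "g v \<in> topspace E"
      using g v continuous_map_funspace[OF g] by auto
    then have "(\<lambda>i. v i - g v i) \<in> topspace E" using vE by (simp add: E_def topspace_Euclidean_space)
    moreover have "(\<lambda>i. v i - g v i) \<noteq> (\<lambda>i. 0)"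
    proof
      assume "(\<lambda>i. v i - g v i) = (\<lambda>i. 0)"
      then have "g v = v" by (metis (no_types, lifting) eq_iff_diff_eq_0 ext)
      then show False using v by (simp add: K_def)
    qed
    ultimately show "(\<lambda>i. v i - g v i) \<in> ?O" by simp
  qed
  have cg: "continuous_map (subtopology E U) E (\<lambda>v i. v i - g v i)"
  proof -
    have proj: "continuous_map (subtopology E U) euclideanreal (\<lambda>v. v i)"
      "continuous_map (subtopology E U) euclideanreal (\<lambda>v. g v i)" for i
      using continuous_map_from_subtopology[OF continuous_map_Euclidean_projection[of n i, folded E_def]]
        continuous_map_compose[OF g continuous_map_Euclidean_projection[of n i, folded E_def]]
      by (simp_all add: o_def)
    show ?thesis
    proof (rule continuous_map_into_Euclidean_space[where n = n, folded E_def])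
      show "continuous_map (subtopology E U) euclideanreal (\<lambda>v. v i - g v i)" for i
        by (rule continuous_map_diff[OF proj])
      show "v i - g v i = 0" if v: "v \<in> topspace (subtopology E U)" "n \<le> i" for v i
      proof -
        have "v \<in> topspace E" "g v \<in> topspace E"
          using v(1) continuous_map_funspace[OF g] by auto
        then show ?thesis using v(2) by (simp add: E_def topspace_Euclidean_space)
      qed
    qed
  qed
  have "hom_induced (int n) (subtopology E U) (U - K) E ?O (\<lambda>v i. v i - g v i) z =
      hom_induced (int n) (subtopology E U0) (U0 - K) E ?O ((\<lambda>v i. v i - g v i) \<circ> id) z'"
    unfolding z_def by (rule hom_induced_compose'[OF incU _ cg gim]) (use KU0 in auto)
  also have "\<dots> = hom_induced (int n) (subtopology E U0) (U0 - K) E ?O (\<Psi> \<circ> Pair 0) z'"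
    by (rule fun_cong[OF hom_induced_eq]) (use at0 in \<open>simp add: \<Psi>_def U0_def\<close>)
  also have "\<dots> = hom_induced (int n) (subtopology ?P \<U>) (\<U> - \<K>) E ?O \<Psi>
      (hom_induced (int n) (subtopology E U0) (U0 - K) (subtopology ?P \<U>) (\<U> - \<K>) (Pair 0) z')"
    by (rule hom_induced_compose'[symmetric, OF j0 j0im c\<Psi>]) (use \<Psi>0 in blast)
  finally have via: "hom_induced (int n) E ?D E ?O id c [^]\<^bsub>?H E ?O\<^esub> k =
      hom_induced (int n) (subtopology ?P \<U>) (\<U> - \<K>) E ?O \<Psi>
      (hom_induced (int n) (subtopology E U0) (U0 - K) (subtopology ?P \<U>) (\<U> - \<K>) (Pair 0) z')"
    using power by simp
  \<comment> \<open>The index at time 0 factors through this class; once y is trivial, so is the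
    k-th power of the local class.\<close>
  define y where "y = hom_induced (int n) (subtopology E U0) (U0 - K) (subtopology ?P \<U>) (\<U> - \<K>) (Pair 0) z'"
  have y: "y \<in> carrier (?H (subtopology ?P \<U>) (\<U> - \<K>))" unfolding y_def by (rule hom_induced_carrier)
  have KK: "Pair 0 \<in> (topspace E - K) \<rightarrow> topspace ?P - \<K>"
  proof
    fix v assume v: "v \<in> topspace E - K"
    have "(0, v) \<notin> \<K>"
    proof
      assume "(0, v) \<in> \<K>"
      moreover from this have "v \<in> U0" using v by (simp add: \<K>_def U0_def)
      ultimately show False using pair\<K> v by blast
    qed
    then show "(0, v) \<in> topspace ?P - \<K>" using v by (simp add: I_def)
  qed
  have "hom_induced (int n) (subtopology ?P \<U>) (\<U> - \<K>) ?P (topspace ?P - \<K>) id y =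
      hom_induced (int n) (subtopology E U0) (U0 - K) ?P (topspace ?P - \<K>) (id \<circ> Pair 0) z'"
    unfolding y_def
    by (rule hom_induced_compose'[OF j0 j0im]) (use openin_subset[OF \<U>] in \<open>auto simp: continuous_map_from_subtopology\<close>)
  also have "id \<circ> Pair 0 = Pair (0::real) \<circ> id" by simp
  also have "hom_induced (int n) (subtopology E U0) (U0 - K) ?P (topspace ?P - \<K>) (Pair 0 \<circ> id) z' =
      hom_induced (int n) E (topspace E - K) ?P (topspace ?P - \<K>) (Pair 0)
        (hom_induced (int n) (subtopology E U0) (U0 - K) E (topspace E - K) id z')"
    by (rule hom_induced_compose'[symmetric, OF _ _ slice KK])
      (use openin_subset[OF U0] in \<open>auto simp: continuous_map_from_subtopology\<close>)
  also have "\<dots> = hom_induced (int n) E (topspace E - K) ?P (topspace ?P - \<K>) (Pair 0)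
        (hom_induced (int n) E ?D' E (topspace E - K) id c')"
    by (simp only: z'(1))
  also have "\<dots> = hom_induced (int n) E ?D' ?P (topspace ?P - \<K>) (Pair 0 \<circ> id) c'"
    by (rule hom_induced_compose'[OF _ _ slice KK]) (use D'D DK in \<open>auto simp del: Diff_iff\<close>)
  \<comment> \<open>Outside the larger ball no point of \<K> occurs at any time, so the inclusion at
    time 0 is homotopic, as a map of pairs, to the inclusion at time 1.\<close>
  also have "\<dots> = hom_induced (int n) E ?D' ?P (topspace ?P - \<K>) (Pair 1) c'"
  proof -
    have "homotopic_with (\<lambda>h. h \<in> ?D' \<rightarrow> topspace ?P - \<K>) E ?P (Pair 0) (Pair 1)"
      unfolding homotopic_with_def
    proof (intro exI[of _ id] conjI ballI allI)
      show "continuous_map (prod_topology (top_of_set {0..1}) E) ?P id" by (simp add: I_def)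
      show "(\<lambda>x. id (t, x)) \<in> ?D' \<rightarrow> topspace ?P - \<K>" if "t \<in> {0..1}" for t
        using that \<K>D by (auto simp: I_def)
    qed auto
    from homology_homotopy_axiom[OF this, of "int n"] show ?thesis by simp
  qed
  \<comment> \<open>At time 1 the whole space misses \<K>, so the map factors through the trivial
    group H_n(E, E).\<close>
  also have "\<dots> = hom_induced (int n) E (topspace E) ?P (topspace ?P - \<K>) (Pair 1) (hom_induced (int n) E ?D' E (topspace E) id c')"
  proof -
    have "Pair 1 \<in> topspace E \<rightarrow> topspace ?P - \<K>" using at1 by (auto simp: I_def \<K>_def)
    then have "hom_induced (int n) E (topspace E) ?P (topspace ?P - \<K>) (Pair 1) (hom_induced (int n) E ?D' E (topspace E) id c')
      = hom_induced (int n) E ?D' ?P (topspace ?P - \<K>) (Pair 1 \<circ> id) c'"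
      by (intro hom_induced_compose' slice) auto
    then show ?thesis by simp
  qed
  also have "\<dots> = \<one>\<^bsub>?H ?P (topspace ?P - \<K>)\<^esub>"
  proof -
    have "trivial_group (?H E (topspace E))" by (rule trivial_relative_homology_group_topspace)
    then have "hom_induced (int n) E ?D' E (topspace E) id c' = \<one>\<^bsub>?H E (topspace E)\<^esub>"
      using hom_induced_carrier[of "int n" E ?D' E "topspace E" id c'] unfolding trivial_group_def by simp
    then show ?thesis
      using hom_one[OF hom_induced_hom[of "int n" E "topspace E" ?P "topspace ?P - \<K>" "Pair 1"]] by simp
  qed
  finally have "hom_induced (int n) (subtopology ?P \<U>) (\<U> - \<K>) ?P (topspace ?P - \<K>) id y = \<one>\<^bsub>?H ?P (topspace ?P - \<K>)\<^esub>" .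
  moreover have "hom_induced (int n) (subtopology ?P \<U>) (\<U> - \<K>) ?P (topspace ?P - \<K>) id \<one>\<^bsub>?H (subtopology ?P \<U>) (\<U> - \<K>)\<^esub>
      = \<one>\<^bsub>?H ?P (topspace ?P - \<K>)\<^esub>"
    by (rule hom_one[OF hom_induced_hom]) simp_all
  \<comment> \<open>Excision for \<K> inside \<U> carries the vanishing back to the class y
    itself.\<close>
  moreover have "inj_on (hom_induced (int n) (subtopology ?P \<U>) (\<U> - \<K>) ?P (topspace ?P - \<K>) id)
      (carrier (?H (subtopology ?P \<U>) (\<U> - \<K>)))"
    using exc1 by (simp add: iso_iff)
  moreover have "\<one>\<^bsub>?H (subtopology ?P \<U>) (\<U> - \<K>)\<^esub> \<in> carrier (?H (subtopology ?P \<U>) (\<U> - \<K>))"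
    by (rule monoid.one_closed[OF group.is_monoid[OF group_relative_homology_group]])
  ultimately have "y = \<one>\<^bsub>?H (subtopology ?P \<U>) (\<U> - \<K>)\<^esub>"
    using y by (metis (no_types, lifting) inj_onD)
  then have "hom_induced (int n) (subtopology ?P \<U>) (\<U> - \<K>) E ?O \<Psi> y = \<one>\<^bsub>?H E ?O\<^esub>"
    using hom_one[OF hom_induced_hom[of "int n" "subtopology ?P \<U>" "\<U> - \<K>" E ?O \<Psi>]] by simp
  then have "hom_induced (int n) E ?D' E ?O id c' [^]\<^bsub>?H E ?O\<^esub> k = \<one>\<^bsub>?H E ?O\<^esub>"
    using via unfolding y_def[symmetric] c0 by simp
  then show "k = 0" by (rule ord)
qed

section \<open>Nielsen classes\<close>

definition join_maps :: "(real \<Rightarrow> 'a) \<Rightarrow> (real \<Rightarrow> 'a) \<Rightarrow> real \<Rightarrow> 'a" where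
  "join_maps a b s = (if s \<le> 1/2 then a (2 * s) else b (2 * s - 1))"

abbreviation unit_interval :: "real topology" where "unit_interval \<equiv> top_of_set {0..1}"

text \<open>The two homotopies run side by side in the path parameter; they fit together in the
  middle because every stage of both takes the value y there.\<close>

lemma homotopic_with_join:
  assumes a: "homotopic_with (\<lambda>h. h 0 = x \<and> h 1 = y) unit_interval X a a'"
    and b: "homotopic_with (\<lambda>h. h 0 = y \<and> h 1 = z) unit_interval X b b'"
  shows "homotopic_with (\<lambda>h. h 0 = x \<and> h 1 = z) unit_interval X (join_maps a b) (join_maps a' b')"
proof -
  let ?I2 = "prod_topology unit_interval unit_interval"
  obtain k where k: "continuous_map ?I2 X k" "\<And>s. k (0, s) = a s" "\<And>s. k (1, s) = a' s"
    "\<And>t. t \<in> {0..1} \<Longrightarrow> k (t, 0) = x \<and> k (t, 1) = y"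
    using a unfolding homotopic_with_def by blast
  obtain l where l: "continuous_map ?I2 X l" "\<And>s. l (0, s) = b s" "\<And>s. l (1, s) = b' s"
    "\<And>t. t \<in> {0..1} \<Longrightarrow> l (t, 0) = y \<and> l (t, 1) = z"
    using b unfolding homotopic_with_def by blast
  let ?h = "\<lambda>w. if snd w \<le> 1/2 then k (fst w, 2 * snd w) else l (fst w, 2 * snd w - 1)"
  have c1: "continuous_map ?I2 euclideanreal fst" "continuous_map ?I2 euclideanreal snd"
    using continuous_map_fst[of unit_interval unit_interval] continuous_map_snd[of unit_interval unit_interval]
    by (auto dest: continuous_map_into_fulltopology)
  have "continuous_map ?I2 X ?h"
  proof (rule continuous_map_cases_le[OF c1(2)])
    show "continuous_map ?I2 euclideanreal (\<lambda>w. 1/2)" by simp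
    have "continuous_map (subtopology ?I2 {w \<in> topspace ?I2. snd w \<le> 1/2}) ?I2 (\<lambda>w. (fst w, 2 * snd w))"
      unfolding continuous_map_pairwise o_def continuous_map_in_subtopology fst_conv snd_conv
      by (intro conjI continuous_map_real_mult continuous_map_from_subtopology c1) auto
    from continuous_map_compose[OF this k(1)]
    show "continuous_map (subtopology ?I2 {w \<in> topspace ?I2. snd w \<le> 1/2}) X (\<lambda>w. k (fst w, 2 * snd w))"
      by (simp add: o_def)
    have "continuous_map (subtopology ?I2 {w \<in> topspace ?I2. 1/2 \<le> snd w}) ?I2 (\<lambda>w. (fst w, 2 * snd w - 1))"
      unfolding continuous_map_pairwise o_def continuous_map_in_subtopology fst_conv snd_conv
      by (intro conjI continuous_map_diff continuous_map_real_mult continuous_map_from_subtopology c1) auto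
    from continuous_map_compose[OF this l(1)]
    show "continuous_map (subtopology ?I2 {w \<in> topspace ?I2. 1/2 \<le> snd w}) X (\<lambda>w. l (fst w, 2 * snd w - 1))"
      by (simp add: o_def)
    show "k (fst w, 2 * snd w) = l (fst w, 2 * snd w - 1)" if "w \<in> topspace ?I2" "snd w = 1/2" for w
    proof -
      obtain t u where w1: "w = (t, u)" by (cases w)
      then have w: "w = (t, u)" "t \<in> {0..1}" using that(1) by simp_all
      then have "2 * u = 1" using that(2) by simp
      then show ?thesis using k(4)[OF w(2)] l(4)[OF w(2)] by (simp add: w(1))
    qed
  qed
  then show ?thesis
    unfolding homotopic_with_def
    by (intro exI[of _ ?h] conjI ballI) (auto simp: join_maps_def k l)
qed

lemma join_maps_compose: "f \<circ> join_maps a b = join_maps (f \<circ> a) (f \<circ> b)"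
  by (auto simp: join_maps_def)

lemma equiv_nielsen_relation:
  assumes f: "continuous_map X X f"
  shows "equiv (fixed_points X f) (nielsen_relation X f)"
proof (rule equivI)
  show "nielsen_relation X f \<subseteq> fixed_points X f \<times> fixed_points X f"
    by (auto simp: nielsen_relation_def)
  show "refl_on (fixed_points X f) (nielsen_relation X f)"
  proof (rule refl_onI)
    fix x assume x: "x \<in> fixed_points X f"
    then have "homotopic_with (\<lambda>h. h 0 = x \<and> h 1 = x) unit_interval X (\<lambda>_. x) (f \<circ> (\<lambda>_. x))"
      by (simp add: fixed_points_def o_def)
    then show "(x, x) \<in> nielsen_relation X f" using x unfolding nielsen_relation_def by blast
  qed
  show "sym (nielsen_relation X f)"
  proof (rule symI)
    fix x y assume "(x, y) \<in> nielsen_relation X f"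
    then obtain \<gamma> where \<gamma>: "x \<in> fixed_points X f" "y \<in> fixed_points X f"
      "homotopic_with (\<lambda>h. h 0 = x \<and> h 1 = y) unit_interval X \<gamma> (f \<circ> \<gamma>)"
      by (auto simp: nielsen_relation_def)
    have "continuous_map unit_interval unit_interval (\<lambda>s. 1 - s)"
      by (auto simp: continuous_map_in_subtopology intro: continuous_intros)
    then have "homotopic_with (\<lambda>h. h 0 = y \<and> h 1 = x) unit_interval X (\<gamma> \<circ> (\<lambda>s. 1 - s)) ((f \<circ> \<gamma>) \<circ> (\<lambda>s. 1 - s))"
      by (rule homotopic_with_compose_continuous_map_right[OF \<gamma>(3)]) auto
    then show "(y, x) \<in> nielsen_relation X f"
      using \<gamma>(1,2) unfolding nielsen_relation_def by (auto simp: comp_assoc)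
  qed
  show "trans (nielsen_relation X f)"
  proof (rule transI)
    fix x y z assume "(x, y) \<in> nielsen_relation X f" "(y, z) \<in> nielsen_relation X f"
    then obtain a b where "x \<in> fixed_points X f" "z \<in> fixed_points X f"
      "homotopic_with (\<lambda>h. h 0 = x \<and> h 1 = y) unit_interval X a (f \<circ> a)"
      "homotopic_with (\<lambda>h. h 0 = y \<and> h 1 = z) unit_interval X b (f \<circ> b)"
      by (auto simp: nielsen_relation_def)
    then show "(x, z) \<in> nielsen_relation X f"
      using homotopic_with_join[of x y X a "f \<circ> a" z b "f \<circ> b"]
      unfolding nielsen_relation_def join_maps_compose[symmetric] by blast
  qed
qed

section \<open>Convex neighbourhoods and straight segments in Euclidean space\<close>

lemma Euclidean_box:
  assumes S: "openin (Euclidean_space n) S" and x: "x \<in> S"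
  obtains \<epsilon> where "\<epsilon> > 0" "{v \<in> topspace (Euclidean_space n). \<forall>i<n. \<bar>v i - x i\<bar> < \<epsilon>} \<subseteq> S"
proof -
  obtain T where T: "openin (powertop_real UNIV) T" "S = T \<inter> {x. \<forall>i\<ge>n. x i = 0}"
    using S by (auto simp: Euclidean_space_def openin_subtopology)
  then obtain U where U: "finite {i. U i \<noteq> UNIV}" "\<And>i. open (U i)" "x \<in> Pi\<^sub>E UNIV U" "Pi\<^sub>E UNIV U \<subseteq> T"
    using x by (auto simp: openin_product_topology_alt)
  have "\<exists>e>0. \<forall>y. \<bar>y - x i\<bar> < e \<longrightarrow> y \<in> U i" for i
  proof -
    have "x i \<in> U i" using U(3) by auto
    then obtain e where "e > 0" "ball (x i) e \<subseteq> U i" using U(2)[of i] open_contains_ball by blast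
    then show ?thesis by (intro exI[of _ e]) (auto simp: subset_iff dist_real_def abs_minus_commute)
  qed
  then obtain e where e: "\<And>i. e i > 0" "\<And>i y. \<bar>y - x i\<bar> < e i \<Longrightarrow> y \<in> U i" by metis
  \<comment> \<open>The element 1 keeps the minimum meaningful for n = 0.\<close>
  define \<epsilon> where "\<epsilon> = Min (insert 1 (e ` {..<n}))"
  have "\<epsilon> > 0" using e(1) by (simp add: \<epsilon>_def)
  moreover have "v \<in> S" if v: "v \<in> topspace (Euclidean_space n)" "\<And>i. i < n \<Longrightarrow> \<bar>v i - x i\<bar> < \<epsilon>" for v
  proof -
    have "v i \<in> U i" for i
    proof (cases "i < n")
      case True
      then have "\<epsilon> \<le> e i" by (simp add: \<epsilon>_def)
      then show ?thesis using e(2)[of "v i" i] v(2)[OF True] by simp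
    next
      case False
      then have "v i = x i" using v(1) x T(2) by (simp add: topspace_Euclidean_space)
      then show ?thesis using e(1)[of i] e(2)[of "v i" i] by simp
    qed
    then have "v \<in> T" using U(4) by auto
    then show ?thesis using v(1) T(2) by (simp add: topspace_Euclidean_space)
  qed
  ultimately show ?thesis using that by blast
qed

lemma openin_Euclidean_box:
  "openin (Euclidean_space n) {v \<in> topspace (Euclidean_space n). \<forall>i<n. \<bar>v i - x i\<bar> < \<epsilon>}"
proof -
  have "openin (Euclidean_space n) {v \<in> topspace (Euclidean_space n). v i \<in> {x i - \<epsilon><..<x i + \<epsilon>}}" for i
    by (rule openin_continuous_map_preimage[OF continuous_map_Euclidean_projection]) simp
  then have "openin (Euclidean_space n) (topspace (Euclidean_space n) \<inter>
      (\<Inter>i<n. {v \<in> topspace (Euclidean_space n). v i \<in> {x i - \<epsilon><..<x i + \<epsilon>}}))"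
    by (induction n) (auto intro!: openin_INT)
  moreover have "topspace (Euclidean_space n) \<inter>
      (\<Inter>i<n. {v \<in> topspace (Euclidean_space n). v i \<in> {x i - \<epsilon><..<x i + \<epsilon>}})
    = {v \<in> topspace (Euclidean_space n). \<forall>i<n. \<bar>v i - x i\<bar> < \<epsilon>}"
    by (auto simp: abs_diff_less_iff)
  ultimately show ?thesis by simp
qed

lemma abs_convex_combination_less:
  fixes a b x :: real
  assumes "0 \<le> s" "s \<le> 1" "\<bar>a - x\<bar> < e" "\<bar>b - x\<bar> < e"
  shows "\<bar>(1 - s) * a + s * b - x\<bar> < e"
proof -
  have "(1 - s) * a + s * b - x = (1 - s) * (a - x) + s * (b - x)" by (simp add: algebra_simps)
  then have "\<bar>(1 - s) * a + s * b - x\<bar> \<le> (1 - s) * \<bar>a - x\<bar> + s * \<bar>b - x\<bar>"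
    using assms abs_triangle_ineq[of "(1 - s) * (a - x)" "s * (b - x)"] by (simp add: abs_mult)
  also have "\<dots> \<le> (1 - s) * max \<bar>a - x\<bar> \<bar>b - x\<bar> + s * max \<bar>a - x\<bar> \<bar>b - x\<bar>"
    using assms by (intro add_mono mult_left_mono) auto
  also have "\<dots> = max \<bar>a - x\<bar> \<bar>b - x\<bar>" by (simp add: algebra_simps)
  also have "\<dots> < e" using assms by simp
  finally show ?thesis .
qed

definition segment_point :: "real \<Rightarrow> (nat \<Rightarrow> real) \<Rightarrow> (nat \<Rightarrow> real) \<Rightarrow> nat \<Rightarrow> real" where
  "segment_point s a b = (\<lambda>i. (1 - s) * a i + s * b i)"

lemma segment_point_simps [simp]: "segment_point 0 a b = a" "segment_point 1 a b = b" "segment_point s a a = a"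
  by (auto simp: segment_point_def algebra_simps)

lemma continuous_map_segment_point:
  assumes s: "continuous_map Z euclideanreal s" and a: "continuous_map Z (Euclidean_space n) a"
    and b: "continuous_map Z (Euclidean_space n) b"
  shows "continuous_map Z (Euclidean_space n) (\<lambda>z. segment_point (s z) (a z) (b z))"
proof (rule continuous_map_into_Euclidean_space)
  have "continuous_map Z euclideanreal (\<lambda>z. a z i)" "continuous_map Z euclideanreal (\<lambda>z. b z i)" for i
    using continuous_map_compose[OF a continuous_map_Euclidean_projection[of n i]]
      continuous_map_compose[OF b continuous_map_Euclidean_projection[of n i]] by (simp_all add: o_def)
  then show "continuous_map Z euclideanreal (\<lambda>z. segment_point (s z) (a z) (b z) i)" for i
    unfolding segment_point_def by (intro continuous_map_add continuous_map_real_mult continuous_map_diff s) auto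
  show "segment_point (s z) (a z) (b z) i = 0" if "z \<in> topspace Z" "n \<le> i" for z i
  proof -
    have "a z \<in> topspace (Euclidean_space n)" "b z \<in> topspace (Euclidean_space n)"
      using that(1) continuous_map_funspace[OF a] continuous_map_funspace[OF b] by auto
    then show ?thesis using that(2) by (simp add: segment_point_def topspace_Euclidean_space)
  qed
qed

lemma segment_point_in_box:
  assumes "s \<in> {0..1}" "a \<in> {v \<in> topspace (Euclidean_space n). \<forall>i<n. \<bar>v i - x i\<bar> < \<epsilon>}"
    "b \<in> {v \<in> topspace (Euclidean_space n). \<forall>i<n. \<bar>v i - x i\<bar> < \<epsilon>}"
  shows "segment_point s a b \<in> {v \<in> topspace (Euclidean_space n). \<forall>i<n. \<bar>v i - x i\<bar> < \<epsilon>}"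
  using assms abs_convex_combination_less[of s] by (simp add: segment_point_def topspace_Euclidean_space)

text \<open>The fat homotopy. Its fixed points are the fixed points of all stages together with
  their times, and its Nielsen relation compares fixed points of different stages.\<close>

definition track_map :: "(real \<times> 'a \<Rightarrow> 'a) \<Rightarrow> real \<times> 'a \<Rightarrow> real \<times> 'a" where
  "track_map H w = (fst w, H w)"

lemma continuous_track_map:
  assumes "continuous_map (prod_topology unit_interval C) C H"
  shows "continuous_map (prod_topology unit_interval C) (prod_topology unit_interval C) (track_map H)"
  using assms continuous_map_fst[of unit_interval C]
  by (simp add: continuous_map_pairwise track_map_def[abs_def] o_def)

text \<open>Nielsen classes are relatively open because the space is a neighbourhood retract. A
  short segment joining nearby fixed points in Euclidean space retracts to a path whose image under
  the track stays close, and the segments between the two paths can again be retracted, leaving the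
  ends in place.\<close>

lemma track_class_open:
  fixes C :: "'a topology"
  assumes H: "continuous_map (prod_topology unit_interval C) C H"
    and V: "openin (Euclidean_space n) V"
    and r: "retraction_maps (subtopology (Euclidean_space n) V) C r e"
    and w0: "w0 \<in> fixed_points (prod_topology unit_interval C) (track_map H)"
  shows "\<exists>N. openin (prod_topology unit_interval C) N \<and> w0 \<in> N \<and>
    (\<forall>w\<in>N \<inter> fixed_points (prod_topology unit_interval C) (track_map H).
       (w0, w) \<in> nielsen_relation (prod_topology unit_interval C) (track_map H))"
proof -
  define E where "E = Euclidean_space n"
  let ?I = unit_interval
  let ?P = "prod_topology ?I C"
  note V = V[folded E_def] and r = r[folded E_def]
  define box where "box x \<epsilon> = {v \<in> topspace E. \<forall>i<n. \<bar>v i - x i\<bar> < \<epsilon>}" for x :: "nat \<Rightarrow> real" and \<epsilon>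
  have openbox: "openin E (box x \<epsilon>)" for x \<epsilon>
    unfolding box_def E_def by (rule openin_Euclidean_box)
  have segbox: "segment_point s a b \<in> box x \<epsilon>" if "s \<in> {0..1}" "a \<in> box x \<epsilon>" "b \<in> box x \<epsilon>" for s a b x \<epsilon>
    using that unfolding box_def E_def by (rule segment_point_in_box)
  have rc: "continuous_map (subtopology E V) C r" and ec: "continuous_map C (subtopology E V) e"
    and re: "\<And>x. x \<in> topspace C \<Longrightarrow> r (e x) = x"
    using r by (auto simp: retraction_maps_def)
  have ecE: "continuous_map C E e" using ec by (rule continuous_map_into_fulltopology)
  have eV: "e x \<in> V" "e x \<in> topspace E" if "x \<in> topspace C" for x
    using that continuous_map_funspace[OF ec] by auto
  have rC: "r v \<in> topspace C" if "v \<in> V" for v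
    using that continuous_map_funspace[OF rc] openin_subset[OF V] by auto
  obtain t0 x0 where w0': "w0 = (t0, x0)" by (cases w0)
  then have x0: "t0 \<in> {0..1}" "x0 \<in> topspace C" "H (t0, x0) = x0"
    using w0 by (auto simp: fixed_points_def track_map_def)
  obtain \<epsilon> where \<epsilon>: "\<epsilon> > 0" "box (e x0) \<epsilon> \<subseteq> V"
    using Euclidean_box[OF V[unfolded E_def] eV(1)[OF x0(2)]] unfolding box_def E_def by blast
  define N0 where "N0 = {x \<in> topspace C. e x \<in> box (e x0) \<epsilon>}"
  have N0: "openin C N0" unfolding N0_def by (rule openin_continuous_map_preimage[OF ecE openbox])
  have x0N0: "x0 \<in> N0" using x0 \<epsilon>(1) eV by (simp add: N0_def box_def)
  let ?IV = "prod_topology ?I (subtopology E V)"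
  have \<rho>: "continuous_map ?IV ?P (\<lambda>w. (fst w, r (snd w)))"
    using continuous_map_compose[OF continuous_map_snd rc] by (simp add: continuous_map_pairwise o_def continuous_map_fst)
  \<comment> \<open>Here the retracted point and its image under H are both embedded in one cube
    inside V. A product neighbourhood of (t0, e x0) within Q is the room in which the short path may
    move.\<close>
  define Q where "Q = {w \<in> topspace ?IV. H (fst w, r (snd w)) \<in> N0} \<inter> {w \<in> topspace ?IV. r (snd w) \<in> N0}"
  have openQ: "openin ?IV Q"
    unfolding Q_def
    using openin_continuous_map_preimage[OF continuous_map_compose[OF \<rho> H] N0]
      openin_continuous_map_preimage[OF continuous_map_compose[OF continuous_map_snd[of ?I "subtopology E V"] rc] N0]
    by (intro openin_Int) (simp_all only: o_def)
  have inQ: "(t0, e x0) \<in> Q"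
    using x0 x0N0 eV[OF x0(2)] re by (simp add: Q_def)
  from openQ[unfolded openin_prod_topology_alt, rule_format, OF inQ]
  obtain A D where AD: "openin ?I A" "openin (subtopology E V) D" "t0 \<in> A" "e x0 \<in> D" "A \<times> D \<subseteq> Q"
    by (elim exE conjE)
  obtain T where T: "open T" "A = {0..1} \<inter> T" using AD(1) by (auto simp: openin_open)
  then obtain d where d: "d > 0" "ball t0 d \<subseteq> T" using AD(3) open_contains_ball by blast
  have "openin E D" using AD(2) V openin_trans_full by blast
  then obtain \<epsilon>' where \<epsilon>': "\<epsilon>' > 0" "box (e x0) \<epsilon>' \<subseteq> D"
    using Euclidean_box[of n D "e x0"] AD(4) unfolding box_def E_def by blast
  define N where "N = ({0..1} \<inter> ball t0 d) \<times> {x \<in> topspace C. e x \<in> box (e x0) \<epsilon>'}"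
  have "openin ?P N"
    unfolding N_def openin_prod_Times_iff
    using openin_continuous_map_preimage[OF ecE openbox] by (auto simp: openin_open)
  moreover have "w0 \<in> N" using x0 d \<epsilon>' eV by (simp add: N_def w0' box_def)
  moreover have "(w0, w) \<in> nielsen_relation ?P (track_map H)"
    if w: "w \<in> N \<inter> fixed_points ?P (track_map H)" for w
  proof -
    obtain t x where w': "w = (t, x)" by (cases w)
    have x: "t \<in> {0..1}" "\<bar>t - t0\<bar> < d" "x \<in> topspace C" "H (t, x) = x" "e x \<in> box (e x0) \<epsilon>'"
      using w by (auto simp: w' N_def fixed_points_def track_map_def dist_real_def)
    define \<tau> where "\<tau> s = (1 - s) * t0 + s * t" for s
    define \<sigma> where "\<sigma> s = segment_point s (e x0) (e x)" for s
    define \<gamma> where "\<gamma> s = r (\<sigma> s)" for s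
    have \<tau>A: "\<tau> s \<in> A" if "s \<in> {0..1}" for s
    proof -
      have "\<bar>\<tau> s - t0\<bar> < d"
        unfolding \<tau>_def using that x(2) d(1) by (intro abs_convex_combination_less) auto
      moreover have "\<tau> s \<in> {0..1}"
        using convexD_alt[OF convex_real_interval(5)[of 0 1] x0(1) x(1), of s] that by (simp add: \<tau>_def)
      ultimately show ?thesis using d(2) T(2) by (auto simp: dist_real_def subset_iff abs_minus_commute)
    qed
    have \<tau>I: "\<tau> s \<in> {0..1}" if "s \<in> {0..1}" for s using \<tau>A[OF that] T(2) by auto
    have e0box: "e x0 \<in> box (e x0) \<epsilon>'" using \<epsilon>'(1) eV(2)[OF x0(2)] by (simp add: box_def)
    have \<sigma>D: "\<sigma> s \<in> D" if "s \<in> {0..1}" for s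
      using segbox[OF that e0box x(5)] \<epsilon>'(2) by (auto simp: \<sigma>_def)
    have Q: "H (\<tau> s, \<gamma> s) \<in> N0" "\<gamma> s \<in> N0" if "s \<in> {0..1}" for s
    proof -
      have "(\<tau> s, \<sigma> s) \<in> Q" using AD(5) \<tau>A[OF that] \<sigma>D[OF that] by blast
      then show "H (\<tau> s, \<gamma> s) \<in> N0" "\<gamma> s \<in> N0" by (auto simp: Q_def \<gamma>_def)
    qed
    \<comment> \<open>Keeps the time coordinate and moves from \<gamma> to its image along segments
      in the cube. At the ends of the path both points coincide, so the segment is constant.\<close>
    let ?h = "\<lambda>w. (\<tau> (snd w), r (segment_point (fst w) (e (\<gamma> (snd w))) (e (H (\<tau> (snd w), \<gamma> (snd w))))))"
    let ?I2 = "prod_topology ?I ?I"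
    have id: "continuous_map ?I euclideanreal (\<lambda>s. s)" by (simp add: continuous_on_id)
    have \<tau>c: "continuous_map ?I ?I \<tau>"
      using \<tau>I unfolding \<tau>_def by (auto simp: continuous_map_in_subtopology intro!: continuous_intros)
    have "continuous_map ?I E \<sigma>"
      unfolding \<sigma>_def E_def using eV[OF x0(2)] eV[OF x(3)]
      by (intro continuous_map_segment_point id) (simp_all add: E_def)
    then have "continuous_map ?I (subtopology E V) \<sigma>"
      using \<sigma>D openin_subset[OF AD(2)] by (auto simp: continuous_map_in_subtopology)
    then have \<gamma>c: "continuous_map ?I C \<gamma>"
      using continuous_map_compose[OF _ rc] unfolding \<gamma>_def o_def by blast
    have \<delta>c: "continuous_map ?I ?P (\<lambda>s. (\<tau> s, \<gamma> s))"
      using \<tau>c \<gamma>c by (simp add: continuous_map_pairwise o_def)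
    have a: "continuous_map ?I2 E (\<lambda>w. e (\<gamma> (snd w)))"
      using continuous_map_compose[OF continuous_map_compose[OF continuous_map_snd[of ?I ?I] \<gamma>c] ecE] by (simp only: o_def)
    have b: "continuous_map ?I2 E (\<lambda>w. e (H (\<tau> (snd w), \<gamma> (snd w))))"
      using continuous_map_compose[OF continuous_map_compose[OF continuous_map_compose[OF continuous_map_snd[of ?I ?I] \<delta>c] H] ecE]
      by (simp only: o_def)
    have "continuous_map ?I2 E (\<lambda>w. segment_point (fst w) (e (\<gamma> (snd w))) (e (H (\<tau> (snd w), \<gamma> (snd w)))))"
      unfolding E_def
      by (rule continuous_map_segment_point[OF continuous_map_into_fulltopology[OF continuous_map_fst] a[unfolded E_def] b[unfolded E_def]])
    moreover have "segment_point u (e (\<gamma> s)) (e (H (\<tau> s, \<gamma> s))) \<in> V" if "u \<in> {0..1}" "s \<in> {0..1}" for u s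
      using segbox[OF that(1), of _ "e x0" \<epsilon>] Q[OF that(2)] \<epsilon>(2) by (auto simp: N0_def)
    ultimately have "continuous_map ?I2 (subtopology E V)
        (\<lambda>w. segment_point (fst w) (e (\<gamma> (snd w))) (e (H (\<tau> (snd w), \<gamma> (snd w)))))"
      by (auto simp: continuous_map_in_subtopology)
    from continuous_map_compose[OF this rc]
    have hc: "continuous_map ?I2 ?P ?h"
      using continuous_map_compose[OF continuous_map_snd[of ?I ?I] \<tau>c]
      unfolding continuous_map_pairwise o_def fst_conv snd_conv by blast
    have ends: "\<tau> 0 = t0" "\<tau> 1 = t" "\<gamma> 0 = x0" "\<gamma> 1 = x"
      using re x0(2) x(3) by (simp_all add: \<tau>_def \<gamma>_def \<sigma>_def)
    have "homotopic_with (\<lambda>h. h 0 = w0 \<and> h 1 = w) ?I ?P (\<lambda>s. (\<tau> s, \<gamma> s)) (track_map H \<circ> (\<lambda>s. (\<tau> s, \<gamma> s)))"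
    proof (subst homotopic_with)
      show "(h 0 = w0 \<and> h 1 = w) = (h' 0 = w0 \<and> h' 1 = w)"
        if "\<And>s. s \<in> topspace ?I \<Longrightarrow> h s = h' s" for h h' :: "real \<Rightarrow> real \<times> 'a"
        using that[of 0] that[of 1] by simp
      have "?h (0, s) = (\<tau> s, \<gamma> s)" "?h (1, s) = (track_map H \<circ> (\<lambda>s. (\<tau> s, \<gamma> s))) s" if "s \<in> {0..1}" for s
        using Q[OF that] re by (auto simp: N0_def track_map_def)
      moreover have "?h (u, 0) = w0" "?h (u, 1) = w" for u
        using x0 x re by (simp_all add: ends w0' w')
      ultimately show "\<exists>h. continuous_map ?I2 ?P h \<and> (\<forall>s\<in>topspace ?I. h (0, s) = (\<tau> s, \<gamma> s)) \<and>
          (\<forall>s\<in>topspace ?I. h (1, s) = (track_map H \<circ> (\<lambda>s. (\<tau> s, \<gamma> s))) s) \<and>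
          (\<forall>t\<in>{0..1}. h (t, 0) = w0 \<and> h (t, 1) = w)"
        using hc by (intro exI[of _ ?h]) simp
    qed
    then show ?thesis using w0 w by (auto simp: nielsen_relation_def)
  qed
  ultimately show ?thesis by blast
qed

text \<open>From left to right, project the path to the space and then contract its time coordinate
  to 0; the ends already have time 0 and stay fixed. From right to left, the path is placed at time
  0.\<close>

lemma track_relation_zero:
  assumes H: "continuous_map (prod_topology unit_interval C) C H"
    and x: "x \<in> fixed_points C (\<lambda>x. H (0, x))" and y: "y \<in> fixed_points C (\<lambda>x. H (0, x))"
  shows "((0, x), (0, y)) \<in> nielsen_relation (prod_topology unit_interval C) (track_map H) \<longleftrightarrow>
    (x, y) \<in> nielsen_relation C (\<lambda>x. H (0, x))"
proof
  let ?I = unit_interval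
  let ?P = "prod_topology ?I C"
  assume "((0, x), (0, y)) \<in> nielsen_relation ?P (track_map H)"
  then obtain \<delta> where \<delta>: "homotopic_with (\<lambda>h. h 0 = (0, x) \<and> h 1 = (0, y)) ?I ?P \<delta> (track_map H \<circ> \<delta>)"
    by (auto simp: nielsen_relation_def)
  have ends: "\<delta> 0 = (0, x)" "\<delta> 1 = (0, y)" using homotopic_with_imp_property[OF \<delta>] by auto
  have \<delta>c: "continuous_map ?I ?P \<delta>" using homotopic_with_imp_continuous_maps[OF \<delta>] by blast
  define \<gamma> where "\<gamma> = snd \<circ> \<delta>"
  have "homotopic_with (\<lambda>h. h 0 = x \<and> h 1 = y) ?I C (snd \<circ> \<delta>) (snd \<circ> (track_map H \<circ> \<delta>))"
    by (rule homotopic_with_compose_continuous_map_left[OF \<delta> continuous_map_snd]) auto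
  then have h1: "homotopic_with (\<lambda>h. h 0 = x \<and> h 1 = y) ?I C \<gamma> (H \<circ> \<delta>)"
    by (simp add: \<gamma>_def track_map_def[abs_def] o_def)
  let ?h = "\<lambda>w. H ((1 - fst w) * fst (\<delta> (snd w)), snd (\<delta> (snd w)))"
  let ?I2 = "prod_topology ?I ?I"
  have d1: "continuous_map ?I2 euclideanreal (\<lambda>w. fst (\<delta> (snd w)))"
    using continuous_map_compose[OF continuous_map_compose[OF continuous_map_snd[of ?I ?I] \<delta>c] continuous_map_fst]
    unfolding o_def by (rule continuous_map_into_fulltopology)
  have d2: "continuous_map ?I2 C (\<lambda>w. snd (\<delta> (snd w)))"
    using continuous_map_compose[OF continuous_map_compose[OF continuous_map_snd[of ?I ?I] \<delta>c] continuous_map_snd]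
    by (simp only: o_def)
  have c: "continuous_map ?I2 euclideanreal (\<lambda>w. (1 - fst w) * fst (\<delta> (snd w)))"
    by (intro continuous_map_real_mult continuous_map_diff d1 continuous_map_into_fulltopology[OF continuous_map_fst]) auto
  have "fst (\<delta> s) \<in> {0..1}" if "s \<in> {0..1}" for s
  proof -
    have "\<delta> s \<in> {0..1} \<times> topspace C"
      using that continuous_map_funspace[OF \<delta>c] by (simp add: Pi_iff)
    then show ?thesis by (simp add: mem_Times_iff)
  qed
  then have "(1 - u) * fst (\<delta> s) \<in> {0..1}" if "u \<in> {0..1}" "s \<in> {0..1}" for u s
    using that mult_mono[of "1 - u" 1 "fst (\<delta> s)" 1] by auto
  then have "continuous_map ?I2 ?I (\<lambda>w. (1 - fst w) * fst (\<delta> (snd w)))"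
    using c by (auto simp: continuous_map_in_subtopology)
  then have "continuous_map ?I2 ?P (\<lambda>w. ((1 - fst w) * fst (\<delta> (snd w)), snd (\<delta> (snd w))))"
    using d2 by (simp add: continuous_map_pairwise o_def)
  from continuous_map_compose[OF this H] have hc: "continuous_map ?I2 C ?h" by (simp add: o_def)
  have "homotopic_with (\<lambda>h. h 0 = x \<and> h 1 = y) ?I C (H \<circ> \<delta>) ((\<lambda>x. H (0, x)) \<circ> \<gamma>)"
    unfolding homotopic_with_def
    using hc ends x y by (intro exI[of _ ?h]) (auto simp: \<gamma>_def fixed_points_def)
  from homotopic_with_trans[OF h1 this] show "(x, y) \<in> nielsen_relation C (\<lambda>x. H (0, x))"
    using x y by (auto simp: nielsen_relation_def)
next
  let ?I = unit_interval
  let ?P = "prod_topology ?I C"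
  assume "(x, y) \<in> nielsen_relation C (\<lambda>x. H (0, x))"
  then obtain \<gamma> where \<gamma>: "homotopic_with (\<lambda>h. h 0 = x \<and> h 1 = y) ?I C \<gamma> ((\<lambda>x. H (0, x)) \<circ> \<gamma>)"
    by (auto simp: nielsen_relation_def)
  have "continuous_map C ?P (Pair 0)" by (simp add: continuous_map_pairwise o_def)
  then have "homotopic_with (\<lambda>h. h 0 = (0, x) \<and> h 1 = (0, y)) ?I ?P (Pair 0 \<circ> \<gamma>) (Pair 0 \<circ> ((\<lambda>x. H (0, x)) \<circ> \<gamma>))"
    by (rule homotopic_with_compose_continuous_map_left[OF \<gamma>]) auto
  moreover have "Pair 0 \<circ> ((\<lambda>x. H (0, x)) \<circ> \<gamma>) = track_map H \<circ> (Pair 0 \<circ> \<gamma>)"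
    by (auto simp: track_map_def)
  ultimately have "\<exists>\<gamma>. homotopic_with (\<lambda>h. h 0 = (0, x) \<and> h 1 = (0, y)) ?I ?P \<gamma> (track_map H \<circ> \<gamma>)"
    by (metis (no_types, lifting))
  then show "((0, x), (0, y)) \<in> nielsen_relation ?P (track_map H)"
    using x y by (auto simp: nielsen_relation_def fixed_points_def track_map_def)
qed

lemma openin_prod_open_subspace:
  assumes "openin Y V" "openin (prod_topology X (subtopology Y V)) S"
  shows "openin (prod_topology X Y) S"
  unfolding openin_prod_topology_alt
proof (intro allI impI)
  fix x y assume "(x, y) \<in> S"
  from assms(2)[unfolded openin_prod_topology_alt, rule_format, OF this]
  obtain A B where "openin X A" "openin (subtopology Y V) B" "x \<in> A" "y \<in> B" "A \<times> B \<subseteq> S"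
    by (elim exE conjE)
  moreover from this(2) have "openin Y B" using assms(1) openin_trans_full by blast
  ultimately show "\<exists>A B. openin X A \<and> openin Y B \<and> x \<in> A \<and> y \<in> B \<and> A \<times> B \<subseteq> S" by blast
qed

text \<open>Suppose that no fixed point of the final stage is linked to x. The track class K of (0,
  x) is compact and isolated, its slice at time 0 is F, and it misses time 1. Transported to
  Euclidean space by the retraction, this is the situation of \<open>euclidean_index_zero\<close>,
  so k would be 0.\<close>

theorem essential_class_persists:
  fixes C :: "'a topology"
  assumes C: "compact_space C" "Hausdorff_space C" and ab: "a \<in> topspace C" "b \<in> topspace C" "a \<noteq> b"
    and H: "continuous_map (prod_topology unit_interval C) C H"
    and F: "F \<in> fixed_points C (\<lambda>x. H (0, x)) // nielsen_relation C (\<lambda>x. H (0, x))"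
    and ind: "has_fixed_point_index C (\<lambda>x. H (0, x)) F k" "k \<noteq> 0" and x: "x \<in> F"
  shows "\<exists>y \<in> fixed_points C (\<lambda>x. H (1, x)).
    ((0, x), (1, y)) \<in> nielsen_relation (prod_topology unit_interval C) (track_map H)"
proof (rule ccontr)
  assume no: "\<not> ?thesis"
  let ?I = unit_interval
  let ?P = "prod_topology ?I C"
  let ?R = "nielsen_relation ?P (track_map H)"
  let ?h0 = "\<lambda>x. H (0, x)"
  define \<F> where "\<F> = fixed_points ?P (track_map H)"
  have Pc: "compact_space ?P" "Hausdorff_space ?P"
    using C by (simp_all add: compact_space_prod_topology compact_space_subtopology
        Hausdorff_space_prod_topology Hausdorff_space_subtopology)
  have ct: "continuous_map ?P ?P (track_map H)" by (rule continuous_track_map[OF H])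
  have equivR: "equiv \<F> ?R" unfolding \<F>_def by (rule equiv_nielsen_relation[OF ct])
  have "continuous_map C ?P (Pair 0)" by (simp add: continuous_map_pairwise o_def)
  from continuous_map_compose[OF this H] have h0: "continuous_map C C ?h0" by (simp add: o_def)
  have equiv0: "equiv (fixed_points C ?h0) (nielsen_relation C ?h0)" by (rule equiv_nielsen_relation[OF h0])
  obtain n V r e W where V: "openin (Euclidean_space n) V"
    and r: "retraction_maps (subtopology (Euclidean_space n) V) C r e"
    and W: "openin C W" "fixed_points C ?h0 \<inter> W = F"
    and index: "has_euclidean_index n {v \<in> V. r v \<in> W} (\<lambda>v. e (?h0 (r v))) k"
    using ind(1) unfolding has_fixed_point_index_def by blast
  define E where "E = Euclidean_space n"
  have rc: "continuous_map (subtopology E V) C r" and ec: "continuous_map C (subtopology E V) e"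
    and re: "\<And>x. x \<in> topspace C \<Longrightarrow> r (e x) = x"
    using r by (auto simp: retraction_maps_def E_def)
  have ecE: "continuous_map C E e" using ec by (rule continuous_map_into_fulltopology)
  have eV: "e x \<in> V" "e x \<in> topspace E" if "x \<in> topspace C" for x
    using that continuous_map_funspace[OF ec] by auto
  have rC: "r v \<in> topspace C" if "v \<in> V" for v
    using that continuous_map_funspace[OF rc] openin_subset[OF V] by (auto simp: E_def)
  have VE: "V \<subseteq> topspace E" using openin_subset[OF V] by (simp add: E_def)
  \<comment> \<open>The local class comes from a sphere of dimension n - 1. Two distinct points of C
    do not embed in a space of dimension 0.\<close>
  have n: "0 < n"
  proof (rule ccontr)
    assume "\<not> 0 < n"
    then have "e a = e b" using eV(2)[OF ab(1)] eV(2)[OF ab(2)] by (auto simp: E_def topspace_Euclidean_space)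
    then show False using re ab by metis
  qed
  have xF: "x \<in> fixed_points C ?h0" using x W by blast
  have x0\<F>: "(0, y) \<in> \<F> \<longleftrightarrow> y \<in> fixed_points C ?h0" for y
    by (auto simp: \<F>_def fixed_points_def track_map_def)
  define K where "K = {w. ((0, x), w) \<in> ?R}"
  have K\<F>: "K \<subseteq> \<F>" by (auto simp: K_def \<F>_def nielsen_relation_def)
  have "\<forall>w\<in>\<F>. \<exists>N. openin ?P N \<and> w \<in> N \<and> (\<forall>w'\<in>N \<inter> \<F>. (w, w') \<in> ?R)"
    unfolding \<F>_def using track_class_open[OF H V r] by blast
  then obtain N where N: "\<And>w. w \<in> \<F> \<Longrightarrow> openin ?P (N w)" "\<And>w. w \<in> \<F> \<Longrightarrow> w \<in> N w"
    "\<And>w w'. w \<in> \<F> \<Longrightarrow> w' \<in> N w \<Longrightarrow> w' \<in> \<F> \<Longrightarrow> (w, w') \<in> ?R"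
    unfolding bchoice_iff by blast
  have sym: "(w', w) \<in> ?R" if "(w, w') \<in> ?R" for w w' using equivE[OF equivR] that by (meson symD)
  have tr: "(w, w'') \<in> ?R" if "(w, w') \<in> ?R" "(w', w'') \<in> ?R" for w w' w''
    using equivE[OF equivR] that by (meson transD)
  have "continuous_map ?P ?P id" by simp
  then have "closedin ?P {w \<in> topspace ?P. track_map H w = id w}"
    by (rule closedin_continuous_maps_eq[OF Pc(2) ct])
  then have cl\<F>: "closedin ?P \<F>" by (simp add: \<F>_def fixed_points_def)
  \<comment> \<open>Removing from the closed set \<F> the neighbourhoods of the points of its other
    classes exhibits K as closed.\<close>
  have "K = \<F> - (\<Union>w\<in>\<F> - K. N w)"
  proof (intro equalityI subsetI)
    fix w assume w: "w \<in> K"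
    have False if "w' \<in> \<F> - K" "w \<in> N w'" for w'
      using N(3)[of w' w] that w K\<F> tr[of "(0, x)" w w'] sym[of w' w] by (auto simp: K_def)
    then show "w \<in> \<F> - (\<Union>w\<in>\<F> - K. N w)" using w K\<F> by blast
  qed (use N(2) in blast)
  moreover have "openin ?P (\<Union>w\<in>\<F> - K. N w)" using N(1) by (intro openin_clauses(3)) auto
  ultimately have "closedin ?P K" using cl\<F> closedin_diff by metis
  then have Kcomp: "compactin ?P K" using Pc(1) closedin_compact_space by blast
  \<comment> \<open>The removed closed set forces the slice at time 0 into W, where the index of F
    is computed. No point of K is lost, since its points at time 0 belong to F.\<close>
  define \<W> where "\<W> = (\<Union>w\<in>K. N w) - {0} \<times> (topspace C - W)"
  have "openin ?P (\<Union>w\<in>K. N w)" using N(1) K\<F> by (intro openin_clauses(3)) auto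
  moreover have "closedin ?P ({0} \<times> (topspace C - W))"
    using W(1) by (simp add: closedin_prod_Times_iff closedin_diff)
  ultimately have \<W>: "openin ?P \<W>" unfolding \<W>_def by (rule openin_diff)
  have \<W>\<F>: "\<W> \<inter> \<F> = K"
  proof (intro equalityI subsetI)
    fix w assume w: "w \<in> \<W> \<inter> \<F>"
    then obtain w' where "w' \<in> K" "w \<in> N w'" by (auto simp: \<W>_def)
    then show "w \<in> K" using N(3)[of w' w] K\<F> w tr[of "(0, x)" w' w] by (auto simp: K_def)
  next
    fix w assume w: "w \<in> K"
    have "y \<in> W" if "w = (0, y)" for y
    proof -
      have y: "y \<in> fixed_points C ?h0" using w that K\<F> x0\<F> by blast
      have "(x, y) \<in> nielsen_relation C ?h0"
        using w track_relation_zero[OF H xF y] that by (simp add: K_def)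
      then have "y \<in> F" using F x equiv0 by (metis in_quotient_imp_closed)
      then show ?thesis using W(2) by blast
    qed
    then show "w \<in> \<W> \<inter> \<F>" using w K\<F> N(2)[of w] by (auto simp: \<W>_def)
  qed
  have FK: "(0, y) \<in> K" if "y \<in> F" for y
  proof -
    have y: "y \<in> fixed_points C ?h0" using that W by blast
    have "(x, y) \<in> nielsen_relation C ?h0" using quotient_eq_iff[OF equiv0 F F x that] by simp
    then show ?thesis using track_relation_zero[OF H xF y] by (simp add: K_def)
  qed
  let ?IV = "prod_topology ?I (subtopology E V)"
  have \<rho>: "continuous_map ?IV ?P (\<lambda>w. (fst w, r (snd w)))"
    using continuous_map_compose[OF continuous_map_snd[of ?I "subtopology E V"] rc]
    by (simp add: continuous_map_pairwise o_def continuous_map_fst)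
  define \<U> where "\<U> = {w \<in> topspace ?IV. (fst w, r (snd w)) \<in> \<W>}"
  define G where "G w = e (H (fst w, r (snd w)))" for w
  have \<U>: "openin (prod_topology ?I E) \<U>"
    unfolding \<U>_def using V by (intro openin_prod_open_subspace[OF _ openin_continuous_map_preimage[OF \<rho> \<W>]])
      (simp add: E_def)
  have Gc: "continuous_map (subtopology (prod_topology ?I E) \<U>) E G"
  proof -
    have "continuous_map ?IV E G"
      using continuous_map_compose[OF continuous_map_compose[OF \<rho> H] ecE] by (simp only: G_def[abs_def] o_def)
    moreover have "?IV = subtopology (prod_topology ?I E) (UNIV \<times> V)" by (simp add: subtopology_Times)
    ultimately have "continuous_map (subtopology (prod_topology ?I E) (UNIV \<times> V)) E G" by simp
    then show ?thesis by (rule continuous_map_from_subtopology_mono) (auto simp: \<U>_def)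
  qed
  \<comment> \<open>If e (H (t, r v)) = v, applying r shows that r v is fixed at time t. The
    solutions in Euclidean space are therefore the embedded points of K, and compactness carries
    over.\<close>
  have zeros: "{w \<in> \<U>. G w = snd w} = (\<lambda>w. (fst w, e (snd w))) ` K"
  proof (intro equalityI subsetI)
    fix w assume w: "w \<in> {w \<in> \<U>. G w = snd w}"
    obtain t v where tv: "w = (t, v)" by (cases w)
    have v: "t \<in> {0..1}" "v \<in> V" "(t, r v) \<in> \<W>" "e (H (t, r v)) = v"
      using w by (auto simp: tv \<U>_def G_def)
    have "(t, r v) \<in> topspace ?P" using v rC by simp
    moreover from this have "H (t, r v) \<in> topspace C" using continuous_map_funspace[OF H] by blast
    then have "H (t, r v) = r v" using re v(4) by metis
    ultimately have "(t, r v) \<in> \<F>" by (simp add: \<F>_def fixed_points_def track_map_def)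
    then have "(t, r v) \<in> K" using v(3) \<W>\<F> by blast
    moreover have "w = (t, e (r v))" using v(4) \<open>H (t, r v) = r v\<close> tv by simp
    ultimately show "w \<in> (\<lambda>w. (fst w, e (snd w))) ` K" by force
  next
    fix w assume "w \<in> (\<lambda>w. (fst w, e (snd w))) ` K"
    then obtain t y where ty: "(t, y) \<in> K" "w = (t, e y)" by auto
    then have y: "t \<in> {0..1}" "y \<in> topspace C" "H (t, y) = y" "(t, y) \<in> \<W>"
      using K\<F> \<W>\<F> by (auto simp: \<F>_def fixed_points_def track_map_def)
    then show "w \<in> {w \<in> \<U>. G w = snd w}"
      using eV[OF y(2)] re[OF y(2)] ty(2) by (simp add: \<U>_def G_def)
  qed
  have "continuous_map ?P (prod_topology ?I E) (\<lambda>w. (fst w, e (snd w)))"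
    using continuous_map_compose[OF continuous_map_snd[of ?I C] ecE]
    by (simp add: continuous_map_pairwise o_def continuous_map_fst)
  from image_compactin[OF Kcomp this]
  have comp: "compactin (prod_topology ?I E) {w \<in> \<U>. G w = snd w}" unfolding zeros .
  have "k = 0"
  proof (rule euclidean_index_zero[OF index n \<U>[unfolded E_def] Gc[unfolded E_def] comp[unfolded E_def]])
    show "v \<in> {v \<in> V. r v \<in> W} \<and> G (0, v) = e (?h0 (r v))" if "(0, v) \<in> \<U>" for v
      using that rC[of v] by (auto simp: \<U>_def G_def \<W>_def)
    show "(0, v) \<in> \<U>" if v: "v \<in> {v \<in> V. r v \<in> W}" "e (?h0 (r v)) = v" for v
    proof -
      have "r v \<in> topspace C" using v rC by blast
      moreover from this have "?h0 (r v) \<in> topspace C" using continuous_map_funspace[OF h0] by blast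
      then have "?h0 (r v) = r v" using re v(2) by metis
      ultimately have "r v \<in> F" using v(1) W(2) by (auto simp: fixed_points_def)
      then have "(0, r v) \<in> \<W>" using FK \<W>\<F> by blast
      then show ?thesis using v(1) VE by (auto simp: \<U>_def)
    qed
    show "G (1, v) \<noteq> v" if v: "(1, v) \<in> \<U>" for v
    proof
      assume "G (1, v) = v"
      then have "(1, v) \<in> {w \<in> \<U>. G w = snd w}" using v by simp
      then have "(1, v) \<in> (\<lambda>w. (fst w, e (snd w))) ` K" unfolding zeros .
      then obtain w where w: "w \<in> K" "(1, v) = (fst w, e (snd w))" by (rule imageE)
      define y where "y = snd w"
      have y: "(1, y) \<in> K" using w by (cases w) (simp add: y_def)
      then have "y \<in> fixed_points C (\<lambda>x. H (1, x))"
        using K\<F> by (auto simp: \<F>_def fixed_points_def track_map_def)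
      then show False using no y by (auto simp: K_def)
    qed
  qed
  then show False using ind(2) by simp
qed

text \<open>Each essential class is assigned a fixed point of the final stage linked to it. Two
  classes with the same assigned point are linked through it, and at time 0 being linked is the
  ordinary Nielsen relation, so the assignment is injective.\<close>

corollary nielsen_number_le_card_fixed_points:
  fixes C :: "'a topology"
  assumes C: "compact_space C" "Hausdorff_space C" and ab: "a \<in> topspace C" "b \<in> topspace C" "a \<noteq> b"
    and H: "continuous_map (prod_topology unit_interval C) C H"
    and fin: "finite (fixed_points C (\<lambda>x. H (1, x)))"
  shows "nielsen_number C (\<lambda>x. H (0, x)) \<le> card (fixed_points C (\<lambda>x. H (1, x)))"
proof -
  let ?P = "prod_topology unit_interval C"
  let ?h0 = "\<lambda>x. H (0, x)"
  let ?Q = "fixed_points C ?h0 // nielsen_relation C ?h0"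
  let ?R = "nielsen_relation ?P (track_map H)"
  let ?Ess = "{F \<in> ?Q. \<exists>k. has_fixed_point_index C ?h0 F k \<and> k \<noteq> 0}"
  have "continuous_map C ?P (Pair 0)" by (simp add: continuous_map_pairwise o_def)
  from continuous_map_compose[OF this H] have "continuous_map C C ?h0" by (simp add: o_def)
  then have eq0: "equiv (fixed_points C ?h0) (nielsen_relation C ?h0)" by (rule equiv_nielsen_relation)
  have eqR: "equiv (fixed_points ?P (track_map H)) ?R"
    by (rule equiv_nielsen_relation[OF continuous_track_map[OF H]])
  have "\<forall>F\<in>?Ess. \<exists>w. fst w \<in> F \<and> snd w \<in> fixed_points C (\<lambda>x. H (1, x)) \<and> ((0, fst w), (1, snd w)) \<in> ?R"
  proof
    fix F assume "F \<in> ?Ess"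
    then obtain k where F: "F \<in> ?Q" "has_fixed_point_index C ?h0 F k" "k \<noteq> 0" by (elim CollectE conjE exE)
    from in_quotient_imp_non_empty[OF eq0 F(1)] obtain x where x: "x \<in> F" by blast
    from essential_class_persists[OF C ab H F x] obtain y
      where "y \<in> fixed_points C (\<lambda>x. H (1, x))" "((0, x), (1, y)) \<in> ?R" by (rule bexE)
    then show "\<exists>w. fst w \<in> F \<and> snd w \<in> fixed_points C (\<lambda>x. H (1, x)) \<and> ((0, fst w), (1, snd w)) \<in> ?R"
      using x by (intro exI[of _ "(x, y)"]) simp
  qed
  from bchoice[OF this] obtain \<omega> where \<omega>: "\<forall>F\<in>?Ess. fst (\<omega> F) \<in> F \<and>
      snd (\<omega> F) \<in> fixed_points C (\<lambda>x. H (1, x)) \<and> ((0, fst (\<omega> F)), (1, snd (\<omega> F))) \<in> ?R" by (rule exE)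
  define \<xi> \<eta> where "\<xi> F = fst (\<omega> F)" and "\<eta> F = snd (\<omega> F)" for F
  have \<xi>: "\<xi> F \<in> F" "\<eta> F \<in> fixed_points C (\<lambda>x. H (1, x))" "((0, \<xi> F), (1, \<eta> F)) \<in> ?R"
    if "F \<in> ?Ess" for F
    using bspec[OF \<omega> that] by (simp_all only: \<xi>_def \<eta>_def)
  have "inj_on \<eta> ?Ess"
  proof (rule inj_onI)
    fix F F' assume F: "F \<in> ?Ess" "F' \<in> ?Ess" "\<eta> F = \<eta> F'"
    have symR: "sym ?R" using eqR by (rule equivE)
    have transR: "trans ?R" using eqR by (rule equivE)
    have "((0, \<xi> F), (1, \<eta> F')) \<in> ?R" using \<xi>(3)[OF F(1)] by (simp only: F(3))
    from transD[OF transR this symD[OF symR \<xi>(3)[OF F(2)]]]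
    have "((0, \<xi> F), (0, \<xi> F')) \<in> ?R" .
    moreover have "\<xi> F \<in> fixed_points C ?h0" "\<xi> F' \<in> fixed_points C ?h0"
      using F \<xi>(1) in_quotient_imp_subset[OF eq0] by blast+
    ultimately have "(\<xi> F, \<xi> F') \<in> nielsen_relation C ?h0" using track_relation_zero[OF H] by blast
    then show "F = F'" using quotient_eq_iff[OF eq0, of F F'] F \<xi>(1) by blast
  qed
  then show ?thesis
    unfolding nielsen_number_def using fin \<xi>(2) by (intro card_inj_on_le) auto
qed

section \<open>From the collapsed tori back to the triad\<close>

lemma closure_of_torus_part:
  assumes i: "i \<in> {1, 2}"
  shows "double_torus p closure_of torus_part p i = torus_part p i \<union> connecting_sphere p"
proof
  have "closedin (double_torus p) (torus_part p i \<union> connecting_sphere p)"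
    unfolding dt_parts(3)[OF i] using closedin_dt_height[of "{0..}" p "side_sign i"] by simp
  then show "double_torus p closure_of torus_part p i \<subseteq> torus_part p i \<union> connecting_sphere p"
    by (intro closure_of_minimal) auto
  have "z \<in> double_torus p closure_of torus_part p i" if z: "z \<in> connecting_sphere p" for z
  proof -
    obtain x where x: "z = (0, x)" "x \<in> topspace (torus p)" "torus_radius p x = 1"
      using z unfolding connecting_sphere_eq by blast
    \<comment> \<open>Scaling by 1 + l s gives a curve that starts on the sphere and lies in part i
      for s > 0. The absolute value keeps it in the bordered torus for all s, so it is continuous on
      the whole line; the bound 1/2 stays in the range of \<open>torus_scale_small\<close>.\<close>
    define l where "l s = min \<bar>s\<bar> (1/2)" for s :: real
    define c where "c s = glue p (i, torus_scale p (l s) x)" for s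
    have l: "0 \<le> l s" "l s \<le> 1/2" for s by (auto simp: l_def)
    have rad: "torus_radius p (torus_scale p (l s) x) = 1 + l s" for s
      using torus_scale_small[OF x(2), of "l s"] x(3) l[of s] by simp
    have "continuous_map euclideanreal euclideanreal l"
      unfolding l_def by (auto intro!: continuous_intros)
    then have "continuous_map euclideanreal (torus p) (\<lambda>s. torus_scale p (l s) x)"
      using x(2) by (intro continuous_map_torus_scale) auto
    then have "continuous_map euclideanreal (bordered_torus p) (\<lambda>s. torus_scale p (l s) x)"
      by (rule continuous_map_into_bordered_torus) (use rad l in simp)
    from continuous_map_compose[OF this continuous_map_glue[OF i]]
    have cc: "continuous_map euclideanreal (double_torus p) c" by (simp only: c_def[abs_def] o_def)
    have "c s \<in> torus_part p i" if "0 < s" for s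
      using rad[of s] torus_scale_in_torus[OF x(2)] that
      by (simp add: c_def glue_eq torus_part_eq l_def)
    then have "double_torus p closure_of (c ` {0<..}) \<subseteq> double_torus p closure_of torus_part p i"
      by (intro closure_of_mono) auto
    moreover have "c ` (euclideanreal closure_of {0<..}) \<subseteq> double_torus p closure_of (c ` {0<..})"
      by (rule continuous_map_image_closure_subset[OF cc])
    moreover have "0 \<in> euclideanreal closure_of {0<..}" by simp
    moreover have "c 0 = z" using x by (simp add: c_def l_def torus_scale_0 glue_eq)
    ultimately show ?thesis by blast
  qed
  moreover have "torus_part p i \<subseteq> double_torus p closure_of torus_part p i"
    using i topspace_double_torus[of p] by (intro closure_of_subset) auto
  ultimately show "torus_part p i \<union> connecting_sphere p \<subseteq> double_torus p closure_of torus_part p i" by blast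
qed

text \<open>The summand 1 accounts for the point at infinity; every other fixed point of the
  collapsed final stage is a genuine fixed point in part i.\<close>

lemma nielsen_number_part_le:
  assumes p: "0 < p" and i: "i \<in> {1, 2}"
    and k: "continuous_map (prod_topology unit_interval (double_torus p)) (double_torus p) k"
    and kf: "\<And>x. k (0, x) = f x"
    and kT: "\<And>t. t \<in> {0..1} \<Longrightarrow> (\<lambda>x. k (t, x)) ` (topspace (double_torus p) - torus_part p i)
                \<subseteq> topspace (double_torus p) - torus_part p i"
    and f: "f ` torus_part p i \<subseteq> torus_part p i"
    and fin: "finite (fixed_points (double_torus p) (\<lambda>x. k (1, x)))"
  shows "nielsen_number (compactified_part p i) (map_option f)
    \<le> card (fixed_points (double_torus p) (\<lambda>x. k (1, x)) \<inter> torus_part p i) + 1"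
proof -
  let ?X = "double_torus p" and ?T = "torus_part p i"
  let ?C = "compactified_part p i"
  have Tsub: "?T \<subseteq> topspace ?X" using i topspace_double_torus[of p] by auto
  have T: "openin ?X ?T"
    unfolding dt_parts(1)[OF i] using openin_dt_height[of "{0<..}" p "side_sign i"] by simp
  have "topspace ?X - ?T \<noteq> {}"
    using collar_homotopy_double_torus[OF p i] by (simp add: collar_homotopy_def)
  then have T': "?T \<noteq> topspace ?X" by auto
  \<comment> \<open>The collapsed torus must have a second point besides infinity. An empty part
    would have empty closure, but its closure contains the connecting sphere.\<close>
  have Tne: "?T \<noteq> {}"
  proof
    assume e: "?T = {}"
    have "double_torus p closure_of torus_part p i = connecting_sphere p"
      unfolding closure_of_torus_part[OF i] using e by simp
    then have "connecting_sphere p = {}" using e by simp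
    then show False using connecting_sphere_nonempty[OF p] by simp
  qed
  \<comment> \<open>Outside the space the values are chosen so that the initial stage equals
    \<open>map_option f\<close> as a function, which is what \<open>nielsen_number\<close> takes as
    its argument.\<close>
  define H where "H w = (if snd w \<in> topspace ?C then collapse_map ?T (\<lambda>x. k (fst w, x)) (snd w)
      else map_option f (snd w))" for w
  have "continuous_map (prod_topology unit_interval ?C) ?C (\<lambda>(t, y). collapse_map ?T (\<lambda>x. k (t, x)) y)"
    by (rule continuous_map_collapse_homotopy[OF Hausdorff_double_torus compact_double_torus T T' k])
      (use kT in blast)
  then have H: "continuous_map (prod_topology unit_interval ?C) ?C H"
    by (rule continuous_map_eq) (auto simp: H_def)
  have H0: "(\<lambda>y. H (0, y)) = map_option f"
  proof
    fix y show "H (0, y) = map_option f y"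
      using collapse_map_eq_map_option[OF f, of y ?X] kf by (simp add: H_def)
  qed
  have sub: "fixed_points ?C (\<lambda>y. H (1, y)) \<subseteq> insert None (Some ` (fixed_points ?X (\<lambda>x. k (1, x)) \<inter> ?T))"
  proof
    fix y assume y: "y \<in> fixed_points ?C (\<lambda>y. H (1, y))"
    show "y \<in> insert None (Some ` (fixed_points ?X (\<lambda>x. k (1, x)) \<inter> ?T))"
    proof (cases y)
      case (Some x)
      then have "x \<in> ?T" "collapse ?T (k (1, x)) = Some x" "x \<in> topspace ?X"
        using y by (auto simp: fixed_points_def H_def collapse_map_def)
      then show ?thesis using Some by (auto simp: fixed_points_def collapse_def split: if_splits)
    qed simp
  qed
  have finS: "finite (insert None (Some ` (fixed_points ?X (\<lambda>x. k (1, x)) \<inter> ?T)))" using fin by simp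
  obtain x where x: "x \<in> ?T" using Tne by blast
  have "nielsen_number ?C (\<lambda>y. H (0, y)) \<le> card (fixed_points ?C (\<lambda>y. H (1, y)))"
    by (rule nielsen_number_le_card_fixed_points[of _ None "Some x"])
      (use Hausdorff_collapsed_space[OF Hausdorff_double_torus compact_double_torus T] H
        finite_subset[OF sub finS] x Tsub in auto)
  also have "\<dots> \<le> card (insert None (Some ` (fixed_points ?X (\<lambda>x. k (1, x)) \<inter> ?T)))"
    by (rule card_mono[OF finS sub])
  also have "\<dots> \<le> card (fixed_points ?X (\<lambda>x. k (1, x)) \<inter> ?T) + 1"
    using fin by (simp add: card_insert_if card_image)
  finally show ?thesis by (simp add: H0)
qed

text \<open>The open halves are disjoint and fixed points on the connecting sphere are counted on
  neither side, so the two estimates add up. A map with infinitely many fixed points counts as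
  infinity and leaves nothing to prove.\<close>

lemma nielsen_numbers_le_triad_nielsen_number:
  assumes p: "0 < p"
    and f1: "f ` torus_part p 1 \<subseteq> torus_part p 1" and f2: "f ` torus_part p 2 \<subseteq> torus_part p 2"
  shows "enat (nielsen_number (compactified_part p 1) (map_option f) +
      nielsen_number (compactified_part p 2) (map_option f) - 2)
    \<le> triad_nielsen_number (double_torus p) (double_torus p closure_of torus_part p 1)
        (double_torus p closure_of torus_part p 2) f"
  unfolding triad_nielsen_number_def
proof (rule INF_greatest)
  let ?X = "double_torus p"
  let ?A1 = "?X closure_of torus_part p 1" and ?A2 = "?X closure_of torus_part p 2"
  let ?N = "\<lambda>i. nielsen_number (compactified_part p i) (map_option f)"
  fix g assume "g \<in> {g. homotopic_with (\<lambda>h. h ` ?A1 \<subseteq> ?A1 \<and> h ` ?A2 \<subseteq> ?A2) ?X ?X f g}"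
  from this[unfolded homotopic_with_def mem_Collect_eq]
  obtain k where k: "continuous_map (prod_topology unit_interval ?X) ?X k"
    and k01: "\<forall>x. k (0, x) = f x" "\<forall>x. k (1, x) = g x"
    and kA: "\<forall>t\<in>{0..1}. (\<lambda>x. k (t, x)) ` ?A1 \<subseteq> ?A1 \<and> (\<lambda>x. k (t, x)) ` ?A2 \<subseteq> ?A2"
    by (elim exE conjE)
  \<comment> \<open>The complement of one open part is the closure of the other, so preserving both
    closures is precisely the condition for collapsing either side.\<close>
  have A: "topspace ?X - torus_part p 1 = ?A2" "topspace ?X - torus_part p 2 = ?A1"
    using dt_parts(5)[of 1 p] dt_parts(5)[of 2 p] closure_of_torus_part[of 1 p] closure_of_torus_part[of 2 p]
    by simp_all
  show "enat (?N 1 + ?N 2 - 2) \<le> enat_card (fixed_points ?X g)"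
  proof (cases "finite (fixed_points ?X g)")
    case True
    let ?G = "fixed_points ?X g"
    have g: "(\<lambda>x. k (1, x)) = g" using k01(2) by (simp add: fun_eq_iff)
    have "?N 1 \<le> card (?G \<inter> torus_part p 1) + 1"
    proof (rule nielsen_number_part_le[OF p _ k k01(1)[rule_format] _ f1, unfolded A g, OF _ _ True])
      show "1 \<in> {1, 2::nat}" by simp
      show "(\<lambda>x. k (t, x)) ` ?A2 \<subseteq> ?A2" if "t \<in> {0..1}" for t using bspec[OF kA that] by (rule conjunct2)
    qed
    moreover have "?N 2 \<le> card (?G \<inter> torus_part p 2) + 1"
    proof (rule nielsen_number_part_le[OF p _ k k01(1)[rule_format] _ f2, unfolded A g, OF _ _ True])
      show "2 \<in> {1, 2::nat}" by simp
      show "(\<lambda>x. k (t, x)) ` ?A1 \<subseteq> ?A1" if "t \<in> {0..1}" for t using bspec[OF kA that] by (rule conjunct1)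
    qed
    moreover have "card (?G \<inter> torus_part p 1) + card (?G \<inter> torus_part p 2) \<le> card ?G"
    proof -
      have "torus_part p 1 \<inter> torus_part p 2 = {}" by (auto simp: torus_part_def)
      then have disj: "(?G \<inter> torus_part p 1) \<inter> (?G \<inter> torus_part p 2) = {}" by blast
      have "card (?G \<inter> torus_part p 1) + card (?G \<inter> torus_part p 2) =
          card ((?G \<inter> torus_part p 1) \<union> (?G \<inter> torus_part p 2))"
        by (rule card_Un_disjoint[OF _ _ disj, symmetric]) (use True in \<open>simp_all only: finite_Int simp_thms\<close>)
      moreover have "(?G \<inter> torus_part p 1) \<union> (?G \<inter> torus_part p 2) \<subseteq> ?G" by blast
      from card_mono[OF True this]
      have "card ((?G \<inter> torus_part p 1) \<union> (?G \<inter> torus_part p 2)) \<le> card ?G" .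
      ultimately show ?thesis by (simp only:)
    qed
    ultimately show ?thesis using True by (simp add: enat_card_def)
  qed (simp add: enat_card_def)
qed

theorem corollary4p7:
  fixes p :: nat and f :: "nat \<times> (nat \<Rightarrow> complex) \<Rightarrow> nat \<times> (nat \<Rightarrow> complex)"
  assumes "p \<ge> 3"
    and "continuous_map (double_torus p) (double_torus p) f"
    and "f ` torus_part p 1 \<subseteq> torus_part p 1"
    and "f ` torus_part p 2 \<subseteq> torus_part p 2"
    and "f ` connecting_sphere p \<subseteq> connecting_sphere p"
    and "open_map (double_torus p) (double_torus p) f"
    and "open_map (compactified_part p 1) (compactified_part p 1) (map_option f)"
    and "open_map (compactified_part p 2) (compactified_part p 2) (map_option f)"
  shows
    "((\<forall>i\<in>{1, 2}. real (nielsen_number (compactified_part p i) (map_option f)) =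
                   lefschetz_number (map_option f) (compactified_part p i)) \<longrightarrow>
      ereal_of_enat (triad_nielsen_number (double_torus p)
          (double_torus p closure_of torus_part p 1)
          (double_torus p closure_of torus_part p 2) f) \<ge>
        ereal (lefschetz_number f (double_torus p)
          - lefschetz_number f (subtopology (double_torus p) (connecting_sphere p)) - 1)) \<and>
     ((\<forall>i\<in>{1, 2}. real (nielsen_number (compactified_part p i) (map_option f)) =
                   - lefschetz_number (map_option f) (compactified_part p i)) \<longrightarrow>
      ereal_of_enat (triad_nielsen_number (double_torus p)
          (double_torus p closure_of torus_part p 1)
          (double_torus p closure_of torus_part p 2) f) \<ge>
        ereal (- lefschetz_number f (double_torus p)
          + lefschetz_number f (subtopology (double_torus p) (connecting_sphere p)) - 5))"
proof -
  let ?N = "\<lambda>i. nielsen_number (compactified_part p i) (map_option f)"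
  let ?L = "\<lambda>i. lefschetz_number (map_option f) (compactified_part p i)"
  let ?t = "triad_nielsen_number (double_torus p) (double_torus p closure_of torus_part p 1)
      (double_torus p closure_of torus_part p 2) f"
  have p: "0 < p" using assms(1) by simp
  have L: "?L 1 + ?L 2 = lefschetz_number f (double_torus p)
      - lefschetz_number f (subtopology (double_torus p) (connecting_sphere p)) + 2"
    by (rule lefschetz_number_compactified_parts[OF p assms(2-5)])
  have "ereal (real (?N 1 + ?N 2 - 2)) = ereal_of_enat (enat (?N 1 + ?N 2 - 2))" by simp
  also have "\<dots> \<le> ereal_of_enat ?t"
    using nielsen_numbers_le_triad_nielsen_number[OF p assms(3,4)] by (simp only: ereal_of_enat_le_iff)
  finally have t: "ereal (real (?N 1 + ?N 2 - 2)) \<le> ereal_of_enat ?t" .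
  \<comment> \<open>Subtraction on naturals is truncated and can only enlarge the value, so the
    inequality points in the useful direction.\<close>
  have N: "real (?N 1) + real (?N 2) - 2 \<le> real (?N 1 + ?N 2 - 2)" by linarith
  show ?thesis
  proof (intro conjI impI)
    assume "\<forall>i\<in>{1, 2}. real (?N i) = ?L i"
    then have "lefschetz_number f (double_torus p)
        - lefschetz_number f (subtopology (double_torus p) (connecting_sphere p)) - 1 \<le> real (?N 1 + ?N 2 - 2)"
      using L N by simp
    then show "ereal (lefschetz_number f (double_torus p)
        - lefschetz_number f (subtopology (double_torus p) (connecting_sphere p)) - 1) \<le> ereal_of_enat ?t"
      using t order_trans ereal_less_eq(3) by blast
  next
    assume "\<forall>i\<in>{1, 2}. real (?N i) = - ?L i"
    then have "- lefschetz_number f (double_torus p)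
        + lefschetz_number f (subtopology (double_torus p) (connecting_sphere p)) - 5 \<le> real (?N 1 + ?N 2 - 2)"
      using L N by simp
    then show "ereal (- lefschetz_number f (double_torus p)
        + lefschetz_number f (subtopology (double_torus p) (connecting_sphere p)) - 5) \<le> ereal_of_enat ?t"
      using t order_trans ereal_less_eq(3) by blast
  qed
qed

end
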